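(* Let $\mathfrak{O}$ be the valuation ring of a (non-Archimedean) local field of characteristic zero and residue characteristic $p$. Let $\mathfrak{g} \subset \mathfrak{n}_d(\mathfrak{O})$ be a Lie subalgebra (over $\mathfrak{O}$) and let $G := \exp(\mathfrak{g}) \le \mathrm{U}_d(\mathfrak{O})$. Suppose that $p \ge d$ and that $\mathfrak{g}$ is an isolated submodule of $\mathfrak{n}_d(\mathfrak{O})$ (i.e. the $\mathfrak{O}$-module quotient $\mathfrak{n}_d(\mathfrak{O})/\mathfrak{g}$ is torsion-free). Then $$\mathsf{Z}_G^{\mathsf{oc}}(T) = \mathsf{Z}^{\mathsf{ask}}_{\mathfrak{g}}(T) \quad\text{and}\quad \mathsf{Z}_G^{\mathsf{cc}}(T) = \mathsf{Z}^{\mathsf{ask}}_{\mathrm{ad}(\mathfrak{g})}(T).$$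
   Context: $\mathfrak{n}_d(\mathfrak{O})$ is the Lie algebra of strictly upper triangular $d\times d$ matrices over $\mathfrak{O}$ with bracket $[a,b]=ab-ba$, and $\mathrm{U}_d(\mathfrak{O})$ is the group of upper unitriangular $d\times d$ matrices; $\exp$ is the matrix exponential (a polynomial map on $\mathfrak{n}_d(\mathfrak{O})$ since $a^d=0$ there). Let $\mathfrak{P}$ be the maximal ideal of $\mathfrak{O}$ and $\mathfrak{O}_n=\mathfrak{O}/\mathfrak{P}^n$. Ask zeta functions: let $V$ be a free $\mathfrak{O}$-module of finite rank and $M\subset \mathrm{End}_{\mathfrak{O}}(V)$ a submodule. Put $V_n = V\otimes_{\mathfrak{O}} \mathfrak{O}_n$ and let $M_n$ be the image of $M$ in $\mathrm{End}(V_n)$ under $a\mapsto a\otimes \mathrm{id}_{\mathfrak{O}_n}$. Then $\mathsf{Z}^{\mathsf{ask}}_M(T)=\sum_{n=0}^\infty \bigl(|M_n|^{-1}\sum_{a\in M_n}|\mathrm{Ker}(a)|\bigr)T^n$. For $\mathsf{Z}^{\mathsf{ask}}_{\mathfrak g}$, $\mathfrak{g}$ acts by right multiplication on row vectors $V=\mathfrak{O}^d$. For $\mathsf{Z}^{\mathsf{ask}}_{\mathrm{ad}(\mathfrak g)}$, $V=\mathfrak{g}$ and $\mathrm{ad}(\mathfrak g)=\{\mathrm{ad}(a): a\in\mathfrak g\}\subset\mathrm{End}(\mathfrak g)$, where $\mathrm{ad}(a)\colon b\mapsto [b,a]$. For a subgroup $G\le \mathrm{GL}_d(\mathfrak{O})$,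 let $G_n$ be its image in $\mathrm{GL}_d(\mathfrak{O}_n)$. The conjugacy class zeta function is $\mathsf{Z}^{\mathsf{cc}}_G(T)=\sum_{n=0}^\infty \mathrm{k}(G_n)T^n$, where $\mathrm{k}(H)$ is the number of conjugacy classes of a finite group $H$. The orbit-counting zeta function is $\mathsf{Z}^{\mathsf{oc}}_G(T)=\sum_{n=0}^\infty |\mathfrak{O}_n^d/G|\,T^n$, where $|\mathfrak{O}_n^d/G|$ is the number of orbits of $G$ acting on row vectors $\mathfrak{O}_n^d$ by right multiplication. *)

theory Defs
  imports
    "Jordan_Normal_Form.Matrix"
    "HOL-Algebra.Module"
    "HOL-Algebra.QuotRing"
    "HOL-Algebra.Ideal_Product"
    "HOL-Algebra.Generated_Groups"
    "HOL-Algebra.Group_Action"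
    "HOL-Computational_Algebra.Formal_Power_Series"
begin

section \<open>Non-Archimedean local fields\<close>

text \<open>A valuation is an integer-valued function whose value at 0 is irrelevant
  (it plays the role of infinity).\<close>

definition val_ring :: "('k::field \<Rightarrow> int) \<Rightarrow> 'k ring" where
  "val_ring v =
    \<lparr>carrier = {x. x = 0 \<or> 0 \<le> v x}, mult = (*), one = 1, zero = 0, add = (+)\<rparr>"

definition max_ideal :: "('k::field \<Rightarrow> int) \<Rightarrow> 'k set" where
  "max_ideal v = {x. x = 0 \<or> 0 < v x}"

text \<open>A field, complete with respect to a normalised discrete valuation,
  with finite residue field.\<close>

locale nonarch_local_field =
  fixes v :: "'k::field \<Rightarrow> int"
  assumes val_mult: "\<lbrakk>x \<noteq> 0; y \<noteq> 0\<rbrakk> \<Longrightarrow> v (x * y) = v x + v y"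
    and val_add: "\<lbrakk>x \<noteq> 0; y \<noteq> 0; x + y \<noteq> 0\<rbrakk> \<Longrightarrow> min (v x) (v y) \<le> v (x + y)"
    and val_normalised: "\<exists>x. x \<noteq> 0 \<and> v x = 1"
    and val_complete:
      "(\<And>N. \<exists>m. \<forall>i\<ge>m. \<forall>j\<ge>m. s i = s j \<or> N \<le> v (s i - s j)) \<Longrightarrow>
        \<exists>l. \<forall>N. \<exists>m::nat. \<forall>i\<ge>m. s i = l \<or> N \<le> v (s i - l)"
    and finite_residue_field: "finite (carrier (val_ring v Quot max_ideal v))"

definition has_characteristic :: "('a, 'b) ring_scheme \<Rightarrow> nat \<Rightarrow> bool" where
  "has_characteristic R p \<longleftrightarrow> (\<forall>n::nat. [n] \<cdot>\<^bsub>R\<^esub> \<one>\<^bsub>R\<^esub> = \<zero>\<^bsub>R\<^esub> \<longleftrightarrow> p dvd n)"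

definition ideal_power :: "('a, 'b) ring_scheme \<Rightarrow> 'a set \<Rightarrow> nat \<Rightarrow> 'a set" where
  "ideal_power R P n = P [^]\<^bsub>ideals_set R\<^esub> n"


section \<open>Ask zeta functions\<close>

definition ideal_times_module ::
    "('a, 'm) ring_scheme \<Rightarrow> 'a set \<Rightarrow> ('a, 'v, 'n) module_scheme \<Rightarrow> 'v set" where
  "ideal_times_module R I V = generate (add_monoid V) {r \<odot>\<^bsub>V\<^esub> x | r x. r \<in> I \<and> x \<in> carrier V}"

text \<open>For an ideal \<open>I\<close>, the tensor product of \<open>V\<close> with \<open>R/I\<close> is realised as \<open>V/IV\<close>.
  Below, \<open>W\<close> is the submodule \<open>IV\<close>. The map on \<open>V/W\<close> induced by \<open>a\<close> sends \<open>x + W\<close> to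
  \<open>a x + W\<close>; for an additive map preserving \<open>W\<close>, all the cosets in the union agree. Induced
  maps are restricted to the cosets so that equal endomorphisms are equal functions.\<close>

definition induced_map ::
    "('a, 'v, 'n) module_scheme \<Rightarrow> 'v set \<Rightarrow> ('v \<Rightarrow> 'v) \<Rightarrow> 'v set \<Rightarrow> 'v set" where
  "induced_map V W a = (\<lambda>X \<in> carrier (V A_Mod W). \<Union>x\<in>X. W +>\<^bsub>V\<^esub> a x)"

definition average_kernel_size ::
    "('a, 'v, 'n) module_scheme \<Rightarrow> 'v set \<Rightarrow> ('v \<Rightarrow> 'v) set \<Rightarrow> rat" where
  "average_kernel_size V W M =
    (let V' = V A_Mod W; M' = induced_map V W ` M
     in inverse (of_nat (card M')) * (\<Sum>a\<in>M'. of_nat (card (kernel V' V' a))))"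

definition ask_zeta ::
    "('a, 'm) ring_scheme \<Rightarrow> 'a set \<Rightarrow> ('a, 'v, 'n) module_scheme \<Rightarrow> ('v \<Rightarrow> 'v) set \<Rightarrow> rat fps"
  where
  "ask_zeta R P V M =
    Abs_fps (\<lambda>n. average_kernel_size V (ideal_times_module R (ideal_power R P n) V) M)"


section \<open>Matrices over a ring given by a record\<close>

text \<open>The operations of the matrix library need a type class on the entries; the rings
  \<open>R/P^n\<close> are only available as records, so products are spelled out.\<close>

definition mat_monoid :: "('a, 'm) ring_scheme \<Rightarrow> nat \<Rightarrow> 'a mat monoid" where
  "mat_monoid R d =
    \<lparr>carrier = {A \<in> carrier_mat d d. elements_mat A \<subseteq> carrier R},
     mult = (\<lambda>A B. mat d d (\<lambda>(i, j). \<Oplus>\<^bsub>R\<^esub>k\<in>{..<d}. A $$ (i, k) \<otimes>\<^bsub>R\<^esub> B $$ (k, j))),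
     one = mat d d (\<lambda>(i, j). if i = j then \<one>\<^bsub>R\<^esub> else \<zero>\<^bsub>R\<^esub>)\<rparr>"

definition general_linear :: "('a, 'm) ring_scheme \<Rightarrow> nat \<Rightarrow> 'a mat monoid" where
  "general_linear R d = units_of (mat_monoid R d)"

definition row_vecs :: "('a, 'm) ring_scheme \<Rightarrow> nat \<Rightarrow> 'a vec set" where
  "row_vecs R d = {x \<in> carrier_vec d. \<forall>i<d. vec_index x i \<in> carrier R}"

definition row_act :: "('a, 'm) ring_scheme \<Rightarrow> nat \<Rightarrow> 'a vec \<Rightarrow> 'a mat \<Rightarrow> 'a vec" where
  "row_act R d x A = vec d (\<lambda>j. \<Oplus>\<^bsub>R\<^esub>i\<in>{..<d}. vec_index x i \<otimes>\<^bsub>R\<^esub> A $$ (i, j))"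


section \<open>Conjugacy class and orbit-counting zeta functions\<close>

definition class_number :: "('g, 'm) monoid_scheme \<Rightarrow> nat" where
  "class_number H = card (orbits H (carrier H) (\<lambda>h x. h \<otimes>\<^bsub>H\<^esub> x \<otimes>\<^bsub>H\<^esub> inv\<^bsub>H\<^esub> h))"

text \<open>The image of a matrix group over \<open>R\<close> in the general linear group over \<open>R/I\<close>.\<close>

definition congruence_quotient ::
    "('a, 'm) ring_scheme \<Rightarrow> 'a set \<Rightarrow> nat \<Rightarrow> 'a mat set \<Rightarrow> 'a set mat monoid" where
  "congruence_quotient R I d G =
    (general_linear (R Quot I) d)\<lparr>carrier := map_mat (\<lambda>x. I +>\<^bsub>R\<^esub> x) ` G\<rparr>"

definition cc_zeta :: "('a, 'm) ring_scheme \<Rightarrow> 'a set \<Rightarrow> nat \<Rightarrow> 'a mat set \<Rightarrow> rat fps" where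
  "cc_zeta R P d G =
    Abs_fps (\<lambda>n. of_nat (class_number (congruence_quotient R (ideal_power R P n) d G)))"

text \<open>The group acts from the right; \<open>orbits\<close> only forms the sets of images, so the side
  of the action does not matter.\<close>

definition oc_zeta :: "('a, 'm) ring_scheme \<Rightarrow> 'a set \<Rightarrow> nat \<Rightarrow> 'a mat set \<Rightarrow> rat fps" where
  "oc_zeta R P d G =
    Abs_fps (\<lambda>n. let I = ideal_power R P n in
      of_nat (card (orbits (congruence_quotient R I d G) (row_vecs (R Quot I) d)
        (\<lambda>g x. row_act (R Quot I) d x g))))"


section \<open>Nilpotent Lie algebras and unipotent groups over the valuation ring\<close>

text \<open>Matrices over the valuation ring are matrices over the field with integral entries.\<close>

definition strict_upper_module :: "('k::field \<Rightarrow> int) \<Rightarrow> nat \<Rightarrow> ('k, 'k mat) module" where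
  "strict_upper_module v d = (module_mat TYPE('k) d d)
    \<lparr>carrier := {a \<in> carrier_mat d d. elements_mat a \<subseteq> carrier (val_ring v) \<and>
      (\<forall>i<d. \<forall>j\<le>i. a $$ (i, j) = 0)}\<rparr>"

definition unitriangular :: "('k::field \<Rightarrow> int) \<Rightarrow> nat \<Rightarrow> 'k mat monoid" where
  "unitriangular v d =
    \<lparr>carrier = {a \<in> carrier_mat d d. elements_mat a \<subseteq> carrier (val_ring v) \<and>
      (\<forall>i<d. a $$ (i, i) = 1) \<and> (\<forall>i<d. \<forall>j<i. a $$ (i, j) = 0)},
     mult = (*), one = 1\<^sub>m d\<rparr>"

definition lie_subalgebra :: "('k::field \<Rightarrow> int) \<Rightarrow> nat \<Rightarrow> 'k mat set \<Rightarrow> bool" where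
  "lie_subalgebra v d \<gg> \<longleftrightarrow>
    submodule \<gg> (val_ring v) (strict_upper_module v d) \<and>
    (\<forall>a\<in>\<gg>. \<forall>b\<in>\<gg>. a * b - b * a \<in> \<gg>)"

text \<open>The quotient \<open>V/W\<close> is torsion-free; the zero element of the quotient is the coset \<open>W\<close>,
  and \<open>r (x + W) = r x + W\<close>.\<close>

definition isolated_submodule ::
    "('a, 'm) ring_scheme \<Rightarrow> ('a, 'v, 'n) module_scheme \<Rightarrow> 'v set \<Rightarrow> bool" where
  "isolated_submodule R V W \<longleftrightarrow>
    (\<forall>r\<in>carrier R - {\<zero>\<^bsub>R\<^esub>}. \<forall>x\<in>carrier V. W +>\<^bsub>V\<^esub> (r \<odot>\<^bsub>V\<^esub> x) = W \<longrightarrow> W +>\<^bsub>V\<^esub> x = W)"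

text \<open>The exponential series, truncated because the \<open>d\<close>-th power of a strictly upper
  triangular \<open>d \<times> d\<close> matrix vanishes.\<close>

definition nilpotent_exp :: "nat \<Rightarrow> 'k::field_char_0 mat \<Rightarrow> 'k mat" where
  "nilpotent_exp d a = mat d d (\<lambda>(i, j). \<Sum>m<d. (a ^\<^sub>m m) $$ (i, j) / fact m)"

definition row_module :: "('k::field \<Rightarrow> int) \<Rightarrow> nat \<Rightarrow> ('k, 'k vec) module" where
  "row_module v d = (module_vec TYPE('k) d)\<lparr>carrier := row_vecs (val_ring v) d\<rparr>"

text \<open>A Lie subalgebra acting on row vectors by right multiplication, and on itself by
  the adjoint maps \<open>b \<mapsto> [b, a]\<close>.\<close>

definition right_mult_maps :: "('k::field \<Rightarrow> int) \<Rightarrow> nat \<Rightarrow> 'k mat set \<Rightarrow> ('k vec \<Rightarrow> 'k vec) set" where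
  "right_mult_maps v d \<gg> =
    (\<lambda>a. \<lambda>x\<in>carrier (row_module v d). row_act (val_ring v) d x a) ` \<gg>"

definition lie_module :: "nat \<Rightarrow> 'k::field mat set \<Rightarrow> ('k, 'k mat) module" where
  "lie_module d \<gg> = (module_mat TYPE('k) d d)\<lparr>carrier := \<gg>\<rparr>"

definition ad_maps :: "'k::field mat set \<Rightarrow> ('k mat \<Rightarrow> 'k mat) set" where
  "ad_maps \<gg> = (\<lambda>a. \<lambda>b\<in>\<gg>. b * a - a * b) ` \<gg>"

end

theory Submission
  imports Defs
begin

text \<open>
  Burnside's lemma writes both \<open>|O_n^d / G|\<close> and \<open>k(G_n)\<close> as averages
  over \<open>G_n\<close>: of the number of fixed row vectors, and of the order of the centralizer. It remains
  to replace a group element \<open>exp a\<close> by the Lie algebra element \<open>a\<close>. Since \<open>a\<close> is nilpotent, the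
  series \<open>exp a - 1\<close> and \<open>a = log (1 + (exp a - 1))\<close> are polynomials in one another without
  constant term, and their coefficients are integral because \<open>m\<close> is a unit for \<open>0 < m < d \<le> p\<close>.
  Hence, modulo any power of the maximal ideal, \<open>exp a - 1\<close> and \<open>a\<close> annihilate the same row
  vectors (\<open>annihilates_Exp_iff\<close>), \<open>exp a\<close> and \<open>exp b\<close> commute if and only if \<open>a\<close> and \<open>b\<close> do
  (\<open>Exps_commute_iff\<close>), and \<open>exp a\<close> and \<open>exp b\<close> are congruent if and only if \<open>a\<close> and \<open>b\<close> are
  (\<open>Exp_cong_iff\<close>). So fixed vectors of \<open>exp a\<close> are the kernel of \<open>a\<close>, and the centralizer of
  \<open>exp a\<close> is the kernel of \<open>ad a\<close>. On the ask side one averages over the endomorphisms induced by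
  \<open>a\<close>; several residue classes of \<open>a\<close> may induce the same one, but equally many for each
  endomorphism, so that the average is unchanged (\<open>average_over_images\<close>).

  That the exponentials form a group is the Baker--Campbell--Hausdorff theorem
  \<open>BCH_closed\<close>: in a nilpotent setting over a field of characteristic zero, \<open>log (exp a exp b)\<close>
  lies in every Lie algebra containing \<open>a\<close> and \<open>b\<close>. No explicit series is needed. Put
  \<open>Z = log (exp (t a) exp (t b))\<close>, a power series in \<open>t\<close>; applying \<open>t d/dt\<close> to
  \<open>exp Z = exp (t a) exp (t b)\<close> and cancelling \<open>exp Z\<close> gives an identity between iterated brackets,
  which determines the \<open>n\<close>-th coefficient of \<open>Z\<close> from brackets of lower ones. Setting \<open>t = 1\<close> is
  legitimate by nilpotency. The theorem is applied to the Lie algebra that \<open>\<gg>\<close> spans over the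
  field. As \<open>log (exp a exp b)\<close> is also integral, isolation of \<open>\<gg>\<close> puts it back into \<open>\<gg>\<close>
  (\<open>Exp_mult_closed\<close>). Isolation is used a second time to identify \<open>\<gg> / P^n \<gg>\<close> with the image of
  \<open>\<gg>\<close> in the matrices over \<open>O_n\<close> (\<open>ideal_lattice_eq\<close>).

  Noncommutative algebra is carried out in ring types. Upper triangular matrices with
  rows and columns indexed by the natural numbers form such a type, and an upper triangular
  \<open>d \<times> d\<close> matrix is the leading block of one of its elements. Row vectors are included, as matrices
  supported on the first row.
\<close>

section \<open>Power series evaluated at nilpotent elements\<close>

text \<open>The map \<open>s\<close> embeds a field of scalars into the centre of a noncommutative ring. Power
  series are truncated at \<open>D\<close>, which loses nothing at elements with \<open>x ^ D = 0\<close>.\<close>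

locale scalar_ring =
  fixes s :: "'k::field_char_0 \<Rightarrow> 'a::ring_1" and D :: nat
  assumes s_add: "s (x + y) = s x + s y"
    and s_mult: "s (x * y) = s x * s y"
    and s_one: "s 1 = 1"
    and s_central: "s x * a = a * s x"
begin

lemma s_zero [simp]: "s 0 = 0"
  using s_add[of 0 0] by simp

lemma s_sum: "s (sum f A) = (\<Sum>i\<in>A. s (f i))"
  by (induction A rule: infinite_finite_induct) (simp_all add: s_add)

lemma s_of_nat: "s (of_nat n) = of_nat n"
  by (induction n) (simp_all add: s_add s_one)

lemma s_uminus: "s (- x) = - s x"
  using s_add[of x "- x"] by (simp add: eq_neg_iff_add_eq_0 add.commute)

lemma s_left_commute: "a * (s x * b) = s x * (a * b)"
  by (metis mult.assoc s_central)

definition ev :: "'k fps \<Rightarrow> 'a \<Rightarrow> 'a" where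
  "ev f x = (\<Sum>m<D. s (fps_nth f m) * x ^ m)"

definition Exp :: "'a \<Rightarrow> 'a" where "Exp = ev (fps_exp 1)"

definition Log :: "'a \<Rightarrow> 'a" where "Log = ev (fps_ln 1)"

lemma Exp_eq: "Exp x = (\<Sum>m<D. s (1 / fact m) * x ^ m)"
  by (simp add: Exp_def ev_def)

lemma ev_add: "ev (f + g) x = ev f x + ev g x"
  by (simp add: ev_def s_add distrib_right sum.distrib)

lemma ev_diff: "ev (f - g) x = ev f x - ev g x"
  using ev_add[of "f - g" g x] by (simp add: algebra_simps)

lemma power_eq_0_mono: 
  fixes x :: 'a assumes "x ^ D = 0" "D \<le> m" shows "x ^ m = 0"
  using assms by (metis le_add_diff_inverse mult_zero_left power_add)

lemma ev_one: assumes "x ^ D = 0" shows "ev 1 x = 1"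
proof (cases "D = 0")
  case True
  \<comment> \<open>then \<open>1 = x ^ 0 = 0\<close>, so the ring is trivial\<close>
  then show ?thesis using assms by (simp add: ev_def)
next
  case False
  have "ev 1 x = (\<Sum>m<D. if m = 0 then 1 else 0)"
    unfolding ev_def by (intro sum.cong) (auto simp: s_one)
  then show ?thesis using False by simp
qed

lemma ev_X: assumes "x ^ D = 0" shows "ev fps_X x = x"
proof (cases "D \<le> 1")
  case True
  then have "x = 0" using power_eq_0_mono[OF assms, of 1] by simp
  then show ?thesis using True by (auto simp: ev_def fps_X_def intro!: sum.neutral)
next
  case False
  have "ev fps_X x = (\<Sum>m<D. if m = 1 then x else 0)"
    unfolding ev_def by (intro sum.cong) (auto simp: s_one)
  then show ?thesis using False by simp
qed

text \<open>The terms of the product of the two truncated sums beyond degree \<open>D\<close> vanish, because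
  \<open>x ^ D = 0\<close>; what remains is the Cauchy product.\<close>

lemma ev_mult: assumes x: "x ^ D = 0" shows "ev (f * g) x = ev f x * ev g x"
proof -
  define c where "c i j = s (fps_nth f i) * s (fps_nth g j) * x ^ (i + j)" for i j
  have c0: "c i j = 0" if "D \<le> i + j" for i j
    using power_eq_0_mono[OF x that] by (simp add: c_def)
  have "ev f x * ev g x = (\<Sum>i<D. \<Sum>j<D. c i j)"
    unfolding ev_def sum_product c_def
    by (intro sum.cong refl) (metis (no_types, lifting) mult.assoc power_add s_central)
  also have "\<dots> = (\<Sum>(i,j)\<in>{..<D}\<times>{..<D}. c i j)"
    by (simp add: sum.cartesian_product)
  also have "\<dots> = (\<Sum>(i,j)\<in>{(i,j). i + j < D}. c i j)"
  proof -
    have "{(i,j). i + j < D} \<subseteq> {..<D}\<times>{..<D}" by auto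
    then show ?thesis by (intro sum.mono_neutral_right) (auto simp: c0)
  qed
  also have "\<dots> = (\<Sum>n<D. \<Sum>i\<le>n. c i (n - i))"
    by (rule sum.triangle_reindex)
  also have "\<dots> = (\<Sum>n<D. s (fps_nth (f * g) n) * x ^ n)"
  proof (intro sum.cong refl)
    fix n
    show "(\<Sum>i\<le>n. c i (n - i)) = s (fps_nth (f * g) n) * x ^ n"
      by (simp add: fps_mult_nth s_sum s_mult sum_distrib_right c_def atLeast0AtMost)
  qed
  finally show ?thesis by (simp add: ev_def)
qed

lemma ev_power: assumes "x ^ D = 0" shows "ev (f ^ i) x = ev f x ^ i"
  by (induction i) (simp_all add: ev_one ev_mult assms)

text \<open>As \<open>g\<close> has no constant term, \<open>g ^ i\<close> starts in degree \<open>i\<close>. The sum that defines each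
  coefficient of \<open>f oo g\<close> can therefore be extended to all \<open>i < D\<close>, and the two summations
  interchanged.\<close>

lemma ev_compose:
  assumes "x ^ D = 0" and g: "fps_nth g 0 = 0"
  shows "ev (f oo g) x = ev f (ev g x)"
proof -
  have *: "fps_nth (g ^ i) n = 0" if "n < i" for i n
    using that g by (simp add: startsby_zero_power_prefix)
  have "ev (f oo g) x = (\<Sum>n<D. \<Sum>i<D. s (fps_nth f i) * (s (fps_nth (g ^ i) n) * x ^ n))"
    unfolding ev_def
  proof (intro sum.cong refl)
    fix n assume n: "n \<in> {..<D}"
    have "fps_nth (f oo g) n = (\<Sum>i<D. fps_nth f i * fps_nth (g ^ i) n)"
      unfolding fps_compose_nth using n by (intro sum.mono_neutral_left) (auto simp: *)
    then show "s (fps_nth (f oo g) n) * x ^ n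
        = (\<Sum>i<D. s (fps_nth f i) * (s (fps_nth (g ^ i) n) * x ^ n))"
      by (simp add: s_sum s_mult sum_distrib_right mult.assoc)
  qed
  also have "\<dots> = (\<Sum>i<D. s (fps_nth f i) * ev (g ^ i) x)"
    by (subst sum.swap) (simp add: ev_def sum_distrib_left)
  also have "\<dots> = (\<Sum>i<D. s (fps_nth f i) * ev g x ^ i)"
    by (simp add: ev_power assms)
  finally show ?thesis by (simp add: ev_def)
qed

lemma fps_ln_exp: "fps_ln (1::'k) oo (fps_exp 1 - 1) = fps_X"
  and fps_exp_ln: "(fps_exp (1::'k) - 1) oo fps_ln 1 = fps_X"
  by (simp_all add: fps_ln_fps_exp_inv fps_inv fps_inv_right)

lemma Log_Exp: assumes "x ^ D = 0" shows "Log (Exp x - 1) = x"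
proof -
  have "Log (Exp x - 1) = ev (fps_ln 1) (ev (fps_exp 1 - 1) x)"
    by (simp add: Log_def Exp_def ev_diff ev_one assms)
  also have "\<dots> = ev fps_X x"
    by (simp add: fps_ln_exp assms flip: ev_compose)
  finally show ?thesis by (simp add: ev_X assms)
qed

lemma ev_nilpotent:
  assumes "x ^ D = 0" and "fps_nth g 0 = 0"
  shows "ev g x ^ D = 0"
proof -
  have "ev g x ^ D = ev (g ^ D) x" by (simp add: ev_power assms)
  also have "\<dots> = 0" using assms by (auto simp: ev_def startsby_zero_power_prefix intro!: sum.neutral)
  finally show ?thesis .
qed

lemma Exp_Log: assumes "y ^ D = 0" shows "Exp (Log y) = 1 + y"
proof -
  have l: "Log y ^ D = 0" unfolding Log_def by (rule ev_nilpotent) (use assms in auto)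
  have "Exp (Log y) - 1 = ev (fps_exp 1 - 1) (ev (fps_ln 1) y)"
    by (simp add: Exp_def Log_def[symmetric] ev_diff ev_one l)
  also have "\<dots> = ev fps_X y"
    by (simp add: fps_exp_ln assms flip: ev_compose)
  finally show ?thesis by (simp add: ev_X assms algebra_simps)
qed

lemma ev_uminus_arg: "ev f (- x) = ev (f oo (- fps_X)) x"
proof -
  have "s (fps_nth f m) * (- x) ^ m = s (fps_nth (f oo (- fps_X)) m) * x ^ m" for m
  proof -
    have "s ((- 1) ^ m) = (- 1) ^ m"
      by (induction m) (simp_all add: s_one s_mult s_uminus)
    moreover have "fps_nth (f oo (- fps_X)) m = fps_nth f m * (- 1) ^ m"
      by (simp add: fps_compose_uminus')
    ultimately show ?thesis
      by (simp add: s_mult power_minus[of x] mult.assoc)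
  qed
  then show ?thesis by (simp add: ev_def)
qed

lemma Exp_uminus: assumes "x ^ D = 0" shows "Exp (- x) * Exp x = 1"
proof -
  have "Exp (- x) * Exp x = ev (fps_exp (-1) * fps_exp 1) x"
    unfolding Exp_def ev_uminus_arg ev_mult[OF assms] by (simp add: fps_exp_compose_linear)
  also have "\<dots> = 1" by (simp add: ev_one assms flip: fps_exp_add_mult)
  finally show ?thesis .
qed

end

section \<open>The Baker--Campbell--Hausdorff theorem\<close>

definition bracket :: "'a::ring_1 \<Rightarrow> 'a \<Rightarrow> 'a" where
  "bracket a b = a * b - b * a"

definition ad_pow :: "'a::ring_1 \<Rightarrow> nat \<Rightarrow> 'a \<Rightarrow> 'a" where
  "ad_pow z k y = ((\<lambda>u. bracket u z) ^^ k) y"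

lemma ad_pow_0 [simp]: "ad_pow z 0 y = y"
  and ad_pow_Suc [simp]: "ad_pow z (Suc k) y = bracket (ad_pow z k y) z"
  by (simp_all add: ad_pow_def)

lemma ad_pow_commutes: "ad_pow z k y * z = z * ad_pow z k y + ad_pow z (Suc k) y"
  by (simp add: bracket_def)

text \<open>Right multiplication by \<open>z\<close> is left multiplication by \<open>z\<close> plus \<open>y \<mapsto> [y, z]\<close>, and these two
  commute: this is the binomial theorem for their sum.\<close>

lemma mult_power_right:
  "y * z ^ m = (\<Sum>k\<le>m. of_nat (m choose k) * (z ^ (m - k) * ad_pow z k y))"
proof (induction m)
  case (Suc m)
  let ?f = "\<lambda>m k. of_nat (m choose k) * (z ^ (m - k) * ad_pow z k y)"
  have step: "?f m k * z = of_nat (m choose k) * (z ^ (Suc m - k) * ad_pow z k y)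
      + of_nat (m choose k) * (z ^ (m - k) * ad_pow z (Suc k) y)" if "k \<le> m" for k
  proof -
    have "z ^ (m - k) * z = z ^ (Suc m - k)"
      using that by (metis Suc_diff_le power_Suc2)
    then have "z ^ (m - k) * (z * u) = z ^ (Suc m - k) * u" for u
      by (metis mult.assoc)
    then show ?thesis
      by (simp only: mult.assoc ad_pow_commutes distrib_left)
  qed
  have "y * z ^ Suc m = (y * z ^ m) * z" by (simp only: power_Suc2 mult.assoc)
  also have "\<dots> = (\<Sum>k\<le>m. ?f m k * z)" by (simp only: Suc sum_distrib_right)
  also have "\<dots> = (\<Sum>k\<le>m. of_nat (m choose k) * (z ^ (Suc m - k) * ad_pow z k y))
      + (\<Sum>k\<le>m. of_nat (m choose k) * (z ^ (Suc m - Suc k) * ad_pow z (Suc k) y))"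
    unfolding sum.distrib[symmetric] by (intro sum.cong refl) (simp only: step atMost_iff diff_Suc_Suc)
  also have "(\<Sum>k\<le>m. of_nat (m choose k) * (z ^ (Suc m - k) * ad_pow z k y))
      = (\<Sum>k\<le>Suc m. of_nat (m choose k) * (z ^ (Suc m - k) * ad_pow z k y))"
    by (simp add: binomial_eq_0 del: ad_pow_Suc)
  also have "\<dots> = z ^ Suc m * y + (\<Sum>k\<le>m. of_nat (m choose Suc k) * (z ^ (Suc m - Suc k) * ad_pow z (Suc k) y))"
    unfolding sum.atMost_Suc_shift by simp
  also have "\<dots> + (\<Sum>k\<le>m. of_nat (m choose k) * (z ^ (Suc m - Suc k) * ad_pow z (Suc k) y))
     = z ^ Suc m * y + (\<Sum>k\<le>m. ?f (Suc m) (Suc k))"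
    by (simp only: add.assoc sum.distrib[symmetric] distrib_right[symmetric] of_nat_add[symmetric] 
        binomial_Suc_Suc add.commute[of "m choose Suc _"])
  also have "\<dots> = (\<Sum>k\<le>Suc m. ?f (Suc m) k)"
    unfolding sum.atMost_Suc_shift[of "?f (Suc m)"] by simp
  finally show ?case .
qed simp

text \<open>The noncommutative chain rule for powers. The iterated brackets arise from moving the
  factor \<open>\<theta> z\<close> to the right of all powers of \<open>z\<close>; Pascal's rule then collects the terms.\<close>

lemma derivation_power:
  fixes \<theta> :: "'a::ring_1 \<Rightarrow> 'a"
  assumes leibniz: "\<And>x y. \<theta> (x * y) = \<theta> x * y + x * \<theta> y"
  shows "\<theta> (z ^ m) = (\<Sum>k<m. of_nat (m choose Suc k) * (z ^ (m - Suc k) * ad_pow z k (\<theta> z)))"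
proof (induction m)
  case 0
  have "\<theta> 1 = 0" using leibniz[of 1 1] by simp
  then show ?case by simp
next
  case (Suc m)
  let ?y = "\<theta> z"
  have "\<theta> (z ^ Suc m) = \<theta> z * z ^ m + z * \<theta> (z ^ m)"
    by (simp add: leibniz)
  also have "\<theta> z * z ^ m = (\<Sum>k<Suc m. of_nat (m choose k) * (z ^ (m - k) * ad_pow z k ?y))"
    by (simp only: mult_power_right lessThan_Suc_atMost)
  also have "z * \<theta> (z ^ m) = (\<Sum>k<m. of_nat (m choose Suc k) * (z ^ (m - k) * ad_pow z k ?y))"
  proof -
    have "z * (of_nat c * (z ^ (m - Suc k) * u)) = of_nat c * (z ^ (m - k) * u)" if "k < m" for c k u
    proof -
      have "z * z ^ (m - Suc k) = z ^ (m - k)"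
        using that by (metis Suc_diff_Suc power_Suc)
      moreover have "z * of_nat c = of_nat c * z"
        by (simp only: mult_of_nat_commute)
      ultimately show ?thesis
        by (simp only: mult.assoc[symmetric]) (simp only: mult.assoc)
    qed
    then show ?thesis by (simp add: Suc sum_distrib_left)
  qed
  also have "\<dots> = (\<Sum>k<Suc m. of_nat (m choose Suc k) * (z ^ (m - k) * ad_pow z k ?y))"
    by (simp add: binomial_eq_0 del: ad_pow_Suc)
  finally have "\<theta> (z ^ Suc m) = (\<Sum>k<Suc m. of_nat (m choose k) * (z ^ (m - k) * ad_pow z k ?y))
      + (\<Sum>k<Suc m. of_nat (m choose Suc k) * (z ^ (m - k) * ad_pow z k ?y))" .
  also have "\<dots> = (\<Sum>k<Suc m. of_nat (Suc m choose Suc k) * (z ^ (Suc m - Suc k) * ad_pow z k ?y))"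
    unfolding sum.distrib[symmetric]
    by (intro sum.cong refl) (simp add: distrib_right)
  finally show ?case .
qed

context scalar_ring
begin

text \<open>Sums over the triangle \<open>j + k < D\<close> arising from truncated series may be completed to
  the full square when the extra terms vanish.\<close>

lemma triangle_to_product:
  assumes "\<And>j k. D \<le> j + k \<Longrightarrow> z ^ j * w k = 0"
  shows "(\<Sum>m<D. \<Sum>k\<le>m. s (c (m - k) * e k) * (z ^ (m - k) * w k))
    = (\<Sum>j<D. s (c j) * z ^ j) * (\<Sum>k<D. s (e k) * w k)"
proof -
  define u where "u j k = s (c j) * (s (e k) * (z ^ j * w k))" for j k
  have u0: "u j k = 0" if "D \<le> j + k" for j k
    using assms[OF that] by (simp add: u_def)
  have "(\<Sum>j<D. s (c j) * z ^ j) * (\<Sum>k<D. s (e k) * w k) = (\<Sum>j<D. \<Sum>k<D. u j k)"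
    unfolding sum_product u_def
    by (intro sum.cong refl) (simp add: mult.assoc s_left_commute[of "z ^ _"])
  also have "\<dots> = (\<Sum>(j,k)\<in>{..<D}\<times>{..<D}. u j k)"
    by (simp add: sum.cartesian_product)
  also have "\<dots> = (\<Sum>(j,k)\<in>{(j,k). j + k < D}. u j k)"
  proof -
    have "{(i,j). i + j < D} \<subseteq> {..<D}\<times>{..<D}" by auto
    then show ?thesis by (intro sum.mono_neutral_right) (auto simp: u0)
  qed
  also have "\<dots> = (\<Sum>(k,j)\<in>{(k,j). k + j < D}. u j k)"
    by (rule sum.reindex_bij_witness[of _ prod.swap prod.swap]) auto
  also have "\<dots> = (\<Sum>m<D. \<Sum>k\<le>m. u (m - k) k)"
    by (rule sum.triangle_reindex)
  finally show ?thesis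
    by (simp add: u_def s_mult mult.assoc)
qed

text \<open>Since right multiplication by \<open>z\<close> is the sum of the commuting operators of left
  multiplication and of \<open>y \<mapsto> [y, z]\<close>, right multiplication by \<open>exp z\<close> is the product of their
  exponentials. In other words \<open>exp (- z) y exp z\<close> is a combination of iterated brackets.\<close>

lemma mult_Exp_right:
  assumes "\<And>j k. D \<le> j + k \<Longrightarrow> z ^ j * ad_pow z k y = 0"
  shows "y * Exp z = Exp z * (\<Sum>k<D. s (1 / fact k) * ad_pow z k y)"
proof -
  have "y * Exp z = (\<Sum>m<D. s (1 / fact m) * (y * z ^ m))"
    by (simp add: Exp_eq sum_distrib_left s_left_commute[of y])
  also have "\<dots> = (\<Sum>m<D. \<Sum>k\<le>m. s (1 / fact (m - k) * (1 / fact k)) * (z ^ (m - k) * ad_pow z k y))"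
  proof (intro sum.cong refl)
    fix m
    have *: "s (1 / fact m) * (of_nat (m choose k) * u) = s (1 / fact (m - k) * (1 / fact k)) * u"
      if "k \<le> m" for k u
    proof -
      have **: "1 / fact m * of_nat (m choose k) = 1 / fact (m - k) * (1 / fact k :: 'k)"
        using that by (simp add: binomial_fact field_simps)
      show ?thesis by (simp only: **[symmetric] s_mult s_of_nat mult.assoc)
    qed
    show "s (1 / fact m) * (y * z ^ m)
        = (\<Sum>k\<le>m. s (1 / fact (m - k) * (1 / fact k)) * (z ^ (m - k) * ad_pow z k y))"
      unfolding mult_power_right sum_distrib_left
      by (rule sum.cong[OF refl], rule *, simp only: atMost_iff)
  qed
  also have "\<dots> = Exp z * (\<Sum>k<D. s (1 / fact k) * ad_pow z k y)"
    unfolding Exp_eq by (rule triangle_to_product) (rule assms)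
  finally show ?thesis .
qed

text \<open>The derivative of the exponential: \<open>exp (- z) \<theta> (exp z)\<close> is \<open>\<theta> z\<close> plus iterated
  brackets of \<open>\<theta> z\<close> with \<open>z\<close>. The vanishing assumption covers the terms that truncation at \<open>D\<close>
  omits.\<close>

lemma derivation_Exp:
  fixes \<theta> :: "'a \<Rightarrow> 'a"
  assumes leibniz: "\<And>x y. \<theta> (x * y) = \<theta> x * y + x * \<theta> y"
    and add: "\<And>x y. \<theta> (x + y) = \<theta> x + \<theta> y"
    and scal: "\<And>c. \<theta> (s c) = 0"
    and van: "\<And>j k. D \<le> Suc (j + k) \<Longrightarrow> z ^ j * ad_pow z k (\<theta> z) = 0"
  shows "\<theta> (Exp z) = Exp z * (\<Sum>k<D. s (1 / fact (Suc k)) * ad_pow z k (\<theta> z))"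
proof -
  have sum: "\<theta> (sum f A) = (\<Sum>i\<in>A. \<theta> (f i))" if "finite A" for f :: "nat \<Rightarrow> 'a" and A
  proof -
    have "\<theta> 0 = 0" using add[of 0 0] by simp
    with that show ?thesis by (induction A rule: finite_induct) (simp_all add: add)
  qed
  have "\<theta> (Exp z) = (\<Sum>m<D. s (1 / fact m) * \<theta> (z ^ m))"
    by (simp add: Exp_eq sum leibniz scal)
  also have "\<dots> = (\<Sum>m<D. \<Sum>k<m. s (1 / fact (m - Suc k) * (1 / fact (Suc k)))
      * (z ^ (m - Suc k) * ad_pow z k (\<theta> z)))"
  proof (intro sum.cong refl)
    fix m
    have *: "s (1 / fact m) * (of_nat (m choose Suc k) * u)
        = s (1 / fact (m - Suc k) * (1 / fact (Suc k))) * u" if "k < m" for k u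
    proof -
      have **: "1 / fact m * of_nat (m choose Suc k) = 1 / fact (m - Suc k) * (1 / fact (Suc k) :: 'k)"
        using that by (simp add: binomial_fact field_simps del: fact_Suc)
      show ?thesis by (simp only: **[symmetric] s_mult s_of_nat mult.assoc)
    qed
    show "s (1 / fact m) * \<theta> (z ^ m) = (\<Sum>k<m. s (1 / fact (m - Suc k) * (1 / fact (Suc k)))
      * (z ^ (m - Suc k) * ad_pow z k (\<theta> z)))"
      unfolding derivation_power[of \<theta>, OF leibniz] sum_distrib_left
      by (rule sum.cong[OF refl], rule *, simp only: lessThan_iff)
  qed
  also have "\<dots> = (\<Sum>m<D. \<Sum>k\<le>m. s (1 / fact (m - k) * (1 / fact (Suc k)))
      * (z ^ (m - k) * ad_pow z k (\<theta> z)))"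
  proof (cases D)
    case (Suc n)
    \<comment> \<open>shift \<open>m\<close> by one; the new top layer \<open>m = D - 1\<close> vanishes by assumption\<close>
    have "(\<Sum>m<Suc n. \<Sum>k<m. s (1 / fact (m - Suc k) * (1 / fact (Suc k)))
      * (z ^ (m - Suc k) * ad_pow z k (\<theta> z))) = (\<Sum>m<n. \<Sum>k\<le>m. s (1 / fact (m - k) * (1 / fact (Suc k)))
      * (z ^ (m - k) * ad_pow z k (\<theta> z)))"
      by (subst sum.lessThan_Suc_shift)
        (simp add: lessThan_Suc_atMost del: fact_Suc sum.lessThan_Suc ad_pow_Suc)
    moreover have "(\<Sum>k\<le>n. s (1 / fact (n - k) * (1 / fact (Suc k)))
      * (z ^ (n - k) * ad_pow z k (\<theta> z))) = 0"
      by (intro sum.neutral ballI) (simp add: van Suc)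
    ultimately show ?thesis by (simp add: Suc)
  qed simp
  also have "\<dots> = Exp z * (\<Sum>k<D. s (1 / fact (Suc k)) * ad_pow z k (\<theta> z))"
    unfolding Exp_eq
    by (rule triangle_to_product[of z _ "\<lambda>j. 1 / fact j" "\<lambda>k. 1 / fact (Suc k)"]) (rule van, simp)
  finally show ?thesis .
qed

end

text \<open>A filtration that is exhausted after \<open>D\<close> steps, as by the superdiagonals of \<open>D \<times> D\<close>
  matrices. It makes power series in \<open>t\<close> whose \<open>n\<close>-th coefficient lies in \<open>N n\<close> finite sums.\<close>

locale filtered_scalar_ring = scalar_ring s D
  for s :: "'k::field_char_0 \<Rightarrow> 'a::ring_1" and D :: nat +
  fixes N :: "nat \<Rightarrow> 'a set"
  assumes D_pos: "0 < D"
    and N_zero [simp]: "0 \<in> N n"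
    and N_add: "x \<in> N n \<Longrightarrow> y \<in> N n \<Longrightarrow> x + y \<in> N n"
    and N_scale: "x \<in> N n \<Longrightarrow> s c * x \<in> N n"
    and N_one: "1 \<in> N 0"
    and N_mult: "x \<in> N i \<Longrightarrow> y \<in> N j \<Longrightarrow> x * y \<in> N (i + j)"
    and N_vanish: "x \<in> N n \<Longrightarrow> D \<le> n \<Longrightarrow> x = 0"
begin

lemma N_sum: "(\<And>i. i \<in> A \<Longrightarrow> f i \<in> N n) \<Longrightarrow> sum f A \<in> N n"
  by (induction A rule: infinite_finite_induct) (auto simp: N_add)

lemma N_power: "x \<in> N 1 \<Longrightarrow> x ^ k \<in> N k"
  by (induction k) (use N_one N_mult[of x 1] in auto)

lemma N_nilpotent: "x \<in> N 1 \<Longrightarrow> x ^ D = 0"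
  using N_power N_vanish by blast

end

text \<open>Linking the power of \<open>t\<close> to the filtration has two effects: a graded series divisible by
  \<open>t ^ D\<close> is zero, so that the truncated exponentials over the ring of power series are exact, and
  \<open>t = 1\<close> may be substituted.\<close>

context filtered_scalar_ring
begin

definition graded :: "nat \<Rightarrow> 'a fps set" where
  "graded k = {f. \<forall>n. fps_nth f n \<in> N n \<and> (n < k \<longrightarrow> fps_nth f n = 0)}"

lemma graded_zero: "0 \<in> graded k" by (simp add: graded_def)

lemma graded_add: "f \<in> graded k \<Longrightarrow> g \<in> graded k \<Longrightarrow> f + g \<in> graded k"
  by (simp add: graded_def N_add)

lemma graded_scale: "f \<in> graded k \<Longrightarrow> fps_const (s c) * f \<in> graded k"
  by (simp add: graded_def N_scale)

lemma graded_diff: "f \<in> graded k \<Longrightarrow> g \<in> graded k \<Longrightarrow> f - g \<in> graded k"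
  using graded_add[of f k "fps_const (s (- 1)) * g"] graded_scale[of g k "- 1"]
  by (simp add: s_uminus s_one flip: fps_const_neg)

lemma graded_sum: "(\<And>i. i \<in> A \<Longrightarrow> f i \<in> graded n) \<Longrightarrow> sum f A \<in> graded n"
  by (induction A rule: infinite_finite_induct) (auto simp: graded_add graded_zero)

lemma graded_one: "1 \<in> graded 0" by (auto simp: graded_def N_one)

lemma graded_mono: "k \<le> l \<Longrightarrow> f \<in> graded l \<Longrightarrow> f \<in> graded k"
  by (auto simp: graded_def)

lemma graded_mult: assumes "f \<in> graded k" "g \<in> graded l" shows "f * g \<in> graded (k + l)"
proof -
  have "fps_nth (f * g) n \<in> N n" for n
    unfolding fps_mult_nth
  proof (rule N_sum)
    fix i assume "i \<in> {0..n}"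
    then show "fps_nth f i * fps_nth g (n - i) \<in> N n"
      using N_mult[of "fps_nth f i" i "fps_nth g (n - i)" "n - i"] assms by (simp add: graded_def)
  qed
  moreover have "fps_nth (f * g) n = 0" if "n < k + l" for n
    unfolding fps_mult_nth
  proof (intro sum.neutral ballI)
    fix i assume i: "i \<in> {0..n}"
    show "fps_nth f i * fps_nth g (n - i) = 0"
    proof (cases "i < k")
      case False
      then have "n - i < l" using that i by auto
      then show ?thesis using assms by (simp add: graded_def)
    qed (use assms in \<open>simp add: graded_def\<close>)
  qed
  ultimately show ?thesis by (simp add: graded_def)
qed

lemma graded_power: "f \<in> graded 1 \<Longrightarrow> f ^ k \<in> graded k"
  by (induction k) (use graded_one graded_mult[of f 1] in auto)

lemma graded_vanish: assumes "f \<in> graded k" "D \<le> k" shows "f = 0"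
proof (rule fps_ext)
  fix n show "fps_nth f n = fps_nth 0 n"
    using assms N_vanish[of "fps_nth f n" n] by (cases "n < k") (auto simp: graded_def)
qed

lemma graded_ad_pow: "z \<in> graded 1 \<Longrightarrow> y \<in> graded j \<Longrightarrow> ad_pow z k y \<in> graded (j + k)"
proof (induction k)
  case (Suc k)
  then have "ad_pow z k y \<in> graded (j + k)" by simp
  from graded_mult[OF this Suc.prems(1)] graded_mult[OF Suc.prems(1) this] show ?case
    by (simp add: bracket_def graded_diff)
qed simp

lemma graded_nilpotent: "f \<in> graded 1 \<Longrightarrow> f ^ D = 0"
  using graded_power graded_vanish by blast

text \<open>The substitution \<open>t = 1\<close>: for a graded series the coefficients from \<open>D\<close> onwards vanish.\<close>

definition at_one :: "'a fps \<Rightarrow> 'a" where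
  "at_one f = (\<Sum>n<D. fps_nth f n)"

lemma at_one_add: "at_one (f + g) = at_one f + at_one g"
  and at_one_diff: "at_one (f - g) = at_one f - at_one g"
  and at_one_scale: "at_one (fps_const c * f) = c * at_one f"
  by (simp_all add: at_one_def sum.distrib sum_subtractf sum_distrib_left)

lemma at_one_sum: "at_one (sum f A) = (\<Sum>i\<in>A. at_one (f i))"
  by (induction A rule: infinite_finite_induct) (simp_all add: at_one_add, simp_all add: at_one_def)

lemma at_one_one: "at_one 1 = 1"
  using D_pos by (simp add: at_one_def)

lemma at_one_mult:
  assumes "f \<in> graded 0" "g \<in> graded 0"
  shows "at_one (f * g) = at_one f * at_one g"
proof -
  define c where "c i j = fps_nth f i * fps_nth g j" for i j
  have c0: "c i j = 0" if "D \<le> i + j" for i j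
    using N_vanish[OF N_mult that, of "fps_nth f i" "fps_nth g j"] assms
    by (simp add: c_def graded_def)
  have "at_one f * at_one g = (\<Sum>(i,j)\<in>{..<D}\<times>{..<D}. c i j)"
    by (simp add: at_one_def sum_product c_def sum.cartesian_product)
  also have "\<dots> = (\<Sum>(i,j)\<in>{(i,j). i + j < D}. c i j)"
  proof -
    have "{(i,j). i + j < D} \<subseteq> {..<D}\<times>{..<D}" by auto
    then show ?thesis by (intro sum.mono_neutral_right) (auto simp: c0)
  qed
  also have "\<dots> = (\<Sum>n<D. \<Sum>i\<le>n. c i (n - i))"
    by (rule sum.triangle_reindex)
  finally show ?thesis
    by (simp add: at_one_def c_def fps_mult_nth atLeast0AtMost)
qed

interpretation F: scalar_ring "\<lambda>c. fps_const (s c)" D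
proof
  fix x :: 'k and f :: "'a fps"
  show "fps_const (s x) * f = f * fps_const (s x)"
    by (rule fps_ext) (simp add: s_central)
qed (simp_all add: s_add s_mult s_one)

lemma at_one_ev:
  assumes "z \<in> graded 1"
  shows "at_one (F.ev f z) = ev f (at_one z)"
proof -
  have "at_one (z ^ m) = at_one z ^ m" for m
  proof (induction m)
    case (Suc m)
    then show ?case
      using at_one_mult[of z "z ^ m"] assms graded_power[OF assms, of m]
      by (simp add: graded_mono[of 0])
  qed (simp add: at_one_one)
  then show ?thesis
    by (simp add: F.ev_def ev_def at_one_sum at_one_scale)
qed

lemma graded_ev:
  assumes z: "z \<in> graded 1" and f: "fps_nth f 0 = 0"
  shows "F.ev f z \<in> graded 1"
  unfolding F.ev_def
proof (rule graded_sum)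
  fix m
  show "fps_const (s (fps_nth f m)) * z ^ m \<in> graded 1"
  proof (cases m)
    case (Suc n)
    then show ?thesis using graded_scale[OF graded_power[OF z, of m]] graded_mono[of 1 m] by simp
  qed (simp add: f graded_zero)
qed

lemma graded_Exp:
  assumes "z \<in> graded 1"
  shows "F.Exp z - 1 \<in> graded 1"
proof -
  have "F.Exp z - 1 = F.ev (fps_exp 1 - 1) z"
    by (simp add: F.Exp_def F.ev_diff F.ev_one[OF graded_nilpotent[OF assms]])
  then show ?thesis using graded_ev[OF assms, of "fps_exp 1 - 1"] by simp
qed

text \<open>The Euler operator \<open>t d/dt\<close>.\<close>

definition euler :: "'a fps \<Rightarrow> 'a fps" where
  "euler f = Abs_fps (\<lambda>n. of_nat n * fps_nth f n)"

lemma euler_add: "euler (f + g) = euler f + euler g"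
  by (simp add: euler_def fps_eq_iff distrib_left)

lemma euler_const: "euler (fps_const c) = 0"
  by (simp add: euler_def fps_eq_iff)

lemma euler_mult: "euler (f * g) = euler f * g + f * euler g"
proof (rule fps_ext)
  fix n
  have *: "of_nat n * (fps_nth f i * fps_nth g (n - i))
      = of_nat i * fps_nth f i * fps_nth g (n - i) + fps_nth f i * (of_nat (n - i) * fps_nth g (n - i))"
    if "i \<le> n" for i
  proof -
    have "fps_nth f i * (of_nat (n - i) * fps_nth g (n - i)) = of_nat (n - i) * (fps_nth f i * fps_nth g (n - i))"
      using mult_of_nat_commute[of "n - i" "fps_nth f i"] by (simp only: mult.assoc[symmetric])
    moreover have "of_nat n = (of_nat i + of_nat (n - i) :: 'a)"
      using that by (simp flip: of_nat_add)
    ultimately show ?thesis by (simp add: distrib_right mult.assoc)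
  qed
  show "fps_nth (euler (f * g)) n = fps_nth (euler f * g + f * euler g) n"
    by (simp add: euler_def fps_mult_nth sum_distrib_left * flip: sum.distrib)
qed

lemma graded_euler: "f \<in> graded k \<Longrightarrow> euler f \<in> graded k"
  by (simp add: graded_def euler_def N_scale flip: s_of_nat)

lemma euler_Exp:
  assumes z: "z \<in> graded 1"
  shows "euler (F.Exp z)
    = F.Exp z * (\<Sum>k<D. fps_const (s (1 / fact (Suc k))) * ad_pow z k (euler z))"
proof (rule F.derivation_Exp)
  fix j k assume "D \<le> Suc (j + k)"
  moreover have "z ^ j * ad_pow z k (euler z) \<in> graded (j + (1 + k))"
    by (intro graded_mult graded_power graded_ad_pow graded_euler z)
  ultimately show "z ^ j * ad_pow z k (euler z) = 0"
    using graded_vanish by simp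
qed (simp_all add: euler_mult euler_add euler_const)

definition linear_term :: "'a \<Rightarrow> 'a fps" where
  "linear_term a = Abs_fps (\<lambda>n. if n = 1 then a else 0)"

lemma graded_linear_term: "a \<in> N 1 \<Longrightarrow> linear_term a \<in> graded 1"
  by (simp add: linear_term_def graded_def)

lemma at_one_linear_term: assumes "a \<in> N 1" shows "at_one (linear_term a) = a"
proof (cases "1 < D")
  case False
  then have "a = 0" using N_vanish[OF assms] by simp
  then show ?thesis by (simp add: at_one_def linear_term_def)
qed (simp add: at_one_def linear_term_def)

lemma euler_Exp_linear_term:
  assumes "a \<in> N 1"
  shows "euler (F.Exp (linear_term a)) = F.Exp (linear_term a) * linear_term a"
proof -
  let ?z = "linear_term a"
  have z: "euler ?z = ?z" by (simp add: euler_def linear_term_def fps_eq_iff)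
  have "ad_pow ?z (Suc k) ?z = 0" for k
    by (induction k) (simp_all add: bracket_def)
  then have "(\<Sum>k<D. fps_const (s (1 / fact (Suc k))) * ad_pow ?z k ?z)
      = (\<Sum>k<D. if k = 0 then ?z else 0)"
    by (intro sum.cong refl) (auto simp: gr0_conv_Suc s_one simp del: ad_pow_Suc)
  also have "\<dots> = ?z" using D_pos by simp
  finally show ?thesis
    using euler_Exp[OF graded_linear_term[OF assms]] by (simp add: z)
qed

lemma bracket_nth:
  "fps_nth (bracket f g) n = (\<Sum>i\<le>n. bracket (fps_nth f i) (fps_nth g (n - i)))"
proof -
  have "(\<Sum>i=0..n. fps_nth g i * fps_nth f (n - i)) = (\<Sum>i\<le>n. fps_nth g (n - i) * fps_nth f i)"
    by (rule sum.reindex_bij_witness[of _ "\<lambda>i. n - i" "\<lambda>i. n - i"]) auto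
  then show ?thesis
    by (simp add: bracket_def fps_mult_nth sum_subtractf atLeast0AtMost)
qed

text \<open>The Lie algebra \<open>L\<close> contains every coefficient of the logarithm \<open>Z\<close> of
  \<open>exp (t a) exp (t b)\<close>. Applying \<open>t d/dt\<close> to \<open>exp Z\<close> yields \<open>exp Z\<close> times the sum of \<open>t Z'\<close> and
  of brackets of \<open>t Z'\<close> with \<open>Z\<close>; applied to the product it yields \<open>exp Z\<close> times a series with
  coefficients in \<open>L\<close>. As \<open>Z\<close> has no constant term, the \<open>n\<close>-th coefficients of these brackets
  involve only coefficients of \<open>Z\<close> of index below \<open>n\<close>. So \<open>n\<close> times the \<open>n\<close>-th coefficient of
  \<open>Z\<close> is in \<open>L\<close> by induction, and one divides by \<open>n\<close>.\<close>

theorem BCH_closed: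
  assumes L_N: "L \<subseteq> N 1" and L_zero: "0 \<in> L"
    and L_add: "\<And>x y. x \<in> L \<Longrightarrow> y \<in> L \<Longrightarrow> x + y \<in> L"
    and L_scale: "\<And>c x. x \<in> L \<Longrightarrow> s c * x \<in> L"
    and L_bracket: "\<And>x y. x \<in> L \<Longrightarrow> y \<in> L \<Longrightarrow> bracket x y \<in> L"
    and a: "a \<in> L" and b: "b \<in> L"
  shows "Log (Exp a * Exp b - 1) \<in> L"
proof -
  have aN: "a \<in> N 1" and bN: "b \<in> N 1" using a b L_N by auto
  have L_diff: "x - y \<in> L" if "x \<in> L" "y \<in> L" for x y
    using L_add[OF that(1) L_scale[OF that(2), of "- 1"]] by (simp add: s_uminus s_one)
  have L_sum: "sum f A \<in> L" if "\<And>i. i \<in> A \<Longrightarrow> f i \<in> L" for f :: "nat \<Rightarrow> 'a" and A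
    using that by (induction A rule: infinite_finite_induct) (auto simp: L_zero L_add)
  define S T where "S = linear_term a" and "T = linear_term b"
  have S1: "S \<in> graded 1" and T1: "T \<in> graded 1"
    unfolding S_def T_def by (intro graded_linear_term aN bN)+
  define E where "E = F.Exp S * F.Exp T"
  define Z where "Z = F.Log (E - 1)"
  have E1: "E - 1 \<in> graded 1"
  proof -
    have "E - 1 = (F.Exp S - 1) * (F.Exp T - 1) + (F.Exp S - 1) + (F.Exp T - 1)"
      by (simp add: E_def algebra_simps)
    moreover have "(F.Exp S - 1) * (F.Exp T - 1) \<in> graded 1"
      by (rule graded_mono[OF _ graded_mult[OF graded_Exp[OF S1] graded_Exp[OF T1]]]) simp
    ultimately show ?thesis by (simp only: graded_add graded_Exp S1 T1)
  qed
  have Z1: "Z \<in> graded 1"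
    unfolding Z_def F.Log_def by (intro graded_ev E1) simp
  have EZ: "F.Exp Z = E"
    using F.Exp_Log[OF graded_nilpotent[OF E1]] by (simp add: Z_def)
  have at_one_Exp: "at_one (F.Exp z) = Exp (at_one z)" if "z \<in> graded 1" for z
    using that by (simp add: F.Exp_def Exp_def at_one_ev)
  have graded_Exp0: "F.Exp z \<in> graded 0" if "z \<in> graded 1" for z
    using graded_add[OF graded_mono[OF _ graded_Exp[OF that], of 0] graded_one] by simp
  have Z_at_one: "at_one Z = Log (Exp a * Exp b - 1)"
  proof -
    have "at_one Z = Log (at_one (E - 1))"
      unfolding Z_def F.Log_def Log_def by (rule at_one_ev[OF E1])
    also have "at_one (E - 1) = Exp (at_one S) * Exp (at_one T) - 1"
      using S1 T1 by (simp only: at_one_diff at_one_one E_def at_one_mult graded_Exp0 at_one_Exp)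
    also have "at_one S = a"
      unfolding S_def by (rule at_one_linear_term[OF aN])
    also have "at_one T = b"
      unfolding T_def by (rule at_one_linear_term[OF bN])
    finally show ?thesis .
  qed

  \<comment> \<open>Differentiating \<open>exp Z = exp (t a) exp (t b)\<close> in two ways, and cancelling \<open>exp Z\<close>.\<close>
  define \<Psi> where "\<Psi> = (\<Sum>k<D. fps_const (s (1 / fact k)) * ad_pow T k S)"
  define \<Phi> where "\<Phi> = (\<Sum>k<D. fps_const (s (1 / fact (Suc k))) * ad_pow Z k (euler Z))"
  have "S * F.Exp T = F.Exp T * \<Psi>"
    unfolding \<Psi>_def
  proof (rule F.mult_Exp_right)
    fix j k assume "D \<le> j + k"
    moreover have "T ^ j * ad_pow T k S \<in> graded (j + (1 + k))"
      by (intro graded_mult graded_power graded_ad_pow S1 T1)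
    ultimately show "T ^ j * ad_pow T k S = 0" using graded_vanish by simp
  qed
  then have "euler E = E * (\<Psi> + T)"
    using euler_Exp_linear_term[OF aN] euler_Exp_linear_term[OF bN]
    by (simp add: E_def euler_mult distrib_left mult.assoc flip: S_def T_def)
  then have "E * \<Phi> = E * (\<Psi> + T)"
    using euler_Exp[OF Z1] by (simp add: EZ \<Phi>_def)
  then have "F.Exp (- Z) * E * \<Phi> = F.Exp (- Z) * E * (\<Psi> + T)"
    by (simp only: mult.assoc)
  then have main: "\<Phi> = \<Psi> + T"
    using F.Exp_uminus[OF graded_nilpotent[OF Z1]] by (simp add: EZ)

  \<comment> \<open>The right-hand side has coefficients in \<open>L\<close>, and the left-hand side is \<open>t Z'\<close> up to
    brackets, whose \<open>n\<close>-th coefficients only involve lower coefficients of \<open>Z\<close>.\<close>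
  have ST: "fps_nth S n \<in> L" "fps_nth T n \<in> L" for n
    by (simp_all add: S_def T_def linear_term_def a b L_zero)
  have "fps_nth (ad_pow T k S) n \<in> L" for k n
    by (induction k arbitrary: n) (simp_all add: ST bracket_nth L_sum L_bracket)
  then have \<Psi>: "fps_nth (\<Psi> + T) n \<in> L" for n
    by (auto simp: \<Psi>_def fps_sum_nth ST intro!: L_add L_sum L_scale)
  have Z_L: "fps_nth Z n \<in> L" for n
  proof (induction n rule: less_induct)
    case (less n)
    show ?case
    proof (cases "n = 0")
      case True
      then show ?thesis using Z1 by (simp add: graded_def L_zero)
    next
      case False
      have br: "fps_nth (bracket Y Z) i \<in> L" if "Y \<in> graded 1" "\<And>l. l < n \<Longrightarrow> fps_nth Y l \<in> L" "i \<le> n" for Y i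
        unfolding bracket_nth
      proof (rule L_sum)
        fix l assume l: "l \<in> {..i}"
        show "bracket (fps_nth Y l) (fps_nth Z (i - l)) \<in> L"
        proof (cases "l = 0 \<or> l = i")
          case True
          then have "bracket (fps_nth Y l) (fps_nth Z (i - l)) = 0"
            using that(1) Z1 by (auto simp: graded_def bracket_def)
          then show ?thesis by (simp add: L_zero)
        next
          case False
          then have "l < n" "i - l < n" using l that(3) by auto
          then show ?thesis by (intro L_bracket that(2) less)
        qed
      qed
      have lower: "l < n \<Longrightarrow> fps_nth (ad_pow Z k (euler Z)) l \<in> L" for k l
      proof (induction k arbitrary: l)
        case 0
        then show ?case using L_scale[OF less, of l "of_nat l"] by (simp add: euler_def s_of_nat)
      next
        case (Suc k)
        have "ad_pow Z k (euler Z) \<in> graded 1"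
          by (rule graded_mono[OF _ graded_ad_pow[OF Z1 graded_euler[OF Z1]]]) simp
        from br[OF this Suc.IH] Suc.prems show ?case by simp
      qed
      obtain D' where D': "D = Suc D'" using D_pos by (cases D) auto
      have "fps_nth (ad_pow Z (Suc k) (euler Z)) n \<in> L" for k
      proof -
        have "ad_pow Z k (euler Z) \<in> graded 1"
          by (rule graded_mono[OF _ graded_ad_pow[OF Z1 graded_euler[OF Z1]]]) simp
        from br[OF this lower] show ?thesis by simp
      qed
      then have "fps_nth (\<Sum>k<D'. fps_const (s (1 / fact (Suc (Suc k)))) * ad_pow Z (Suc k) (euler Z)) n \<in> L"
        by (auto simp: fps_sum_nth simp del: fact_Suc ad_pow_Suc intro!: L_sum L_scale)
      moreover have "\<Phi> = euler Z + (\<Sum>k<D'. fps_const (s (1 / fact (Suc (Suc k)))) * ad_pow Z (Suc k) (euler Z))"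
        unfolding \<Phi>_def D' by (subst sum.lessThan_Suc_shift) (simp add: s_one del: ad_pow_Suc)
      ultimately have "fps_nth (euler Z) n \<in> L"
        using L_diff[OF \<Psi>[of n]] unfolding main[symmetric] by fastforce
      from L_scale[OF this, of "1 / of_nat n"] have "s (1 / of_nat n * of_nat n) * fps_nth Z n \<in> L"
        by (simp only: euler_def fps_nth_Abs_fps s_mult s_of_nat mult.assoc)
      then show ?thesis using False by (simp add: s_one)
    qed
  qed
  then have "at_one Z \<in> L" by (simp add: at_one_def L_sum)
  then show ?thesis by (simp add: Z_at_one)
qed

end

section \<open>Upper triangular matrices as a ring type\<close>

text \<open>Indexing by all natural numbers gives one ring for all sizes \<open>d\<close>. The triangular shape keeps
  the sums in the matrix product finite.\<close>

typedef (overloaded) 'a umat = "{f :: nat \<Rightarrow> nat \<Rightarrow> 'a::zero. \<forall>i j. j < i \<longrightarrow> f i j = 0}"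
  morphisms entry Abs_umat by (rule exI[of _ "\<lambda>_ _. 0"]) simp

lemma entry_below [simp]: "j < i \<Longrightarrow> entry f i j = 0"
  using entry[of f] by simp

lemma umat_eqI: "(\<And>i j. i \<le> j \<Longrightarrow> entry f i j = entry g i j) \<Longrightarrow> f = g"
  by (metis entry_below entry_inject ext not_less)

definition umat :: "(nat \<Rightarrow> nat \<Rightarrow> 'a::zero) \<Rightarrow> 'a umat" where
  "umat f = Abs_umat (\<lambda>i j. if i \<le> j then f i j else 0)"

lemma entry_umat: "entry (umat f) i j = (if i \<le> j then f i j else 0)"
  unfolding umat_def by (subst Abs_umat_inverse) auto

instantiation umat :: (comm_ring_1) ring_1
begin

definition "0 = umat (\<lambda>_ _. 0)"
definition "1 = umat (\<lambda>i j. if i = j then 1 else 0)"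
definition "a + b = umat (\<lambda>i j. entry a i j + entry b i j)"
definition "a - b = umat (\<lambda>i j. entry a i j - entry b i j)"
definition "- a = umat (\<lambda>i j. - entry a i j)"
definition "a * b = umat (\<lambda>i j. \<Sum>k\<le>j. entry a i k * entry b k j)"

lemma entry_zero [simp]: "entry 0 i j = 0"
  and entry_one: "entry 1 i j = (if i = j then 1 else 0)"
  and entry_add [simp]: "entry (a + b) i j = entry a i j + entry b i j"
  and entry_diff [simp]: "entry (a - b) i j = entry a i j - entry b i j"
  and entry_uminus [simp]: "entry (- a) i j = - entry a i j"
  by (simp_all add: zero_umat_def one_umat_def plus_umat_def minus_umat_def uminus_umat_def entry_umat)

lemma entry_mult: assumes "j \<le> m" shows "entry (a * b) i j = (\<Sum>k\<le>m. entry a i k * entry b k j)"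
proof -
  have "(\<Sum>k\<le>m. entry a i k * entry b k j) = (\<Sum>k\<le>j. entry a i k * entry b k j)"
    using assms by (intro sum.mono_neutral_right) auto
  moreover have "(\<Sum>k\<le>j. entry a i k * entry b k j) = 0" if "j < i"
    using that by (intro sum.neutral) auto
  ultimately show ?thesis
    by (simp add: times_umat_def entry_umat)
qed

instance
proof
  fix a b c :: "'a umat"
  show "a * b * c = a * (b * c)"
  proof (rule umat_eqI)
    fix i j :: nat
    have "entry (a * b * c) i j = (\<Sum>k\<le>j. \<Sum>l\<le>j. entry a i l * entry b l k * entry c k j)"
      by (simp add: entry_mult[where m = j] sum_distrib_right)
    also have "\<dots> = (\<Sum>l\<le>j. \<Sum>k\<le>j. entry a i l * entry b l k * entry c k j)"
      by (rule sum.swap)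
    also have "\<dots> = entry (a * (b * c)) i j"
      by (simp add: entry_mult[where m = j] sum_distrib_left mult.assoc)
    finally show "entry (a * b * c) i j = entry (a * (b * c)) i j" .
  qed
  show "1 * a = a" "a * 1 = a"
    by (auto intro!: umat_eqI simp: entry_mult[OF order_refl] entry_one if_distrib if_distribR cong: if_cong)
  show "(0::'a umat) \<noteq> 1"
  proof
    assume "(0::'a umat) = 1"
    then have "entry (0::'a umat) 0 0 = entry 1 0 0" by simp
    then show False by (simp add: entry_one)
  qed
qed (auto intro!: umat_eqI simp: entry_mult[OF order_refl] algebra_simps sum.distrib)

end

definition scalar_umat :: "'a::comm_ring_1 \<Rightarrow> 'a umat" where
  "scalar_umat c = umat (\<lambda>i j. if i = j then c else 0)"

lemma entry_scalar: "entry (scalar_umat c) i j = (if i = j then c else 0)"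
  by (simp add: scalar_umat_def entry_umat)

lemma entry_scale [simp]: "entry (scalar_umat c * a) i j = c * entry a i j"
proof (cases "i \<le> j")
  case True
  have "entry (scalar_umat c * a) i j = (\<Sum>k\<le>j. if i = k then c * entry a i j else 0)"
    unfolding entry_mult[OF order_refl] by (intro sum.cong) (auto simp: entry_scalar)
  then show ?thesis using True by simp
qed simp

lemma entry_sum: "entry (sum f A) i j = (\<Sum>a\<in>A. entry (f a) i j)"
  by (induction A rule: infinite_finite_induct) auto

text \<open>The filtration by superdiagonals. Entries off the diagonal are confined to the leading
  \<open>d \<times> d\<close> block, while for \<open>n = 0\<close> the diagonal is unrestricted, so that \<open>superdiag d 0\<close> contains
  the identity.\<close>

definition superdiag :: "nat \<Rightarrow> nat \<Rightarrow> 'a::comm_ring_1 umat set" where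
  "superdiag d n = {f. \<forall>i j. entry f i j \<noteq> 0 \<longrightarrow> i + n \<le> j \<and> (i \<noteq> j \<longrightarrow> j < d)}"

text \<open>The truncation degree is \<open>max 1 d\<close> and not \<open>d\<close>, so that the constant term of a series is
  kept also for \<open>d = 0\<close>.\<close>

interpretation umat: scalar_ring "scalar_umat :: 'k::field_char_0 \<Rightarrow> 'k umat" "max 1 d" for d
proof
  fix x y :: 'k and a :: "'k umat"
  show "scalar_umat (x * y) = scalar_umat x * scalar_umat y"
    by (rule umat_eqI) (simp only: entry_scale, simp add: entry_scalar)
  show "scalar_umat x * a = a * scalar_umat x"
  proof (rule umat_eqI)
    fix i j :: nat
    assume "i \<le> j"
    have "entry (a * scalar_umat x) i j = (\<Sum>k\<le>j. if k = j then x * entry a i j else 0)"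
      unfolding entry_mult[OF order_refl] by (intro sum.cong) (auto simp: entry_scalar)
    then show "entry (scalar_umat x * a) i j = entry (a * scalar_umat x) i j" by simp
  qed
qed (auto intro!: umat_eqI simp: entry_scalar entry_one)

interpretation umat: filtered_scalar_ring "scalar_umat :: 'k::field_char_0 \<Rightarrow> 'k umat" "max 1 d"
  "superdiag d" for d
proof
  fix n x y
  fix a b :: "'k umat"
  show "a + b \<in> superdiag d n" if "a \<in> superdiag d n" "b \<in> superdiag d n"
    unfolding superdiag_def
  proof (intro CollectI allI impI)
    fix i j assume "entry (a + b) i j \<noteq> 0"
    then have "entry a i j \<noteq> 0 \<or> entry b i j \<noteq> 0" by auto
    then show "i + n \<le> j \<and> (i \<noteq> j \<longrightarrow> j < d)" using that unfolding superdiag_def by blast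
  qed
  show "a = 0" if a: "a \<in> superdiag d n" and n: "max 1 d \<le> n"
  proof (rule umat_eqI)
    fix i j
    have "entry a i j = 0"
    proof (rule ccontr)
      assume "entry a i j \<noteq> 0"
      then have "i + n \<le> j \<and> (i \<noteq> j \<longrightarrow> j < d)" using a unfolding superdiag_def by blast
      then show False using n by auto
    qed
    then show "entry a i j = entry 0 i j" by simp
  qed
next
  fix k l and a b :: "'k umat"
  assume a: "a \<in> superdiag d k" and b: "b \<in> superdiag d l"
  show "a * b \<in> superdiag d (k + l)"
    unfolding superdiag_def
  proof (intro CollectI allI impI)
    fix i j assume "entry (a * b) i j \<noteq> 0"
    then obtain m where "entry a i m * entry b m j \<noteq> 0"
      unfolding entry_mult[OF order_refl] by (meson sum.not_neutral_contains_not_neutral)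
    then have "entry a i m \<noteq> 0" "entry b m j \<noteq> 0" by auto
    then have "i + k \<le> m" "i \<noteq> m \<longrightarrow> m < d" "m + l \<le> j" "m \<noteq> j \<longrightarrow> j < d"
      using a b by (auto simp: superdiag_def)
    then show "i + (k + l) \<le> j \<and> (i \<noteq> j \<longrightarrow> j < d)" by auto
  qed
qed (auto simp: superdiag_def entry_one split: if_splits)

subsection \<open>Comparison with matrices of fixed size\<close>

definition to_mat :: "nat \<Rightarrow> 'a::comm_ring_1 umat \<Rightarrow> 'a mat" where
  "to_mat d f = mat d d (\<lambda>(i, j). entry f i j)"

definition of_mat :: "nat \<Rightarrow> 'a::comm_ring_1 mat \<Rightarrow> 'a umat" where
  "of_mat d A = umat (\<lambda>i j. if i < j \<and> j < d then A $$ (i, j) else 0)"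

lemma to_mat_carrier [simp]: "to_mat d f \<in> carrier_mat d d"
  by (simp add: to_mat_def)

lemma to_mat_index [simp]: "i < d \<Longrightarrow> j < d \<Longrightarrow> to_mat d f $$ (i, j) = entry f i j"
  by (simp add: to_mat_def)

lemma to_mat_dim [simp]: "dim_row (to_mat d f) = d" "dim_col (to_mat d f) = d"
  by (simp_all add: to_mat_def)

lemma to_mat_add: "to_mat d (a + b) = to_mat d a + to_mat d b"
  and to_mat_diff: "to_mat d (a - b) = to_mat d a - to_mat d b"
  and to_mat_zero: "to_mat d 0 = 0\<^sub>m d d"
  and to_mat_one: "to_mat d 1 = 1\<^sub>m d"
  and to_mat_scale: "to_mat d (scalar_umat c * a) = c \<cdot>\<^sub>m to_mat d a"
  by (auto simp: entry_one intro!: eq_matI)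

lemma to_mat_mult: "to_mat d (a * b) = to_mat d a * to_mat d b"
proof (rule eq_matI)
  fix i j assume ij: "i < dim_row (to_mat d a * to_mat d b)" "j < dim_col (to_mat d a * to_mat d b)"
  then have "{..d - 1} = {0..<d}" by auto
  with ij show "to_mat d (a * b) $$ (i, j) = (to_mat d a * to_mat d b) $$ (i, j)"
    by (simp add: entry_mult[of j "d - 1"] scalar_prod_def)
qed auto

lemma to_mat_power: "to_mat d (a ^ m) = to_mat d a ^\<^sub>m m"
  by (induction m) (simp_all add: to_mat_one to_mat_mult power_Suc2 del: power_Suc)

lemma to_mat_of_mat:
  assumes "A \<in> carrier_mat d d" "\<And>i j. i < d \<Longrightarrow> j \<le> i \<Longrightarrow> A $$ (i, j) = 0"
  shows "to_mat d (of_mat d A) = A"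
  using assms by (auto intro!: eq_matI simp: of_mat_def entry_umat)

lemma of_mat_superdiag: "of_mat d A \<in> superdiag d 1"
  by (auto simp: of_mat_def superdiag_def entry_umat split: if_splits)

lemma of_mat_to_mat: assumes "x \<in> superdiag d 1" shows "of_mat d (to_mat d x) = x"
proof (rule umat_eqI)
  fix i j
  show "entry (of_mat d (to_mat d x)) i j = entry x i j"
  proof (cases "entry x i j = 0")
    case False
    then have "i < j" "j < d" using assms unfolding superdiag_def by fastforce+
    then show ?thesis by (simp add: of_mat_def entry_umat)
  qed (auto simp: of_mat_def entry_umat)
qed

lemma to_mat_Exp:
  fixes x :: "'k::field_char_0 umat"
  shows "to_mat d (umat.Exp d x) = nilpotent_exp d (to_mat d x)"
proof (rule eq_matI)
  fix i j assume ij: "i < dim_row (nilpotent_exp d (to_mat d x))" "j < dim_col (nilpotent_exp d (to_mat d x))"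
  then have "max 1 d = d" by (simp add: nilpotent_exp_def)
  with ij show "to_mat d (umat.Exp d x) $$ (i, j) = nilpotent_exp d (to_mat d x) $$ (i, j)"
    unfolding umat.Exp_eq by (simp add: nilpotent_exp_def entry_sum flip: to_mat_power)
qed (auto simp: nilpotent_exp_def)

section \<open>Valuation rings and their ideal powers\<close>

context nonarch_local_field
begin

definition ideal_pow :: "nat \<Rightarrow> 'k set" where
  "ideal_pow n = {x. x = 0 \<or> int n \<le> v x}"

lemma carrier_val_ring: "carrier (val_ring v) = ideal_pow 0"
  by (simp add: val_ring_def ideal_pow_def)

lemma max_ideal_eq: "max_ideal v = ideal_pow 1"
  by (auto simp: max_ideal_def ideal_pow_def)

lemma val_one: "v 1 = 0"
  using val_mult[of 1 1] by simp

lemma val_uminus: "v (- x) = v x"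
proof (cases "x = 0")
  case False
  have "v (- 1) = 0" using val_mult[of "- 1" "- 1"] by (simp add: val_one)
  then show ?thesis using val_mult[of "- 1" x] False by simp
qed simp

lemma val_inverse: "x \<noteq> 0 \<Longrightarrow> v (inverse x) = - v x"
  using val_mult[of x "inverse x"] by (simp add: val_one)

lemma ideal_pow_zero [simp]: "0 \<in> ideal_pow n"
  by (simp add: ideal_pow_def)

lemma ideal_pow_one [simp]: "1 \<in> ideal_pow 0"
  by (simp add: ideal_pow_def val_one)

lemma ideal_pow_uminus [simp]: "- x \<in> ideal_pow n \<longleftrightarrow> x \<in> ideal_pow n"
  by (simp add: ideal_pow_def val_uminus)

lemma ideal_pow_add: "x \<in> ideal_pow n \<Longrightarrow> y \<in> ideal_pow n \<Longrightarrow> x + y \<in> ideal_pow n"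
  using val_add[of x y] unfolding ideal_pow_def
  by (cases "x = 0"; cases "y = 0"; cases "x + y = 0") auto

lemma ideal_pow_diff: "x \<in> ideal_pow n \<Longrightarrow> y \<in> ideal_pow n \<Longrightarrow> x - y \<in> ideal_pow n"
  using ideal_pow_add[of x n "- y"] by simp

lemma ideal_pow_mult: "x \<in> ideal_pow m \<Longrightarrow> y \<in> ideal_pow n \<Longrightarrow> x * y \<in> ideal_pow (m + n)"
  using val_mult[of x y] unfolding ideal_pow_def
  by (cases "x = 0"; cases "y = 0") auto

lemma ideal_pow_mult_0:
  "x \<in> ideal_pow 0 \<Longrightarrow> y \<in> ideal_pow n \<Longrightarrow> x * y \<in> ideal_pow n"
  "x \<in> ideal_pow n \<Longrightarrow> y \<in> ideal_pow 0 \<Longrightarrow> x * y \<in> ideal_pow n"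
  using ideal_pow_mult[of x 0 y n] ideal_pow_mult[of x n y 0] by auto

lemma ideal_pow_sum: "(\<And>i. i \<in> A \<Longrightarrow> f i \<in> ideal_pow n) \<Longrightarrow> sum f A \<in> ideal_pow n"
  by (induction A rule: infinite_finite_induct) (auto simp: ideal_pow_add)

lemma ideal_pow_power: "x \<in> ideal_pow 0 \<Longrightarrow> x ^ k \<in> ideal_pow 0"
  by (induction k) (auto simp: ideal_pow_mult_0)

lemma ideal_pow_subset: "ideal_pow n \<subseteq> ideal_pow 0"
  by (auto simp: ideal_pow_def)

lemma uniformizer_power: 
  obtains \<pi> where "\<pi> \<noteq> 0" "\<pi> \<in> ideal_pow n" "\<And>x. x \<in> ideal_pow (n + m) \<Longrightarrow> \<exists>y\<in>ideal_pow m. x = \<pi> * y"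
proof -
  obtain z where z: "z \<noteq> 0" "v z = 1" using val_normalised by auto
  have vz: "v (z ^ n) = int n" for n
    by (induction n) (simp_all add: z val_one val_mult)
  have "\<exists>y\<in>ideal_pow m. x = z ^ n * y" if "x \<in> ideal_pow (n + m)" for x
  proof (rule bexI[of _ "inverse (z ^ n) * x"])
    show "inverse (z ^ n) * x \<in> ideal_pow m"
      using that z vz[of n] val_mult[of "inverse (z ^ n)" x] val_inverse[of "z ^ n"]
      by (cases "x = 0") (auto simp: ideal_pow_def)
  qed (use z in auto)
  then show ?thesis
    using that[of "z ^ n"] z vz[of n] by (auto simp: ideal_pow_def)
qed

lemma val_ring_simps:
  "add (val_ring v) = (+)" "mult (val_ring v) = (*)" "zero (val_ring v) = 0" "one (val_ring v) = 1"
  by (simp_all add: val_ring_def)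

lemma cring_val_ring: "cring (val_ring v)"
proof (rule cringI)
  show "abelian_group (val_ring v)"
  proof (rule abelian_groupI)
    fix x assume "x \<in> carrier (val_ring v)"
    then show "\<exists>y\<in>carrier (val_ring v). y \<oplus>\<^bsub>val_ring v\<^esub> x = \<zero>\<^bsub>val_ring v\<^esub>"
      by (intro bexI[of _ "- x"]) (auto simp: carrier_val_ring val_ring_simps)
  qed (auto simp: carrier_val_ring val_ring_simps ideal_pow_add)
  show "comm_monoid (val_ring v)"
    by (rule comm_monoidI) (auto simp: carrier_val_ring val_ring_simps ideal_pow_mult_0)
qed (auto simp: carrier_val_ring val_ring_simps algebra_simps)

sublocale O: cring "val_ring v"
  by (rule cring_val_ring)

lemma a_inv_val_ring: assumes "x \<in> ideal_pow 0" shows "\<ominus>\<^bsub>val_ring v\<^esub> x = - x"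
  using O.minus_equality[of "- x" x] assms by (simp add: carrier_val_ring val_ring_simps)

lemma finsum_val_ring:
  assumes "\<And>i. i \<in> A \<Longrightarrow> f i \<in> ideal_pow 0"
  shows "finsum (val_ring v) f A = sum f A"
  using assms
  by (induction A rule: infinite_finite_induct) (auto simp: O.finsum_insert carrier_val_ring val_ring_simps)

lemma ideal_ideal_pow: "ideal (ideal_pow n) (val_ring v)"
proof (rule idealI)
  show "subgroup (ideal_pow n) (add_monoid (val_ring v))"
  proof (rule O.add.subgroupI)
    fix a assume a: "a \<in> ideal_pow n"
    then show "\<ominus>\<^bsub>val_ring v\<^esub> a \<in> ideal_pow n"
      using a_inv_val_ring[of a] ideal_pow_subset[of n] by auto
  qed (use ideal_pow_subset[of n] in \<open>auto simp: carrier_val_ring val_ring_simps ideal_pow_add intro: ideal_pow_zero\<close>)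
qed (auto simp: O.ring_axioms carrier_val_ring val_ring_simps ideal_pow_mult_0)

lemma ideal_power_eq: "ideal_power (val_ring v) (max_ideal v) n = ideal_pow n"
proof (induction n)
  case 0
  show ?case by (simp add: ideal_power_def ideals_set_def carrier_val_ring)
next
  case (Suc n)
  have "ideal_power (val_ring v) (max_ideal v) (Suc n) = ideal_prod (val_ring v) (ideal_pow n) (ideal_pow 1)"
    using Suc by (simp add: ideal_power_def nat_pow_def ideals_set_def max_ideal_eq)
  also have "\<dots> = ideal_pow (Suc n)"
  proof
    show "ideal_prod (val_ring v) (ideal_pow n) (ideal_pow 1) \<subseteq> ideal_pow (Suc n)"
    proof
      fix x assume "x \<in> ideal_prod (val_ring v) (ideal_pow n) (ideal_pow 1)"
      then show "x \<in> ideal_pow (Suc n)"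
        by induction (use ideal_pow_mult[of _ n _ 1] in \<open>auto simp: val_ring_simps ideal_pow_add\<close>)
    qed
    show "ideal_pow (Suc n) \<subseteq> ideal_prod (val_ring v) (ideal_pow n) (ideal_pow 1)"
    proof
      fix x assume x: "x \<in> ideal_pow (Suc n)"
      obtain \<pi> where "\<pi> \<noteq> 0" "\<pi> \<in> ideal_pow n" "\<And>x. x \<in> ideal_pow (n + 1) \<Longrightarrow> \<exists>y\<in>ideal_pow 1. x = \<pi> * y"
        using uniformizer_power[of n 1] by blast
      then show "x \<in> ideal_prod (val_ring v) (ideal_pow n) (ideal_pow 1)"
        using ideal_prod.prod[of \<pi> "ideal_pow n" _ "ideal_pow 1" "val_ring v"] x by (auto simp: val_ring_simps)
    qed
  qed
  finally show ?case .
qed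

definition residue :: "nat \<Rightarrow> 'k \<Rightarrow> 'k set" where
  "residue n x = ideal_pow n +>\<^bsub>val_ring v\<^esub> x"

lemma residue_eq: "residue n x = (\<lambda>h. h + x) ` ideal_pow n"
  by (auto simp: residue_def a_r_coset_def r_coset_def val_ring_simps)

lemma mem_residue_iff: "z \<in> residue n x \<longleftrightarrow> z - x \<in> ideal_pow n"
proof
  assume "z \<in> residue n x"
  then obtain h where "z = h + x" "h \<in> ideal_pow n" unfolding residue_eq by (rule imageE)
  then show "z - x \<in> ideal_pow n" by simp
next
  assume "z - x \<in> ideal_pow n"
  then show "z \<in> residue n x" unfolding residue_eq by (rule rev_image_eqI) simp
qed

lemma residue_eq_iff: "residue n x = residue n y \<longleftrightarrow> x - y \<in> ideal_pow n"
proof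
  assume *: "residue n x = residue n y"
  have "x \<in> residue n x" by (simp only: mem_residue_iff diff_self ideal_pow_zero)
  then show "x - y \<in> ideal_pow n" unfolding * mem_residue_iff .
next
  assume *: "x - y \<in> ideal_pow n"
  have "z - x \<in> ideal_pow n \<longleftrightarrow> z - y \<in> ideal_pow n" for z
    using ideal_pow_add[OF _ *, of "z - x"] ideal_pow_diff[OF _ *, of "z - y"] by (intro iffI) simp_all
  then show "residue n x = residue n y" unfolding set_eq_iff mem_residue_iff by (rule allI)
qed

lemma carrier_residue_ring: "carrier (val_ring v Quot ideal_pow n) = residue n ` ideal_pow 0"
  by (auto simp: FactRing_def A_RCOSETS_def' residue_def carrier_val_ring)

text \<open>Representatives modulo \<open>P ^ Suc n\<close> arise from a \<open>P\<close>-adic expansion.\<close>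

lemma finite_residues: "finite (residue n ` ideal_pow 0)"
proof -
  have "\<exists>T. finite T \<and> T \<subseteq> ideal_pow 0 \<and> (\<forall>x\<in>ideal_pow 0. \<exists>t\<in>T. x - t \<in> ideal_pow n)"
  proof (induction n)
    case 0
    show ?case by (intro exI[of _ "{0}"]) auto
  next
    case (Suc n)
    then obtain T where T: "finite T" "T \<subseteq> ideal_pow 0" "\<And>x. x \<in> ideal_pow 0 \<Longrightarrow> \<exists>t\<in>T. x - t \<in> ideal_pow n"
      by blast
    have "finite (residue 1 ` ideal_pow 0)"
      using finite_residue_field by (simp add: max_ideal_eq carrier_residue_ring)
    then obtain U where U: "finite U" "U \<subseteq> ideal_pow 0" "residue 1 ` ideal_pow 0 = residue 1 ` U"
      using finite_subset_image[of "residue 1 ` ideal_pow 0" "residue 1" "ideal_pow 0"] by auto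
    obtain \<pi> where "\<pi> \<noteq> 0"
      and \<pi>: "\<pi> \<in> ideal_pow n" "\<And>x. x \<in> ideal_pow (n + 0) \<Longrightarrow> \<exists>y\<in>ideal_pow 0. x = \<pi> * y"
      using uniformizer_power[of n 0] by blast
    let ?V = "(\<lambda>(t, u). t + \<pi> * u) ` (T \<times> U)"
    have "\<exists>t\<in>?V. x - t \<in> ideal_pow (Suc n)" if x: "x \<in> ideal_pow 0" for x
    proof -
      obtain t where t: "t \<in> T" "x - t \<in> ideal_pow n" using T(3)[OF x] by auto
      then obtain y where y: "y \<in> ideal_pow 0" "x - t = \<pi> * y" using \<pi>(2)[of "x - t"] by auto
      have "residue 1 y \<in> residue 1 ` U" unfolding U(3)[symmetric] by (rule imageI[OF y(1)])
      then obtain u where u: "u \<in> U" "residue 1 y = residue 1 u" by (rule imageE)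
      have "x - (t + \<pi> * u) = \<pi> * (y - u)" using y(2) by (simp add: algebra_simps)
      moreover have "\<pi> * (y - u) \<in> ideal_pow (n + 1)"
        using u(2) by (intro ideal_pow_mult \<pi>) (simp add: residue_eq_iff)
      ultimately have "x - (t + \<pi> * u) \<in> ideal_pow (Suc n)" by simp
      then show ?thesis using t(1) u(1) by (intro bexI[of _ "t + \<pi> * u"]) auto
    qed
    moreover have "?V \<subseteq> ideal_pow 0"
    proof (clarify, intro ideal_pow_add ideal_pow_mult_0(1))
      fix t u assume "t \<in> T" "u \<in> U"
      then show "t \<in> ideal_pow 0" "u \<in> ideal_pow 0" using T(2) U(2) by auto
      show "\<pi> \<in> ideal_pow 0" using \<pi>(1) ideal_pow_subset by auto
    qed
    moreover have "finite ?V" using T(1) U(1) by simp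
    ultimately show ?case by (intro exI[of _ ?V] conjI) simp_all
  qed
  then obtain T where T: "finite T" "\<forall>x\<in>ideal_pow 0. \<exists>t\<in>T. x - t \<in> ideal_pow n"
    by (elim exE conjE)
  have "residue n ` ideal_pow 0 \<subseteq> residue n ` T"
  proof (rule image_subsetI)
    fix x assume "x \<in> ideal_pow 0"
    from bspec[OF T(2) this] obtain t where "t \<in> T" and t: "x - t \<in> ideal_pow n" by (rule bexE)
    then show "residue n x \<in> residue n ` T"
      unfolding residue_eq_iff[THEN iffD2, OF t] by (intro imageI)
  qed
  then show ?thesis by (rule finite_surj[OF T(1)])
qed

lemma of_nat_integral: "of_nat m \<in> ideal_pow 0"
  by (induction m) (auto intro: ideal_pow_add)

text \<open>Since \<open>p\<close> does not divide \<open>m\<close>, the image of \<open>m\<close> in the residue field is not zero, so the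
  valuation of \<open>m\<close> is zero.\<close>

lemma inverse_of_nat_integral:
  assumes "has_characteristic (val_ring v Quot max_ideal v) p" and "0 < m" "m < p"
  shows "inverse (of_nat m) \<in> ideal_pow 0"
proof -
  let ?Q = "val_ring v Quot ideal_pow 1"
  interpret I: ideal "ideal_pow 1" "val_ring v" by (rule ideal_ideal_pow)
  interpret Q: ring ?Q by (rule I.quotient_is_ring)
  have one: "\<one>\<^bsub>?Q\<^esub> = residue 1 1"
    by (simp only: FactRing_def residue_def val_ring_simps ring.simps monoid.simps)
  have add: "residue 1 x \<oplus>\<^bsub>?Q\<^esub> residue 1 y = residue 1 (x + y)"
    if "x \<in> ideal_pow 0" "y \<in> ideal_pow 0" for x y
    using ring_hom_add[OF I.rcos_ring_hom, of x y] that
    by (simp only: carrier_val_ring residue_def val_ring_simps)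
  have zero: "\<zero>\<^bsub>?Q\<^esub> = residue 1 0"
    by (simp add: FactRing_def residue_eq)
  have *: "[k] \<cdot>\<^bsub>?Q\<^esub> \<one>\<^bsub>?Q\<^esub> = residue 1 (of_nat k)" for k :: nat
  proof (induction k)
    case 0
    show ?case by (simp only: Q.add.nat_pow_0 zero of_nat_0)
  next
    case (Suc k)
    then show ?case
      by (simp only: Q.add.nat_pow_Suc one add of_nat_integral ideal_pow_one of_nat_Suc)
        (simp only: add.commute)
  qed
  have "\<not> p dvd m" using assms(2,3) using dvd_imp_le[of p m] by linarith
  then have "residue 1 (of_nat m) \<noteq> \<zero>\<^bsub>?Q\<^esub>"
    using assms(1)[unfolded has_characteristic_def max_ideal_eq, THEN spec, of m]
    unfolding * by blast
  then have "of_nat m \<notin> ideal_pow 1" unfolding zero residue_eq_iff by simp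
  then have "of_nat m \<noteq> (0::'k)" "\<not> 1 \<le> v (of_nat m)"
    by (simp_all add: ideal_pow_def)
  then show ?thesis
    using of_nat_integral[of m] val_inverse[of "of_nat m"] by (simp add: ideal_pow_def)
qed

end

section \<open>Counting\<close>

text \<open>Both sides count the classes of one equivalence relation on \<open>S\<close>.\<close>

lemma card_image_eq_card_image:
  assumes "\<And>x y. x \<in> S \<Longrightarrow> y \<in> S \<Longrightarrow> f x = f y \<longleftrightarrow> g x = g y"
  shows "card (f ` S) = card (g ` S)"
proof (rule bij_betw_same_card[of "\<lambda>u. g (SOME x. x \<in> S \<and> f x = u)"])
  define r where "r u = (SOME x. x \<in> S \<and> f x = u)" for u
  have r: "r (f x) \<in> S \<and> f (r (f x)) = f x" if "x \<in> S" for x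
    unfolding r_def by (rule someI[of _ x]) (simp add: that)
  have g: "g (r (f x)) = g x" if "x \<in> S" for x
    using assms[of "r (f x)" x] r[OF that] that by simp
  show "bij_betw (\<lambda>u. g (r u)) (f ` S) (g ` S)"
    unfolding bij_betw_def inj_on_def by (simp add: image_image g assms)
qed

text \<open>Each value of \<open>F\<close> accounts for exactly \<open>N\<close> values of \<open>E\<close>, on all of which \<open>c\<close> is constant;
  the factor \<open>N\<close> cancels in the average. Below, \<open>E\<close> sends an element of the Lie lattice to the
  residue class of its exponential, and \<open>F\<close> to the endomorphism that it induces.\<close>

lemma average_over_images:
  fixes c :: "'b \<Rightarrow> rat"
  assumes fin: "finite (E ` S)" and ne: "S \<noteq> {}"
    and E_F: "\<And>a b. a \<in> S \<Longrightarrow> b \<in> S \<Longrightarrow> E a = E b \<Longrightarrow> F a = F b"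
    and fibre: "\<And>a. a \<in> S \<Longrightarrow> card (E ` {b \<in> S. F b = F a}) = N"
    and c: "\<And>a. a \<in> S \<Longrightarrow> c (E a) = c' (F a)"
  shows "inverse (of_nat (card (F ` S))) * (\<Sum>u\<in>F ` S. c' u)
    = inverse (of_nat (card (E ` S))) * (\<Sum>u\<in>E ` S. c u)"
proof -
  let ?fib = "\<lambda>u. E ` {b \<in> S. F b = u}"
  have finF: "finite (F ` S)"
  proof (rule finite_surj[OF fin])
    show "F ` S \<subseteq> (\<lambda>e. F (SOME a. a \<in> S \<and> E a = e)) ` E ` S"
    proof (rule image_subsetI)
      fix a assume a: "a \<in> S"
      define a' where "a' = (SOME b. b \<in> S \<and> E b = E a)"
      have "a' \<in> S \<and> E a' = E a" unfolding a'_def by (rule someI[of _ a]) (simp add: a)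
      then have "F a = F a'" using E_F[of a' a] a by simp
      then show "F a \<in> (\<lambda>e. F (SOME a. a \<in> S \<and> E a = e)) ` E ` S"
        using a unfolding a'_def by (intro image_eqI[of _ _ "E a"]) simp_all
    qed
  qed
  have fibs: "E ` S = (\<Union>u\<in>F ` S. ?fib u)" by auto
  have finfib: "finite (?fib u)" for u by (rule finite_subset[OF _ fin]) auto
  have disj: "?fib u \<inter> ?fib w = {}" if "u \<noteq> w" for u w
  proof (rule ccontr)
    assume "?fib u \<inter> ?fib w \<noteq> {}"
    then obtain a b where "a \<in> S" "F a = u" "b \<in> S" "F b = w" "E a = E b" by auto
    then show False using E_F[of a b] that by simp
  qed
  have card_fib: "card (?fib u) = N" if u: "u \<in> F ` S" for u
  proof -
    from u obtain a where "a \<in> S" "u = F a" by (rule imageE)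
    then show ?thesis using fibre[of a] by simp
  qed
  have "card (E ` S) = (\<Sum>u\<in>F ` S. card (?fib u))"
    unfolding fibs by (rule card_UN_disjoint) (auto simp: finF finfib disj)
  also have "\<dots> = N * card (F ` S)" by (simp add: card_fib)
  finally have 1: "card (E ` S) = N * card (F ` S)" .
  have "(\<Sum>e\<in>E ` S. c e) = (\<Sum>u\<in>F ` S. \<Sum>e\<in>?fib u. c e)"
    unfolding fibs by (rule sum.UNION_disjoint) (auto simp: finF finfib disj)
  also have "\<dots> = (\<Sum>u\<in>F ` S. of_nat N * c' u)"
  proof (rule sum.cong[OF refl])
    fix u assume u: "u \<in> F ` S"
    have "(\<Sum>e\<in>?fib u. c e) = (\<Sum>e\<in>?fib u. c' u)"
      by (rule sum.cong[OF refl]) (auto simp: c)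
    then show "(\<Sum>e\<in>?fib u. c e) = of_nat N * c' u" by (simp add: card_fib[OF u])
  qed
  finally have 2: "(\<Sum>e\<in>E ` S. c e) = of_nat N * (\<Sum>u\<in>F ` S. c' u)"
    by (simp add: sum_distrib_left)
  have "card (E ` S) \<noteq> 0" using fin ne by simp
  then have "N \<noteq> 0" using 1 by auto
  then show ?thesis unfolding 1 2 by (simp add: field_simps)
qed

text \<open>Restricting each \<open>\<phi> g\<close> to \<open>E\<close> turns the action into a homomorphism to the group of
  permutations of \<open>E\<close>, without changing orbits or fixed points.\<close>

lemma burnside_left:
  assumes "group H" and fin: "finite (carrier H)" "finite E"
    and closed: "\<And>g x. g \<in> carrier H \<Longrightarrow> x \<in> E \<Longrightarrow> \<phi> g x \<in> E"
    and one: "\<And>x. x \<in> E \<Longrightarrow> \<phi> \<one>\<^bsub>H\<^esub> x = x"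
    and mult: "\<And>g h x. g \<in> carrier H \<Longrightarrow> h \<in> carrier H \<Longrightarrow> x \<in> E \<Longrightarrow> \<phi> (g \<otimes>\<^bsub>H\<^esub> h) x = \<phi> g (\<phi> h x)"
  shows "card (orbits H E \<phi>) * card (carrier H) = (\<Sum>g\<in>carrier H. card {x \<in> E. \<phi> g x = x})"
proof -
  interpret group H by fact
  define \<psi> where "\<psi> g = (\<lambda>x\<in>E. \<phi> g x)" for g
  have Bij: "\<psi> g \<in> Bij E" if g: "g \<in> carrier H" for g
  proof -
    have "bij_betw (\<psi> g) E E"
    proof (rule bij_betw_byWitness[of _ "\<psi> (inv\<^bsub>H\<^esub> g)"])
      show "\<forall>x\<in>E. \<psi> (inv\<^bsub>H\<^esub> g) (\<psi> g x) = x" "\<forall>x\<in>E. \<psi> g (\<psi> (inv\<^bsub>H\<^esub> g) x) = x"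
        using g by (simp_all add: \<psi>_def closed one flip: mult)
    qed (use g in \<open>auto simp: \<psi>_def closed\<close>)
    then show ?thesis by (simp add: Bij_def \<psi>_def)
  qed
  have "\<psi> \<in> hom H (BijGroup E)"
  proof (rule homI)
    fix g h assume gh: "g \<in> carrier H" "h \<in> carrier H"
    have "\<psi> g \<otimes>\<^bsub>BijGroup E\<^esub> \<psi> h = compose E (\<psi> g) (\<psi> h)"
      using Bij[OF gh(1)] Bij[OF gh(2)] by (simp add: BijGroup_def)
    also have "\<dots> = \<psi> (g \<otimes>\<^bsub>H\<^esub> h)"
      by (rule ext) (simp add: compose_def \<psi>_def mult closed gh)
    finally show "\<psi> (g \<otimes>\<^bsub>H\<^esub> h) = \<psi> g \<otimes>\<^bsub>BijGroup E\<^esub> \<psi> h" by simp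
  qed (simp add: BijGroup_def Bij)
  then interpret group_action H E \<psi>
    by (simp add: group_action_def group_hom_def group_hom_axioms_def group_BijGroup group_axioms)
  have "orbits H E \<psi> = orbits H E \<phi>"
  proof -
    have "orbit H \<psi> x = orbit H \<phi> x" if "x \<in> E" for x
      using that by (simp add: orbit_def \<psi>_def)
    then show ?thesis unfolding orbits_def by auto
  qed
  moreover have "invariants E \<psi> g = {x \<in> E. \<phi> g x = x}" for g
    by (auto simp: invariants_def \<psi>_def)
  ultimately show ?thesis using burnside[OF fin] by (simp add: order_def)
qed

text \<open>A right action is a left action of the opposite group, which has the same orbits.\<close>

lemma burnside_right:
  assumes "group H" and fin: "finite (carrier H)" "finite E"
    and closed: "\<And>g x. g \<in> carrier H \<Longrightarrow> x \<in> E \<Longrightarrow> \<phi> g x \<in> E"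
    and one: "\<And>x. x \<in> E \<Longrightarrow> \<phi> \<one>\<^bsub>H\<^esub> x = x"
    and mult: "\<And>g h x. g \<in> carrier H \<Longrightarrow> h \<in> carrier H \<Longrightarrow> x \<in> E \<Longrightarrow> \<phi> (g \<otimes>\<^bsub>H\<^esub> h) x = \<phi> h (\<phi> g x)"
  shows "card (orbits H E \<phi>) * card (carrier H) = (\<Sum>g\<in>carrier H. card {x \<in> E. \<phi> g x = x})"
proof -
  interpret group H by fact
  define K where "K = H\<lparr>mult := \<lambda>a b. b \<otimes>\<^bsub>H\<^esub> a\<rparr>"
  have "group K"
  proof (rule groupI)
    fix x assume "x \<in> carrier K"
    then show "\<exists>y\<in>carrier K. y \<otimes>\<^bsub>K\<^esub> x = \<one>\<^bsub>K\<^esub>"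
      by (intro bexI[of _ "inv\<^bsub>H\<^esub> x"]) (simp_all add: K_def)
  qed (simp_all add: K_def m_assoc)
  then have "card (orbits K E \<phi>) * card (carrier K) = (\<Sum>g\<in>carrier K. card {x \<in> E. \<phi> g x = x})"
    by (rule burnside_left) (simp_all add: K_def fin closed one mult)
  then show ?thesis by (simp add: K_def orbits_def orbit_def)
qed

text \<open>Conjugation by \<open>g\<close> fixes \<open>x\<close> exactly when \<open>g\<close> and \<open>x\<close> commute.\<close>

lemma class_number_eq:
  assumes "group H" and fin: "finite (carrier H)"
  shows "class_number H * card (carrier H)
    = (\<Sum>g\<in>carrier H. card {x \<in> carrier H. g \<otimes>\<^bsub>H\<^esub> x = x \<otimes>\<^bsub>H\<^esub> g})"
proof -
  interpret group H by fact
  have "class_number H * card (carrier H)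
      = (\<Sum>g\<in>carrier H. card {x \<in> carrier H. g \<otimes>\<^bsub>H\<^esub> x \<otimes>\<^bsub>H\<^esub> inv\<^bsub>H\<^esub> g = x})"
    unfolding class_number_def
    by (rule burnside_left) (simp_all add: group_axioms fin inv_mult_group m_assoc)
  also have "\<dots> = (\<Sum>g\<in>carrier H. card {x \<in> carrier H. g \<otimes>\<^bsub>H\<^esub> x = x \<otimes>\<^bsub>H\<^esub> g})"
  proof -
    have "g \<otimes>\<^bsub>H\<^esub> x \<otimes>\<^bsub>H\<^esub> inv\<^bsub>H\<^esub> g = x \<longleftrightarrow> g \<otimes>\<^bsub>H\<^esub> x = x \<otimes>\<^bsub>H\<^esub> g"
      if "g \<in> carrier H" "x \<in> carrier H" for g x
      using inv_solve_right'[of x "g \<otimes>\<^bsub>H\<^esub> x" g] that by auto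
    then show ?thesis
      by (intro sum.cong arg_cong[of _ _ card] Collect_cong conj_cong refl) simp
  qed
  finally show ?thesis .
qed

section \<open>Endomorphisms of quotient modules\<close>

context abelian_subgroup
begin

lemma coset_eq_iff:
  assumes "x \<in> carrier G" "y \<in> carrier G"
  shows "H +> x = H +> y \<longleftrightarrow> (\<exists>w\<in>H. x = w \<oplus> y)"
proof
  assume "H +> x = H +> y"
  then have "x \<in> H +> y" using a_rcos_self[OF assms(1)] by simp
  then show "\<exists>w\<in>H. x = w \<oplus> y" by (auto simp: a_r_coset_def r_coset_def)
next
  assume "\<exists>w\<in>H. x = w \<oplus> y"
  then have "x \<in> H +> y" by (auto simp: a_r_coset_def r_coset_def)
  then show "H +> x = H +> y" by (rule a_repr_independence[OF _ assms(2) a_subgroup, symmetric])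
qed

lemma coset_eq_self_iff: "x \<in> carrier G \<Longrightarrow> H +> x = H \<longleftrightarrow> x \<in> H"
  using a_rcos_self[of x] a_rcos_const[of x] by auto

end

lemma induced_map_coset:
  assumes "abelian_subgroup W V"
    and closed: "\<And>x. x \<in> carrier V \<Longrightarrow> f x \<in> carrier V"
    and add: "\<And>x y. x \<in> carrier V \<Longrightarrow> y \<in> carrier V \<Longrightarrow> f (x \<oplus>\<^bsub>V\<^esub> y) = f x \<oplus>\<^bsub>V\<^esub> f y"
    and W: "\<And>x. x \<in> W \<Longrightarrow> f x \<in> W"
    and x: "x \<in> carrier V"
  shows "induced_map V W f (W +>\<^bsub>V\<^esub> x) = W +>\<^bsub>V\<^esub> f x"
proof -
  interpret abelian_subgroup W V by fact
  have "W +>\<^bsub>V\<^esub> x \<in> carrier (V A_Mod W)"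
    using x by (auto simp: A_FactGroup_def' A_RCOSETS_def')
  then have "induced_map V W f (W +>\<^bsub>V\<^esub> x) = (\<Union>y\<in>W +>\<^bsub>V\<^esub> x. W +>\<^bsub>V\<^esub> f y)"
    by (simp add: induced_map_def)
  also have "\<dots> = (\<Union>y\<in>W +>\<^bsub>V\<^esub> x. W +>\<^bsub>V\<^esub> f x)"
  proof (rule SUP_cong[OF refl])
    fix y assume "y \<in> W +>\<^bsub>V\<^esub> x"
    then obtain w where w: "w \<in> W" "y = w \<oplus>\<^bsub>V\<^esub> x" by (auto simp: a_r_coset_def r_coset_def)
    then have "f y = f w \<oplus>\<^bsub>V\<^esub> f x" using add[of w x] x a_Hcarr[OF w(1)] by simp
    then show "W +>\<^bsub>V\<^esub> f y = W +>\<^bsub>V\<^esub> f x"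
      using W[OF w(1)] closed[OF x] closed[of y] x a_Hcarr[OF w(1)] w(2)
      by (subst coset_eq_iff) auto
  qed
  also have "\<dots> = W +>\<^bsub>V\<^esub> f x" using a_rcos_self[OF x] by auto
  finally show ?thesis .
qed

lemma kernel_induced_map:
  assumes "abelian_subgroup W V"
    and closed: "\<And>x. x \<in> carrier V \<Longrightarrow> f x \<in> carrier V"
    and add: "\<And>x y. x \<in> carrier V \<Longrightarrow> y \<in> carrier V \<Longrightarrow> f (x \<oplus>\<^bsub>V\<^esub> y) = f x \<oplus>\<^bsub>V\<^esub> f y"
    and W: "\<And>x. x \<in> W \<Longrightarrow> f x \<in> W"
  shows "kernel (V A_Mod W) (V A_Mod W) (induced_map V W f)
    = (\<lambda>x. W +>\<^bsub>V\<^esub> x) ` {x \<in> carrier V. f x \<in> W}"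
proof -
  interpret abelian_subgroup W V by fact
  have "kernel (V A_Mod W) (V A_Mod W) (induced_map V W f)
      = (\<lambda>x. W +>\<^bsub>V\<^esub> x) ` {x \<in> carrier V. induced_map V W f (W +>\<^bsub>V\<^esub> x) = W}"
  proof -
    have carr: "carrier (V A_Mod W) = (\<lambda>x. W +>\<^bsub>V\<^esub> x) ` carrier V"
      by (simp add: A_FactGroup_def' A_RCOSETS_def' UNION_singleton_eq_range)
    have one: "\<one>\<^bsub>V A_Mod W\<^esub> = W" by (simp add: A_FactGroup_def')
    have img: "{X. X \<in> h ` A \<and> k X = W} = h ` {x \<in> A. k (h x) = W}" for A h k
      by auto
    show ?thesis unfolding kernel_def carr one by (rule img)
  qed
  also have "{x \<in> carrier V. induced_map V W f (W +>\<^bsub>V\<^esub> x) = W} = {x \<in> carrier V. f x \<in> W}"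
  proof (intro Collect_cong conj_cong refl)
    fix x assume x: "x \<in> carrier V"
    show "induced_map V W f (W +>\<^bsub>V\<^esub> x) = W \<longleftrightarrow> f x \<in> W"
    proof -
      have "induced_map V W f (W +>\<^bsub>V\<^esub> x) = W +>\<^bsub>V\<^esub> f x"
        by (rule induced_map_coset[OF assms x])
      then show ?thesis by (simp only: coset_eq_self_iff[OF closed[OF x]])
    qed
  qed
  finally show ?thesis .
qed

lemma induced_map_eq_iff:
  assumes "abelian_subgroup W V"
    and f: "\<And>x. x \<in> carrier V \<Longrightarrow> f x \<in> carrier V"
      "\<And>x y. x \<in> carrier V \<Longrightarrow> y \<in> carrier V \<Longrightarrow> f (x \<oplus>\<^bsub>V\<^esub> y) = f x \<oplus>\<^bsub>V\<^esub> f y"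
      "\<And>x. x \<in> W \<Longrightarrow> f x \<in> W"
    and g: "\<And>x. x \<in> carrier V \<Longrightarrow> g x \<in> carrier V"
      "\<And>x y. x \<in> carrier V \<Longrightarrow> y \<in> carrier V \<Longrightarrow> g (x \<oplus>\<^bsub>V\<^esub> y) = g x \<oplus>\<^bsub>V\<^esub> g y"
      "\<And>x. x \<in> W \<Longrightarrow> g x \<in> W"
  shows "induced_map V W f = induced_map V W g \<longleftrightarrow> (\<forall>x\<in>carrier V. \<exists>w\<in>W. f x = w \<oplus>\<^bsub>V\<^esub> g x)"
proof -
  interpret abelian_subgroup W V by fact
  have ext: "induced_map V W f = induced_map V W g \<longleftrightarrow>
      (\<forall>x\<in>carrier V. induced_map V W f (W +>\<^bsub>V\<^esub> x) = induced_map V W g (W +>\<^bsub>V\<^esub> x))"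
  proof
    assume *: "\<forall>x\<in>carrier V. induced_map V W f (W +>\<^bsub>V\<^esub> x) = induced_map V W g (W +>\<^bsub>V\<^esub> x)"
    show "induced_map V W f = induced_map V W g"
    proof
      fix X
      show "induced_map V W f X = induced_map V W g X"
      proof (cases "X \<in> carrier (V A_Mod W)")
        case True
        then show ?thesis using * unfolding A_FactGroup_def' A_RCOSETS_def' by auto
      qed (simp add: induced_map_def)
    qed
  qed simp
  show ?thesis
    unfolding ext
    by (rule ball_cong[OF refl])
      (simp only: induced_map_coset[of W V f, OF assms(1) f] induced_map_coset[of W V g, OF assms(1) g]
        coset_eq_iff f(1) g(1))
qed

context nonarch_local_field
begin

text \<open>The ideal is generated by \<open>\<pi>\<close>, so the products \<open>r x\<close> with \<open>r\<close> in the ideal are the multiples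
  of \<open>\<pi>\<close>, and these already form a subgroup.\<close>

lemma ideal_times_module_eq:
  assumes "module (val_ring v) V"
    and \<pi>: "\<pi> \<in> ideal_pow n" "\<And>x. x \<in> ideal_pow n \<Longrightarrow> \<exists>y\<in>ideal_pow 0. x = \<pi> * y"
  shows "ideal_times_module (val_ring v) (ideal_pow n) V = (\<lambda>x. \<pi> \<odot>\<^bsub>V\<^esub> x) ` carrier V"
    and "abelian_subgroup (ideal_times_module (val_ring v) (ideal_pow n) V) V"
proof -
  interpret module "val_ring v" V by fact
  let ?S = "(\<lambda>x. \<pi> \<odot>\<^bsub>V\<^esub> x) ` carrier V"
  have \<pi>0: "\<pi> \<in> carrier (val_ring v)" using \<pi>(1) ideal_pow_subset[of n] by (auto simp: carrier_val_ring)
  have gens: "{r \<odot>\<^bsub>V\<^esub> x | r x. r \<in> ideal_pow n \<and> x \<in> carrier V} = ?S"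
  proof (intro equalityI subsetI)
    fix z assume "z \<in> {r \<odot>\<^bsub>V\<^esub> x | r x. r \<in> ideal_pow n \<and> x \<in> carrier V}"
    then obtain r x where rx: "z = r \<odot>\<^bsub>V\<^esub> x" "r \<in> ideal_pow n" "x \<in> carrier V" by blast
    from \<pi>(2)[OF rx(2)] obtain s where s: "s \<in> ideal_pow 0" "r = \<pi> * s" by (rule bexE)
    then have "z = \<pi> \<odot>\<^bsub>V\<^esub> (s \<odot>\<^bsub>V\<^esub> x)"
      using smult_assoc1[of \<pi> s x] rx \<pi>0 by (simp add: carrier_val_ring val_ring_simps)
    then show "z \<in> ?S" using s rx by (simp add: carrier_val_ring)
  qed (use \<pi>(1) in blast)
  have "subgroup ?S (add_monoid V)"
  proof (rule M.add.subgroupI)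
    fix a assume "a \<in> ?S"
    then obtain x where "x \<in> carrier V" "a = \<pi> \<odot>\<^bsub>V\<^esub> x" by blast
    then show "\<ominus>\<^bsub>V\<^esub> a \<in> ?S" using smult_r_minus[OF \<pi>0, of x] by (intro image_eqI[of _ _ "\<ominus>\<^bsub>V\<^esub> x"]) simp_all
  next
    fix a b assume "a \<in> ?S" "b \<in> ?S"
    then obtain x y where "x \<in> carrier V" "a = \<pi> \<odot>\<^bsub>V\<^esub> x" "y \<in> carrier V" "b = \<pi> \<odot>\<^bsub>V\<^esub> y" by blast
    then show "a \<oplus>\<^bsub>V\<^esub> b \<in> ?S"
      using smult_r_distr[OF \<pi>0, of x y] by (intro image_eqI[of _ _ "x \<oplus>\<^bsub>V\<^esub> y"]) simp_all
  qed (use \<pi>0 M.zero_closed in auto)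
  note S = this
  then have "generate (add_monoid V) ?S \<subseteq> ?S"
    by (rule M.add.generate_subgroup_incl[OF order_refl])
  moreover have "?S \<subseteq> generate (add_monoid V) ?S"
    by (rule subsetI) (rule generate.incl)
  ultimately show eq: "ideal_times_module (val_ring v) (ideal_pow n) V = ?S"
    unfolding ideal_times_module_def gens by (rule equalityI)
  show "abelian_subgroup (ideal_times_module (val_ring v) (ideal_pow n) V) V"
    unfolding eq by (intro abelian_subgroupI3 additive_subgroupI S M.abelian_group_axioms)
qed

end

(* keeps the 1 in superdiag d 1 from being rewritten to Suc 0 *)
declare One_nat_def [simp del]
section \<open>Lie lattices and their exponentials\<close>

locale lie_lattice = nonarch_local_field v
  for v :: "'k::field_char_0 \<Rightarrow> int" +
  fixes p d :: nat and \<gg> :: "'k mat set"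
  assumes residue_char: "has_characteristic (val_ring v Quot max_ideal v) p"
    and lie: "lie_subalgebra v d \<gg>"
    and d_le_p: "d \<le> p"
    and isolated: "isolated_submodule (val_ring v) (strict_upper_module v d) \<gg>"
begin

abbreviation Exp :: "'k umat \<Rightarrow> 'k umat" where "Exp \<equiv> umat.Exp d"
abbreviation Log :: "'k umat \<Rightarrow> 'k umat" where "Log \<equiv> umat.Log d"
abbreviation ev :: "'k fps \<Rightarrow> 'k umat \<Rightarrow> 'k umat" where "ev \<equiv> umat.ev d"
abbreviation (input) strict :: "'k umat set" where "strict \<equiv> superdiag d 1"

text \<open>For each \<open>n\<close> this is a two-sided ideal of the ring \<open>ideal_mats 0\<close> of integral matrices, and \<open>x - y \<in> ideal_mats n\<close> is congruence modulo the \<open>n\<close>-th power of the maximal ideal.\<close>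

definition ideal_mats :: "nat \<Rightarrow> 'k umat set" where
  "ideal_mats n = {x. \<forall>i j. entry x i j \<in> ideal_pow n}"

lemma ideal_mats_zero: "0 \<in> ideal_mats n" by (simp add: ideal_mats_def)

lemma ideal_mats_one: "1 \<in> ideal_mats 0" by (simp add: ideal_mats_def entry_one)

lemma ideal_mats_add: "x \<in> ideal_mats n \<Longrightarrow> y \<in> ideal_mats n \<Longrightarrow> x + y \<in> ideal_mats n"
  by (simp add: ideal_mats_def ideal_pow_add)

lemma ideal_mats_diff: "x \<in> ideal_mats n \<Longrightarrow> y \<in> ideal_mats n \<Longrightarrow> x - y \<in> ideal_mats n"
  by (simp add: ideal_mats_def ideal_pow_diff)

lemma ideal_mats_uminus: "x \<in> ideal_mats n \<Longrightarrow> - x \<in> ideal_mats n"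
  by (simp add: ideal_mats_def)

lemma ideal_mats_mult: "x \<in> ideal_mats m \<Longrightarrow> y \<in> ideal_mats n \<Longrightarrow> x * y \<in> ideal_mats (m + n)"
  by (simp add: ideal_mats_def entry_mult[OF order_refl] ideal_pow_sum ideal_pow_mult)

lemma ideal_mats_mult_left: "x \<in> ideal_mats 0 \<Longrightarrow> y \<in> ideal_mats n \<Longrightarrow> x * y \<in> ideal_mats n"
  using ideal_mats_mult[of x 0 y n] by simp

lemma ideal_mats_mult_right: "x \<in> ideal_mats n \<Longrightarrow> y \<in> ideal_mats 0 \<Longrightarrow> x * y \<in> ideal_mats n"
  using ideal_mats_mult[of x n y 0] by simp

lemma ideal_mats_scale: "c \<in> ideal_pow 0 \<Longrightarrow> x \<in> ideal_mats n \<Longrightarrow> scalar_umat c * x \<in> ideal_mats n"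
  by (simp add: ideal_mats_def ideal_pow_mult_0)

lemma ideal_mats_sum: "(\<And>i. i \<in> A \<Longrightarrow> f i \<in> ideal_mats n) \<Longrightarrow> sum f A \<in> ideal_mats n"
  by (induction A rule: infinite_finite_induct) (simp_all add: ideal_mats_zero ideal_mats_add)

lemma ideal_mats_power: "x \<in> ideal_mats 0 \<Longrightarrow> x ^ m \<in> ideal_mats 0"
  by (induction m) (simp_all add: ideal_mats_one ideal_mats_mult_left)

lemma ideal_mats_sym: "x - y \<in> ideal_mats n \<Longrightarrow> y - x \<in> ideal_mats n"
  using ideal_mats_uminus[of "x - y"] by simp

definition integral_series :: "'k fps \<Rightarrow> bool" where
  "integral_series f \<longleftrightarrow> (\<forall>m < max 1 d. fps_nth f m \<in> ideal_pow 0)"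

lemma ideal_mats_ev: "integral_series f \<Longrightarrow> x \<in> ideal_mats 0 \<Longrightarrow> ev f x \<in> ideal_mats 0"
  unfolding umat.ev_def integral_series_def by (intro ideal_mats_sum ideal_mats_scale ideal_mats_power) auto

text \<open>Congruences pass to powers by induction, and thus to the values of integral power series.\<close>

lemma ev_annihilates:
  assumes f: "integral_series f" "fps_nth f 0 = 0" and y: "y \<in> ideal_mats 0" and xy: "x * y \<in> ideal_mats n"
  shows "x * ev f y \<in> ideal_mats n"
  unfolding umat.ev_def sum_distrib_left
proof (rule ideal_mats_sum)
  fix m assume m: "m \<in> {..<max 1 d}"
  show "x * (scalar_umat (fps_nth f m) * y ^ m) \<in> ideal_mats n"
  proof (cases m)
    case (Suc k)
    have "x * (scalar_umat (fps_nth f m) * y ^ m) = scalar_umat (fps_nth f m) * (x * y * y ^ k)"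
      by (simp only: umat.s_left_commute Suc power_Suc mult.assoc)
    also have "\<dots> \<in> ideal_mats n"
      using f(1) m unfolding integral_series_def by (intro ideal_mats_scale ideal_mats_mult_right xy ideal_mats_power y) auto
    finally show ?thesis .
  qed (simp add: f(2) ideal_mats_zero)
qed

lemma ev_commutes:
  assumes f: "integral_series f" and x: "x \<in> ideal_mats 0" and y: "y \<in> ideal_mats 0" and xy: "x * y - y * x \<in> ideal_mats n"
  shows "x * ev f y - ev f y * x \<in> ideal_mats n"
proof -
  have pow: "x * y ^ m - y ^ m * x \<in> ideal_mats n" for m
  proof (induction m)
    case (Suc m)
    have "x * y ^ Suc m - y ^ Suc m * x = y * (x * y ^ m - y ^ m * x) + (x * y - y * x) * y ^ m"
      by (simp add: algebra_simps)
    also have "\<dots> \<in> ideal_mats n"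
      by (intro ideal_mats_add ideal_mats_mult_left[OF y Suc] ideal_mats_mult_right[OF xy] ideal_mats_power y)
    finally show ?case .
  qed (simp add: ideal_mats_zero)
  have "x * ev f y - ev f y * x = (\<Sum>m<max 1 d. scalar_umat (fps_nth f m) * (x * y ^ m - y ^ m * x))"
    unfolding umat.ev_def sum_distrib_left sum_distrib_right sum_subtractf[symmetric]
    by (intro sum.cong refl) (simp only: umat.s_left_commute[of x] right_diff_distrib mult.assoc)
  also have "\<dots> \<in> ideal_mats n"
    using f unfolding integral_series_def by (intro ideal_mats_sum ideal_mats_scale pow) auto
  finally show ?thesis .
qed

lemma ev_cong:
  assumes f: "integral_series f" and x: "x \<in> ideal_mats 0" and y: "y \<in> ideal_mats 0" and xy: "x - y \<in> ideal_mats n"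
  shows "ev f x - ev f y \<in> ideal_mats n"
proof -
  have pow: "x ^ m - y ^ m \<in> ideal_mats n" for m
  proof (induction m)
    case (Suc m)
    have "x ^ Suc m - y ^ Suc m = x * (x ^ m - y ^ m) + (x - y) * y ^ m"
      by (simp add: algebra_simps)
    also have "\<dots> \<in> ideal_mats n"
      by (intro ideal_mats_add ideal_mats_mult_left[OF x Suc] ideal_mats_mult_right[OF xy] ideal_mats_power y)
    finally show ?case .
  qed (simp add: ideal_mats_zero)
  have "ev f x - ev f y = (\<Sum>m<max 1 d. scalar_umat (fps_nth f m) * (x ^ m - y ^ m))"
    by (simp only: umat.ev_def right_diff_distrib sum_subtractf)
  also have "\<dots> \<in> ideal_mats n"
    using f unfolding integral_series_def by (intro ideal_mats_sum ideal_mats_scale pow) auto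
  finally show ?thesis .
qed

text \<open>Here \<open>d \<le> p\<close> enters: the denominators \<open>m\<close> and \<open>m!\<close> for \<open>m < d\<close> are units.\<close>

lemma inverse_of_nat_integral': "0 < m \<Longrightarrow> m < max 1 d \<Longrightarrow> inverse (of_nat m) \<in> ideal_pow 0"
  using inverse_of_nat_integral[OF residue_char, of m] d_le_p by simp

lemma integral_series_exp: "integral_series (fps_exp 1)"
proof -
  have "inverse (fact m) \<in> ideal_pow 0" if "m < max 1 d" for m
    using that
  proof (induction m)
    case (Suc m)
    have "inverse (fact (Suc m) :: 'k) = inverse (of_nat (Suc m)) * inverse (fact m)"
      by (simp only: fact_Suc inverse_mult_distrib)
    also have "\<dots> \<in> ideal_pow 0"
      using Suc by (intro ideal_pow_mult_0(1) inverse_of_nat_integral') simp_all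
    finally show ?case .
  qed simp
  then show ?thesis by (simp add: integral_series_def divide_inverse)
qed

lemma integral_series_ln: "integral_series (fps_ln 1)"
proof -
  have "(- 1) ^ (m - 1) * inverse (of_nat m) \<in> ideal_pow 0" if "0 < m" "m < max 1 d" for m
    using that by (intro ideal_pow_mult_0(1) inverse_of_nat_integral' ideal_pow_power) simp_all
  then show ?thesis by (simp add: integral_series_def divide_inverse fps_ln_nth)
qed

lemma integral_series_exp_minus_1: "integral_series (fps_exp 1 - 1)"
  using integral_series_exp unfolding integral_series_def by (auto intro: ideal_pow_diff)

lemma strict_nilpotent: "x \<in> strict \<Longrightarrow> x ^ max 1 d = 0"
  by (rule umat.N_nilpotent)

lemma Exp_minus_1: "x \<in> strict \<Longrightarrow> Exp x - 1 = ev (fps_exp 1 - 1) x"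
  by (simp only: umat.Exp_def umat.ev_diff umat.ev_one[OF strict_nilpotent])

lemma Log_Exp: "x \<in> strict \<Longrightarrow> Log (Exp x - 1) = x"
  by (rule umat.Log_Exp[OF strict_nilpotent])

lemma ideal_mats_Exp: "x \<in> ideal_mats 0 \<Longrightarrow> Exp x \<in> ideal_mats 0"
  unfolding umat.Exp_def by (rule ideal_mats_ev[OF integral_series_exp])

lemma ideal_mats_Log: "x \<in> ideal_mats 0 \<Longrightarrow> Log x \<in> ideal_mats 0"
  unfolding umat.Log_def by (rule ideal_mats_ev[OF integral_series_ln])

text \<open>Each of \<open>exp y - 1\<close> and \<open>y = log (1 + (exp y - 1))\<close> is an integral power series without
  constant term in the other. The next lemmas rest on the same observation.\<close>

lemma annihilates_Exp_iff:
  assumes y: "y \<in> strict" "y \<in> ideal_mats 0"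
  shows "x * (Exp y - 1) \<in> ideal_mats n \<longleftrightarrow> x * y \<in> ideal_mats n"
proof
  assume "x * (Exp y - 1) \<in> ideal_mats n"
  then have "x * Log (Exp y - 1) \<in> ideal_mats n"
    unfolding umat.Log_def
    by (rule ev_annihilates[rotated 3]) (simp_all add: integral_series_ln ideal_mats_diff ideal_mats_Exp ideal_mats_one y)
  then show "x * y \<in> ideal_mats n" by (simp only: Log_Exp[OF y(1)])
next
  assume "x * y \<in> ideal_mats n"
  then show "x * (Exp y - 1) \<in> ideal_mats n"
    unfolding Exp_minus_1[OF y(1)]
    by (rule ev_annihilates[rotated 3]) (simp_all add: integral_series_exp_minus_1 y)
qed

lemma Exp_cong_iff:
  assumes x: "x \<in> strict" "x \<in> ideal_mats 0" and y: "y \<in> strict" "y \<in> ideal_mats 0"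
  shows "Exp x - Exp y \<in> ideal_mats n \<longleftrightarrow> x - y \<in> ideal_mats n"
proof
  assume "x - y \<in> ideal_mats n"
  then show "Exp x - Exp y \<in> ideal_mats n"
    unfolding umat.Exp_def by (rule ev_cong[OF integral_series_exp x(2) y(2)])
next
  assume "Exp x - Exp y \<in> ideal_mats n"
  then have "Exp x - 1 - (Exp y - 1) \<in> ideal_mats n" by simp
  then have "Log (Exp x - 1) - Log (Exp y - 1) \<in> ideal_mats n"
    unfolding umat.Log_def
    by (rule ev_cong[rotated 3]) (simp_all add: integral_series_ln ideal_mats_diff ideal_mats_Exp ideal_mats_one x y)
  then show "x - y \<in> ideal_mats n" by (simp only: Log_Exp x y)
qed

lemma Exp_commutes_iff:
  assumes x: "x \<in> ideal_mats 0" and y: "y \<in> strict" "y \<in> ideal_mats 0"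
  shows "x * Exp y - Exp y * x \<in> ideal_mats n \<longleftrightarrow> x * y - y * x \<in> ideal_mats n"
proof
  assume "x * y - y * x \<in> ideal_mats n"
  then show "x * Exp y - Exp y * x \<in> ideal_mats n"
    unfolding umat.Exp_def by (rule ev_commutes[OF integral_series_exp x y(2)])
next
  assume "x * Exp y - Exp y * x \<in> ideal_mats n"
  then have "x * (Exp y - 1) - (Exp y - 1) * x \<in> ideal_mats n" by (simp add: algebra_simps)
  then have "x * Log (Exp y - 1) - Log (Exp y - 1) * x \<in> ideal_mats n"
    unfolding umat.Log_def
    by (rule ev_commutes[rotated 3]) (simp_all add: integral_series_ln ideal_mats_diff ideal_mats_Exp ideal_mats_one x y)
  then show "x * y - y * x \<in> ideal_mats n" by (simp only: Log_Exp y)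
qed

lemma Exps_commute_iff:
  assumes x: "x \<in> strict" "x \<in> ideal_mats 0" and y: "y \<in> strict" "y \<in> ideal_mats 0"
  shows "Exp x * Exp y - Exp y * Exp x \<in> ideal_mats n \<longleftrightarrow> x * y - y * x \<in> ideal_mats n"
proof -
  have flip: "a * b - b * a \<in> ideal_mats n \<longleftrightarrow> b * a - a * b \<in> ideal_mats n" for a b
    using ideal_mats_sym[of "a * b" "b * a"] ideal_mats_sym[of "b * a" "a * b"] by (rule iffI)
  have "Exp x * Exp y - Exp y * Exp x \<in> ideal_mats n \<longleftrightarrow> Exp x * y - y * Exp x \<in> ideal_mats n"
    by (rule Exp_commutes_iff[OF ideal_mats_Exp[OF x(2)] y])
  also have "\<dots> \<longleftrightarrow> y * Exp x - Exp x * y \<in> ideal_mats n" by (rule flip)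
  also have "\<dots> \<longleftrightarrow> y * x - x * y \<in> ideal_mats n" by (rule Exp_commutes_iff[OF y(2) x])
  also have "\<dots> \<longleftrightarrow> x * y - y * x \<in> ideal_mats n" by (rule flip)
  finally show ?thesis .
qed

subsection \<open>The lattice inside the ring of upper triangular matrices\<close>

text \<open>The Lie lattice transported to the ring of upper triangular matrices, where it is used to
  index both the group and the Lie algebra.\<close>

definition lattice :: "'k umat set" where
  "lattice = {x \<in> strict. to_mat d x \<in> \<gg>}"

lemma carrier_strict_upper:
  "A \<in> carrier (strict_upper_module v d) \<longleftrightarrow> A \<in> carrier_mat d d \<and>
    (\<forall>i<d. \<forall>j<d. A $$ (i, j) \<in> ideal_pow 0) \<and> (\<forall>i<d. \<forall>j\<le>i. A $$ (i, j) = 0)"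
proof -
  have "elements_mat A \<subseteq> ideal_pow 0 \<longleftrightarrow> (\<forall>i<d. \<forall>j<d. A $$ (i, j) \<in> ideal_pow 0)"
    if "A \<in> carrier_mat d d"
  proof
    assume "elements_mat A \<subseteq> ideal_pow 0"
    then show "\<forall>i<d. \<forall>j<d. A $$ (i, j) \<in> ideal_pow 0" using that by blast
  next
    assume *: "\<forall>i<d. \<forall>j<d. A $$ (i, j) \<in> ideal_pow 0"
    show "elements_mat A \<subseteq> ideal_pow 0"
    proof
      fix a assume "a \<in> elements_mat A"
      from elements_matD[OF this] show "a \<in> ideal_pow 0" using * that by auto
    qed
  qed
  then show ?thesis by (auto simp: strict_upper_module_def carrier_val_ring)
qed

lemma strict_upper_simps:
  "add (strict_upper_module v d) = (+)" "zero (strict_upper_module v d) = 0\<^sub>m d d"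
  "smult (strict_upper_module v d) = (\<cdot>\<^sub>m)"
  by (simp_all add: strict_upper_module_def module_mat_def)

lemma submodule: "submodule \<gg> (val_ring v) (strict_upper_module v d)"
  using lie by (simp add: lie_subalgebra_def)

lemma \<gg>_strict_upper: "A \<in> \<gg> \<Longrightarrow> A \<in> carrier (strict_upper_module v d)"
  using subgroup.subset[OF submodule.axioms(1)[OF submodule]] by auto

lemma \<gg>_carrier: "A \<in> \<gg> \<Longrightarrow> A \<in> carrier_mat d d"
  using \<gg>_strict_upper carrier_strict_upper by blast

lemma \<gg>_zero: "0\<^sub>m d d \<in> \<gg>"
  using subgroup.one_closed[OF submodule.axioms(1)[OF submodule]] by (simp add: strict_upper_simps)

lemma \<gg>_add: "A \<in> \<gg> \<Longrightarrow> B \<in> \<gg> \<Longrightarrow> A + B \<in> \<gg>"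
  using subgroup.m_closed[OF submodule.axioms(1)[OF submodule]] by (simp add: strict_upper_simps)

lemma \<gg>_smult: "c \<in> ideal_pow 0 \<Longrightarrow> A \<in> \<gg> \<Longrightarrow> c \<cdot>\<^sub>m A \<in> \<gg>"
  using submodule.smult_closed[OF submodule] by (simp add: strict_upper_simps carrier_val_ring)

lemma \<gg>_bracket: "A \<in> \<gg> \<Longrightarrow> B \<in> \<gg> \<Longrightarrow> A * B - B * A \<in> \<gg>"
  using lie by (simp add: lie_subalgebra_def)

lemma lattice_strict: "x \<in> lattice \<Longrightarrow> x \<in> strict" by (simp add: lattice_def)

lemma to_mat_lattice: "to_mat d ` lattice = \<gg>"
proof (intro equalityI subsetI)
  fix A assume A: "A \<in> \<gg>"
  then have "to_mat d (of_mat d A) = A"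
    using \<gg>_strict_upper[OF A] by (intro to_mat_of_mat) (simp_all add: carrier_strict_upper)
  then show "A \<in> to_mat d ` lattice"
    using A by (intro rev_image_eqI[of "of_mat d A"]) (simp_all add: lattice_def of_mat_superdiag)
qed (auto simp: lattice_def)

lemma strict_entry_outside: "x \<in> strict \<Longrightarrow> \<not> (i < j \<and> j < d) \<Longrightarrow> entry x i j = 0"
  unfolding superdiag_def by fastforce

lemma strict_ideal_mats_iff: "x \<in> strict \<Longrightarrow> x \<in> ideal_mats n \<longleftrightarrow> (\<forall>i<d. \<forall>j<d. entry x i j \<in> ideal_pow n)"
proof
  assume x: "x \<in> strict" and *: "\<forall>i<d. \<forall>j<d. entry x i j \<in> ideal_pow n"
  have "entry x i j \<in> ideal_pow n" for i j
    using * strict_entry_outside[OF x, of i j] by (cases "i < j \<and> j < d") auto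
  then show "x \<in> ideal_mats n" by (simp add: ideal_mats_def)
qed (simp add: ideal_mats_def)

lemma lattice_ideal_mats: "x \<in> lattice \<Longrightarrow> x \<in> ideal_mats 0"
  using \<gg>_strict_upper[of "to_mat d x"] strict_ideal_mats_iff[of x 0] unfolding lattice_def carrier_strict_upper by simp

lemma lattice_zero: "0 \<in> lattice"
  by (simp add: lattice_def to_mat_zero \<gg>_zero)

lemma lattice_add: "x \<in> lattice \<Longrightarrow> y \<in> lattice \<Longrightarrow> x + y \<in> lattice"
  by (simp add: lattice_def to_mat_add \<gg>_add umat.N_add)

lemma lattice_scale: "c \<in> ideal_pow 0 \<Longrightarrow> x \<in> lattice \<Longrightarrow> scalar_umat c * x \<in> lattice"
  by (simp add: lattice_def to_mat_scale \<gg>_smult umat.N_scale)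

lemma scalar_minus_1: "scalar_umat (- 1) * x = - x"
  by (rule umat_eqI) simp

lemma lattice_uminus: "x \<in> lattice \<Longrightarrow> - x \<in> lattice"
  using lattice_scale[of "- 1" x] by (simp add: scalar_minus_1)

lemma lattice_diff: "x \<in> lattice \<Longrightarrow> y \<in> lattice \<Longrightarrow> x - y \<in> lattice"
  using lattice_add[of x "- y"] lattice_uminus[of y] by simp

lemma strict_diff: "x \<in> strict \<Longrightarrow> y \<in> strict \<Longrightarrow> x - y \<in> strict"
  using umat.N_add[of x d 1 "- y"] umat.N_scale[of y d 1 "- 1"] by (simp add: scalar_minus_1)

lemma strict_mult: "x \<in> strict \<Longrightarrow> y \<in> strict \<Longrightarrow> x * y \<in> strict"
  using umat.N_mult[of x d 1 y 1] unfolding superdiag_def by fastforce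

lemma lattice_bracket: "x \<in> lattice \<Longrightarrow> y \<in> lattice \<Longrightarrow> x * y - y * x \<in> lattice"
  unfolding lattice_def using \<gg>_bracket by (simp add: strict_diff strict_mult to_mat_diff to_mat_mult)

lemma \<gg>_isolated:
  assumes A: "A \<in> carrier (strict_upper_module v d)" and r: "r \<in> ideal_pow 0" "r \<noteq> 0"
    and rA: "r \<cdot>\<^sub>m A \<in> \<gg>"
  shows "A \<in> \<gg>"
proof -
  let ?V = "strict_upper_module v d"
  have coset: "B \<in> \<gg> +>\<^bsub>?V\<^esub> C \<longleftrightarrow> (\<exists>h\<in>\<gg>. B = h + C)" for B C
    by (auto simp: a_r_coset_def r_coset_def strict_upper_simps)
  have "\<gg> +>\<^bsub>?V\<^esub> (r \<cdot>\<^sub>m A) = \<gg>"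
  proof (intro equalityI subsetI)
    fix B assume "B \<in> \<gg> +>\<^bsub>?V\<^esub> (r \<cdot>\<^sub>m A)"
    then obtain h where "h \<in> \<gg>" "B = h + r \<cdot>\<^sub>m A" unfolding coset by (rule bexE)
    then show "B \<in> \<gg>" using \<gg>_add[OF _ rA] by simp
  next
    fix B assume B: "B \<in> \<gg>"
    have "B + (- 1) \<cdot>\<^sub>m (r \<cdot>\<^sub>m A) \<in> \<gg>" by (intro \<gg>_add B \<gg>_smult rA) simp
    moreover have "B = B + (- 1) \<cdot>\<^sub>m (r \<cdot>\<^sub>m A) + r \<cdot>\<^sub>m A"
      using \<gg>_carrier[OF B] \<gg>_carrier[OF rA] by (intro eq_matI) auto
    ultimately show "B \<in> \<gg> +>\<^bsub>?V\<^esub> (r \<cdot>\<^sub>m A)" unfolding coset by (rule rev_bexI)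
  qed
  then have "\<gg> +>\<^bsub>?V\<^esub> A = \<gg>"
    using isolated A r unfolding isolated_submodule_def
    by (simp add: strict_upper_simps carrier_val_ring val_ring_simps)
  moreover have "A \<in> \<gg> +>\<^bsub>?V\<^esub> A"
    unfolding coset by (rule bexI[OF _ \<gg>_zero]) (use A in \<open>simp add: carrier_strict_upper\<close>)
  ultimately show ?thesis by simp
qed

text \<open>The form in which isolation is used: integrality and membership up to a scalar suffice.\<close>

lemma lattice_isolated:
  assumes "x \<in> strict" "x \<in> ideal_mats 0" "r \<in> ideal_pow 0" "r \<noteq> 0" "scalar_umat r * x \<in> lattice"
  shows "x \<in> lattice"
proof -
  have "to_mat d x \<in> \<gg>"
  proof (rule \<gg>_isolated[of _ r])
    show "to_mat d x \<in> carrier (strict_upper_module v d)"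
      unfolding carrier_strict_upper using assms(2) strict_entry_outside[OF assms(1)] by (simp add: ideal_mats_def)
    show "r \<cdot>\<^sub>m to_mat d x \<in> \<gg>" using assms(5) by (simp add: lattice_def to_mat_scale)
  qed (use assms in simp_all)
  then show ?thesis using assms(1) by (simp add: lattice_def)
qed

end

context lie_lattice
begin

lemma Exp_minus_1_strict: assumes "x \<in> strict" shows "Exp x - 1 \<in> strict"
  unfolding Exp_minus_1[OF assms] umat.ev_def
proof (rule umat.N_sum)
  fix m
  show "scalar_umat (fps_nth (fps_exp 1 - 1) m) * x ^ m \<in> strict"
  proof (cases m)
    case (Suc k)
    have "x ^ m \<in> superdiag d m" by (rule umat.N_power[OF assms])
    then have "x ^ m \<in> strict" using Suc unfolding superdiag_def by fastforce
    then show ?thesis by (rule umat.N_scale)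
  qed (simp add: umat.N_zero)
qed

lemma Exp_0: "Exp 0 = 1"
  using Exp_minus_1[of 0] by (simp add: umat.ev_def umat.N_zero power_0_left if_distrib if_distribR cong: if_cong)

lemma Exp_uminus: assumes "x \<in> strict" shows "Exp (- x) * Exp x = 1" "Exp x * Exp (- x) = 1"
proof -
  have "- x \<in> strict" using strict_diff[OF umat.N_zero assms] by simp
  then show "Exp (- x) * Exp x = 1" "Exp x * Exp (- x) = 1"
    using umat.Exp_uminus[OF strict_nilpotent, of x] umat.Exp_uminus[OF strict_nilpotent, of "- x"] assms by simp_all
qed

text \<open>The theorem of Baker--Campbell--Hausdorff applies to the Lie algebra over the field that
  is spanned by the lattice; isolation brings its conclusion back to the lattice, the logarithm
  of the product being integral.\<close>

lemma Exp_mult_closed: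
  assumes x: "x \<in> lattice" and y: "y \<in> lattice"
  shows "\<exists>z\<in>lattice. Exp x * Exp y = Exp z"
proof -
  define LK where "LK = {x \<in> strict. \<exists>r\<in>ideal_pow 0. r \<noteq> 0 \<and> scalar_umat r * x \<in> lattice}"
  have lattice_LK: "lattice \<subseteq> LK"
  proof
    fix u assume u: "u \<in> lattice"
    then have "scalar_umat 1 * u \<in> lattice" by (simp add: umat.s_one)
    then show "u \<in> LK" using lattice_strict[OF u] unfolding LK_def by (intro CollectI conjI bexI[of _ 1]) simp_all
  qed
  let ?z = "Log (Exp x * Exp y - 1)"
  have "?z \<in> LK"
  proof (rule umat.BCH_closed)
    show "LK \<subseteq> strict" by (auto simp: LK_def)
    show "0 \<in> LK" by (rule subsetD[OF lattice_LK lattice_zero])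
    show "u + w \<in> LK" if uw: "u \<in> LK" "w \<in> LK" for u w
    proof -
      from uw obtain r t where r: "r \<in> ideal_pow 0" "r \<noteq> 0" "scalar_umat r * u \<in> lattice"
        and t: "t \<in> ideal_pow 0" "t \<noteq> 0" "scalar_umat t * w \<in> lattice" unfolding LK_def by blast
      have "scalar_umat (r * t) * (u + w)
          = scalar_umat t * (scalar_umat r * u) + scalar_umat r * (scalar_umat t * w)"
        by (rule umat_eqI) (simp add: algebra_simps)
      also have "\<dots> \<in> lattice" by (intro lattice_add lattice_scale r t)
      finally have "scalar_umat (r * t) * (u + w) \<in> lattice" .
      moreover have "u + w \<in> strict" using uw unfolding LK_def by (intro umat.N_add) simp_all
      ultimately show ?thesis
        using r t unfolding LK_def by (intro CollectI conjI bexI[of _ "r * t"]) (simp_all add: ideal_pow_mult_0)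
    qed
    show "scalar_umat c * u \<in> LK" if u: "u \<in> LK" for c u
    proof -
      from u obtain r where r: "r \<in> ideal_pow 0" "r \<noteq> 0" "scalar_umat r * u \<in> lattice" unfolding LK_def by blast
      obtain e where e: "e \<in> ideal_pow 0" "e \<noteq> 0" "e * c \<in> ideal_pow 0"
      proof (cases "c \<in> ideal_pow 0")
        case True
        then show ?thesis using that[of 1] by simp
      next
        case False
        then have "inverse c \<in> ideal_pow 0" "c \<noteq> 0"
          using val_inverse[of c] by (auto simp: ideal_pow_def)
        then show ?thesis using that[of "inverse c"] by simp
      qed
      have "scalar_umat (r * e) * (scalar_umat c * u) = scalar_umat (e * c) * (scalar_umat r * u)"
        by (rule umat_eqI) simp
      also have "\<dots> \<in> lattice" by (intro lattice_scale e r)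
      finally have "scalar_umat (r * e) * (scalar_umat c * u) \<in> lattice" .
      moreover have "scalar_umat c * u \<in> strict" using u unfolding LK_def by (intro umat.N_scale) simp
      ultimately show ?thesis
        using r e unfolding LK_def by (intro CollectI conjI bexI[of _ "r * e"]) (simp_all add: ideal_pow_mult_0)
    qed
    show "bracket u w \<in> LK" if uw: "u \<in> LK" "w \<in> LK" for u w
    proof -
      from uw obtain r t where r: "r \<in> ideal_pow 0" "r \<noteq> 0" "scalar_umat r * u \<in> lattice"
        and t: "t \<in> ideal_pow 0" "t \<noteq> 0" "scalar_umat t * w \<in> lattice" unfolding LK_def by blast
      have prod: "(scalar_umat a * x) * (scalar_umat b * y) = scalar_umat (a * b) * (x * y)" for a b and x y :: "'k umat"
      proof -
        have "x * (scalar_umat b * y) = scalar_umat b * (x * y)" by (rule umat.s_left_commute)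
        then show ?thesis by (simp only: mult.assoc umat.s_mult)
      qed
      have "scalar_umat (r * t) * bracket u w = scalar_umat (r * t) * (u * w) - scalar_umat (t * r) * (w * u)"
        by (simp only: bracket_def right_diff_distrib mult.commute[of t r])
      also have "\<dots> = (scalar_umat r * u) * (scalar_umat t * w) - (scalar_umat t * w) * (scalar_umat r * u)"
        by (simp only: prod)
      also have "\<dots> \<in> lattice" by (intro lattice_bracket r t)
      finally have "scalar_umat (r * t) * bracket u w \<in> lattice" .
      moreover have "bracket u w \<in> strict" using uw unfolding LK_def bracket_def by (intro strict_diff strict_mult) simp_all
      ultimately show ?thesis
        using r t unfolding LK_def by (intro CollectI conjI bexI[of _ "r * t"]) (simp_all add: ideal_pow_mult_0)
    qed
    show "x \<in> LK" "y \<in> LK" by (rule subsetD[OF lattice_LK x], rule subsetD[OF lattice_LK y])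
  qed
  then have zN: "?z \<in> strict" and "\<exists>r\<in>ideal_pow 0. r \<noteq> 0 \<and> scalar_umat r * ?z \<in> lattice"
    unfolding LK_def by (simp_all only: mem_Collect_eq)
  then obtain r where r: "r \<in> ideal_pow 0" "r \<noteq> 0" "scalar_umat r * ?z \<in> lattice"
    by (elim bexE conjE)
  have "?z \<in> ideal_mats 0" using x y by (intro ideal_mats_Log ideal_mats_diff ideal_mats_mult_left ideal_mats_Exp ideal_mats_one lattice_ideal_mats)
  then have "?z \<in> lattice" by (rule lattice_isolated[OF zN _ r])
  moreover have "Exp ?z = Exp x * Exp y"
  proof -
    have "Exp x * Exp y - 1 = (Exp x - 1) * (Exp y - 1) + (Exp x - 1) + (Exp y - 1)"
      by (simp add: algebra_simps)
    also have "\<dots> \<in> strict" using x y by (intro umat.N_add strict_mult Exp_minus_1_strict lattice_strict)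
    finally show ?thesis by (simp add: umat.Exp_Log[OF strict_nilpotent])
  qed
  ultimately show ?thesis by (intro bexI[of _ ?z]) simp
qed

definition exp_group :: "'k mat set" where "exp_group = nilpotent_exp d ` \<gg>"

lemma exp_group_eq: "exp_group = (\<lambda>x. to_mat d (Exp x)) ` lattice"
proof -
  have "exp_group = nilpotent_exp d ` to_mat d ` lattice" by (simp only: exp_group_def to_mat_lattice)
  then show ?thesis by (simp only: image_image to_mat_Exp)
qed

lemma to_mat_Exp_unitriangular: assumes x: "x \<in> lattice" shows "to_mat d (Exp x) \<in> carrier (unitriangular v d)"
proof -
  have "entry (Exp x - 1) i j = 0" if "j \<le> i" for i j
    using strict_entry_outside[OF Exp_minus_1_strict[OF lattice_strict[OF x]]] that by simp
  then have ent: "entry (Exp x) i j = (if i = j then 1 else 0)" if "j \<le> i" for i j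
    using that by (simp add: entry_one)
  have elem: "elements_mat (to_mat d (Exp x)) \<subseteq> ideal_pow 0"
  proof
    fix a assume "a \<in> elements_mat (to_mat d (Exp x))"
    from elements_matD[OF this] show "a \<in> ideal_pow 0" using ideal_mats_Exp[OF lattice_ideal_mats[OF x]] by (auto simp: ideal_mats_def)
  qed
  have gen: "to_mat d y \<in> carrier (unitriangular v d)"
    if "\<And>i j. j \<le> i \<Longrightarrow> entry y i j = (if i = j then 1 else 0)"
      "elements_mat (to_mat d y) \<subseteq> ideal_pow 0" for y
    using that by (simp add: unitriangular_def carrier_val_ring)
  show ?thesis by (rule gen[OF ent elem])
qed

theorem subgroup_exp_group: "subgroup exp_group (unitriangular v d)"
proof (rule subgroup.intro)
  show "exp_group \<subseteq> carrier (unitriangular v d)" unfolding exp_group_eq using to_mat_Exp_unitriangular by blast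
next
  fix A B assume "A \<in> exp_group" "B \<in> exp_group"
  then obtain x y where xy: "x \<in> lattice" "y \<in> lattice" "A = to_mat d (Exp x)" "B = to_mat d (Exp y)"
    unfolding exp_group_eq by blast
  from Exp_mult_closed[OF xy(1,2)] obtain z where "z \<in> lattice" "Exp x * Exp y = Exp z" by (rule bexE)
  then show "A \<otimes>\<^bsub>unitriangular v d\<^esub> B \<in> exp_group"
    unfolding exp_group_eq by (intro image_eqI[of _ _ z]) (simp_all add: unitriangular_def xy flip: to_mat_mult)
next
  show "\<one>\<^bsub>unitriangular v d\<^esub> \<in> exp_group"
    unfolding exp_group_eq by (intro image_eqI[of _ _ 0]) (simp_all add: unitriangular_def Exp_0 lattice_zero to_mat_one)
next
  fix A assume "A \<in> exp_group"
  then obtain x where x: "x \<in> lattice" "A = to_mat d (Exp x)" unfolding exp_group_eq by blast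
  let ?B = "to_mat d (Exp (- x))"
  have AB: "A * ?B = 1\<^sub>m d" "?B * A = 1\<^sub>m d"
    using Exp_uminus[OF lattice_strict[OF x(1)]] by (simp_all add: x to_mat_one flip: to_mat_mult)
  have "inv\<^bsub>unitriangular v d\<^esub> A = ?B"
    unfolding m_inv_def
  proof (rule the_equality)
    show "?B \<in> carrier (unitriangular v d) \<and> A \<otimes>\<^bsub>unitriangular v d\<^esub> ?B = \<one>\<^bsub>unitriangular v d\<^esub> \<and>
        ?B \<otimes>\<^bsub>unitriangular v d\<^esub> A = \<one>\<^bsub>unitriangular v d\<^esub>"
      using to_mat_Exp_unitriangular[OF lattice_uminus[OF x(1)]] AB by (simp add: unitriangular_def)
  next
    fix C assume "C \<in> carrier (unitriangular v d) \<and> A \<otimes>\<^bsub>unitriangular v d\<^esub> C = \<one>\<^bsub>unitriangular v d\<^esub> \<and>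
        C \<otimes>\<^bsub>unitriangular v d\<^esub> A = \<one>\<^bsub>unitriangular v d\<^esub>"
    then have C: "C \<in> carrier_mat d d" "A * C = 1\<^sub>m d" by (simp_all add: unitriangular_def)
    have "?B * A * C = ?B * (A * C)" using C x by (intro assoc_mult_mat[of _ d d _ d _ d]) simp_all
    then show "C = ?B" using C AB by simp
  qed
  then show "inv\<^bsub>unitriangular v d\<^esub> A \<in> exp_group"
    unfolding exp_group_eq using lattice_uminus[OF x(1)] by blast
qed

subsection \<open>Reduction modulo powers of the maximal ideal\<close>

definition reduce :: "nat \<Rightarrow> 'k umat \<Rightarrow> 'k set mat" where
  "reduce n x = map_mat (residue n) (to_mat d x)"

abbreviation residue_ring :: "nat \<Rightarrow> 'k set ring" where "residue_ring n \<equiv> val_ring v Quot ideal_pow n"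

abbreviation cong_group :: "nat \<Rightarrow> 'k set mat monoid" where
  "cong_group n \<equiv> congruence_quotient (val_ring v) (ideal_pow n) d exp_group"

lemma reduce_carrier [simp]: "reduce n x \<in> carrier_mat d d"
  and reduce_dim [simp]: "dim_row (reduce n x) = d" "dim_col (reduce n x) = d"
  and reduce_index [simp]: "i < d \<Longrightarrow> j < d \<Longrightarrow> reduce n x $$ (i, j) = residue n (entry x i j)"
  by (simp_all add: reduce_def)

lemma reduce_eq_iff: "reduce n x = reduce n y \<longleftrightarrow> (\<forall>i<d. \<forall>j<d. entry (x - y) i j \<in> ideal_pow n)"
  by (simp add: mat_eq_iff residue_eq_iff)

lemma reduce_eq_iff_ideal_mats: "x - y \<in> strict \<Longrightarrow> reduce n x = reduce n y \<longleftrightarrow> x - y \<in> ideal_mats n"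
  unfolding reduce_eq_iff by (rule strict_ideal_mats_iff[symmetric])

lemma residue_hom: "ring_hom_cring (val_ring v) (residue_ring n) (residue n)"
proof -
  interpret ideal "ideal_pow n" "val_ring v" by (rule ideal_ideal_pow)
  show ?thesis using rcos_ring_hom_cring[OF cring_val_ring] unfolding residue_def[abs_def] .
qed

lemma residue_sum_mult:
  assumes "finite A" "\<And>k. k \<in> A \<Longrightarrow> f k \<in> ideal_pow 0" "\<And>k. k \<in> A \<Longrightarrow> g k \<in> ideal_pow 0"
  shows "(\<Oplus>\<^bsub>residue_ring n\<^esub>k\<in>A. residue n (f k) \<otimes>\<^bsub>residue_ring n\<^esub> residue n (g k)) = residue n (\<Sum>k\<in>A. f k * g k)"
proof -
  interpret ring_hom_cring "val_ring v" "residue_ring n" "residue n" by (rule residue_hom)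
  have fg: "f k * g k \<in> ideal_pow 0" if "k \<in> A" for k
    using assms that by (simp add: ideal_pow_mult_0)
  have "residue n (\<Sum>k\<in>A. f k * g k) = residue n (\<Oplus>\<^bsub>val_ring v\<^esub>k\<in>A. f k * g k)"
    by (simp add: finsum_val_ring fg)
  also have "\<dots> = (\<Oplus>\<^bsub>residue_ring n\<^esub>k\<in>A. (residue n \<circ> (\<lambda>k. f k * g k)) k)"
    by (rule hom_finsum) (simp add: carrier_val_ring fg)
  also have "\<dots> = (\<Oplus>\<^bsub>residue_ring n\<^esub>k\<in>A. residue n (f k) \<otimes>\<^bsub>residue_ring n\<^esub> residue n (g k))"
  proof (rule S.finsum_cong')
    show "(\<lambda>k. residue n (f k) \<otimes>\<^bsub>residue_ring n\<^esub> residue n (g k)) \<in> A \<rightarrow> carrier (residue_ring n)"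
      using assms by (simp add: carrier_val_ring)
    fix k assume k: "k \<in> A"
    show "(residue n \<circ> (\<lambda>k. f k * g k)) k = residue n (f k) \<otimes>\<^bsub>residue_ring n\<^esub> residue n (g k)"
      using hom_mult[of "f k" "g k"] assms(2,3)[OF k] by (simp add: carrier_val_ring val_ring_simps)
  qed simp
  finally show ?thesis by simp
qed

lemma cong_group_simps:
  "carrier (cong_group n) = (\<lambda>x. reduce n (Exp x)) ` lattice"
  "mult (cong_group n) = mult (mat_monoid (residue_ring n) d)" "one (cong_group n) = reduce n 1"
proof -
  show "carrier (cong_group n) = (\<lambda>x. reduce n (Exp x)) ` lattice"
    by (simp add: congruence_quotient_def exp_group_eq image_image reduce_def residue_def[abs_def])
  have one: "\<one>\<^bsub>residue_ring n\<^esub> = residue n 1"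
    by (simp only: FactRing_def residue_def val_ring_simps ring.simps monoid.simps)
  have zero: "\<zero>\<^bsub>residue_ring n\<^esub> = residue n 0"
    by (simp add: FactRing_def residue_eq)
  have "one (cong_group n) = one (mat_monoid (residue_ring n) d)"
    by (simp only: congruence_quotient_def general_linear_def units_of_def monoid.simps partial_object.simps)
  also have "\<dots> = mat d d (\<lambda>(i, j). if i = j then residue n 1 else residue n 0)"
    by (simp only: mat_monoid_def monoid.simps one zero)
  also have "\<dots> = reduce n 1"
    by (rule eq_matI) (simp_all add: entry_one)
  finally show "one (cong_group n) = reduce n 1" .
qed (simp add: congruence_quotient_def general_linear_def units_of_def)

lemma reduce_mult: assumes "x \<in> ideal_mats 0" "y \<in> ideal_mats 0" shows "reduce n x \<otimes>\<^bsub>cong_group n\<^esub> reduce n y = reduce n (x * y)"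
proof (rule eq_matI)
  fix i j assume ij: "i < dim_row (reduce n (x * y))" "j < dim_col (reduce n (x * y))"
  interpret ring_hom_cring "val_ring v" "residue_ring n" "residue n" by (rule residue_hom)
  have "(reduce n x \<otimes>\<^bsub>cong_group n\<^esub> reduce n y) $$ (i, j) = (\<Oplus>\<^bsub>residue_ring n\<^esub>k\<in>{..<d}. reduce n x $$ (i, k) \<otimes>\<^bsub>residue_ring n\<^esub> reduce n y $$ (k, j))"
    using ij by (simp add: cong_group_simps mat_monoid_def)
  also have "\<dots> = (\<Oplus>\<^bsub>residue_ring n\<^esub>k\<in>{..<d}. residue n (entry x i k) \<otimes>\<^bsub>residue_ring n\<^esub> residue n (entry y k j))"
    by (rule S.finsum_cong') (use ij assms in \<open>simp_all add: ideal_mats_def carrier_val_ring\<close>)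
  also have "\<dots> = residue n (\<Sum>k<d. entry x i k * entry y k j)"
    using assms by (intro residue_sum_mult) (simp_all add: ideal_mats_def)
  also have "{..<d} = {..d - 1}" using ij by auto
  finally show "(reduce n x \<otimes>\<^bsub>cong_group n\<^esub> reduce n y) $$ (i, j) = reduce n (x * y) $$ (i, j)"
    using ij by (simp add: entry_mult[of j "d - 1"])
qed (simp_all add: cong_group_simps mat_monoid_def)

lemma group_cong_group: "group (cong_group n)"
proof (rule groupI)
  fix g h assume "g \<in> carrier (cong_group n)" "h \<in> carrier (cong_group n)"
  then obtain x y where xy: "x \<in> lattice" "y \<in> lattice" "g = reduce n (Exp x)" "h = reduce n (Exp y)" unfolding cong_group_simps by blast
  from Exp_mult_closed[OF xy(1,2)] obtain z where "z \<in> lattice" "Exp x * Exp y = Exp z" by (rule bexE)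
  then show "g \<otimes>\<^bsub>cong_group n\<^esub> h \<in> carrier (cong_group n)"
    using xy reduce_mult[of "Exp x" "Exp y"] unfolding cong_group_simps(1) by (auto simp: ideal_mats_Exp lattice_ideal_mats)
next
  show "\<one>\<^bsub>cong_group n\<^esub> \<in> carrier (cong_group n)"
    unfolding cong_group_simps by (rule image_eqI[of _ _ 0]) (simp_all add: Exp_0 lattice_zero)
next
  fix g h k assume "g \<in> carrier (cong_group n)" "h \<in> carrier (cong_group n)" "k \<in> carrier (cong_group n)"
  then obtain x y z where "x \<in> lattice" "y \<in> lattice" "z \<in> lattice" "g = reduce n (Exp x)" "h = reduce n (Exp y)" "k = reduce n (Exp z)"
    unfolding cong_group_simps by blast
  then show "g \<otimes>\<^bsub>cong_group n\<^esub> h \<otimes>\<^bsub>cong_group n\<^esub> k = g \<otimes>\<^bsub>cong_group n\<^esub> (h \<otimes>\<^bsub>cong_group n\<^esub> k)"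
    by (simp add: reduce_mult ideal_mats_Exp lattice_ideal_mats ideal_mats_mult_left mult.assoc)
next
  fix g assume "g \<in> carrier (cong_group n)"
  then obtain x where x: "x \<in> lattice" "g = reduce n (Exp x)" unfolding cong_group_simps by blast
  show "\<one>\<^bsub>cong_group n\<^esub> \<otimes>\<^bsub>cong_group n\<^esub> g = g"
    unfolding cong_group_simps(3) x by (simp add: reduce_mult ideal_mats_one ideal_mats_Exp lattice_ideal_mats x)
  have "reduce n (Exp (- x)) \<otimes>\<^bsub>cong_group n\<^esub> g = \<one>\<^bsub>cong_group n\<^esub>"
    unfolding cong_group_simps(3) x by (simp add: reduce_mult ideal_mats_Exp lattice_ideal_mats lattice_uminus x Exp_uminus lattice_strict)
  then show "\<exists>h\<in>carrier (cong_group n). h \<otimes>\<^bsub>cong_group n\<^esub> g = \<one>\<^bsub>cong_group n\<^esub>"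
    by (rule bexI) (simp add: cong_group_simps(1) lattice_uminus x)
qed

lemma finite_matrices: assumes "finite C" shows "finite {A \<in> carrier_mat d d. \<forall>i<d. \<forall>j<d. A $$ (i, j) \<in> C}"
proof (rule finite_surj[of "PiE ({..<d} \<times> {..<d}) (\<lambda>_. C)"])
  show "{A \<in> carrier_mat d d. \<forall>i<d. \<forall>j<d. A $$ (i, j) \<in> C} \<subseteq> mat d d ` PiE ({..<d} \<times> {..<d}) (\<lambda>_. C)"
  proof
    fix A assume A: "A \<in> {A \<in> carrier_mat d d. \<forall>i<d. \<forall>j<d. A $$ (i, j) \<in> C}"
    let ?f = "\<lambda>ij\<in>{..<d} \<times> {..<d}. A $$ ij"
    have "?f \<in> PiE ({..<d} \<times> {..<d}) (\<lambda>_. C)" using A by auto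
    moreover have "A = mat d d ?f" using A by (intro eq_matI) auto
    ultimately show "A \<in> mat d d ` PiE ({..<d} \<times> {..<d}) (\<lambda>_. C)" by (rule rev_image_eqI[where f = "mat d d"])
  qed
qed (simp add: finite_PiE assms)

lemma finite_row_vecs: "finite (row_vecs (residue_ring n) d)"
proof (rule finite_surj[of "PiE {..<d} (\<lambda>_. carrier (residue_ring n))"])
  show "finite (PiE {..<d} (\<lambda>_. carrier (residue_ring n)))"
    by (simp add: finite_PiE carrier_residue_ring finite_residues)
  show "row_vecs (residue_ring n) d \<subseteq> vec d ` PiE {..<d} (\<lambda>_. carrier (residue_ring n))"
  proof
    fix x assume x: "x \<in> row_vecs (residue_ring n) d"
    let ?f = "\<lambda>i\<in>{..<d}. vec_index x i"
    have "?f \<in> PiE {..<d} (\<lambda>_. carrier (residue_ring n))" using x by (auto simp: row_vecs_def)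
    moreover have "x = vec d ?f" using x by (intro eq_vecI) (auto simp: row_vecs_def)
    ultimately show "x \<in> vec d ` PiE {..<d} (\<lambda>_. carrier (residue_ring n))" by (rule rev_image_eqI[where f = "vec d"])
  qed
qed

lemma finite_cong_group: "finite (carrier (cong_group n))"
proof (rule finite_subset[OF _ finite_matrices[OF finite_residues]])
  show "carrier (cong_group n) \<subseteq> {A \<in> carrier_mat d d. \<forall>i<d. \<forall>j<d. A $$ (i, j) \<in> residue n ` ideal_pow 0}"
    unfolding cong_group_simps using ideal_mats_Exp[OF lattice_ideal_mats] by (auto simp: ideal_mats_def)
qed

end

context lie_lattice
begin

lemma reduce_Exp_eq_iff:
  assumes "y \<in> lattice" "z \<in> lattice" shows "reduce n (Exp y) = reduce n (Exp z) \<longleftrightarrow> y - z \<in> ideal_mats n"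
proof -
  have "Exp y - 1 - (Exp z - 1) \<in> strict"
    using assms by (intro strict_diff Exp_minus_1_strict lattice_strict)
  then have "Exp y - Exp z \<in> strict" by simp
  then have "reduce n (Exp y) = reduce n (Exp z) \<longleftrightarrow> Exp y - Exp z \<in> ideal_mats n" by (rule reduce_eq_iff_ideal_mats)
  also have "\<dots> \<longleftrightarrow> y - z \<in> ideal_mats n" using assms by (intro Exp_cong_iff lattice_strict lattice_ideal_mats)
  finally show ?thesis .
qed

lemma module_val_ringI:
  assumes "abelian_group row_mod"
    and "\<And>a x. a \<in> ideal_pow 0 \<Longrightarrow> x \<in> carrier row_mod \<Longrightarrow> a \<odot>\<^bsub>row_mod\<^esub> x \<in> carrier row_mod"
    and "\<And>a b x. x \<in> carrier row_mod \<Longrightarrow> (a + b) \<odot>\<^bsub>row_mod\<^esub> x = a \<odot>\<^bsub>row_mod\<^esub> x \<oplus>\<^bsub>row_mod\<^esub> b \<odot>\<^bsub>row_mod\<^esub> x"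
    and "\<And>a x y. x \<in> carrier row_mod \<Longrightarrow> y \<in> carrier row_mod \<Longrightarrow> a \<odot>\<^bsub>row_mod\<^esub> (x \<oplus>\<^bsub>row_mod\<^esub> y) = a \<odot>\<^bsub>row_mod\<^esub> x \<oplus>\<^bsub>row_mod\<^esub> a \<odot>\<^bsub>row_mod\<^esub> y"
    and "\<And>a b x. x \<in> carrier row_mod \<Longrightarrow> (a * b) \<odot>\<^bsub>row_mod\<^esub> x = a \<odot>\<^bsub>row_mod\<^esub> (b \<odot>\<^bsub>row_mod\<^esub> x)"
    and "\<And>x. x \<in> carrier row_mod \<Longrightarrow> 1 \<odot>\<^bsub>row_mod\<^esub> x = x"
  shows "module (val_ring v) row_mod"
  by (rule moduleI[OF cring_val_ring assms(1)])
    (simp_all only: carrier_val_ring val_ring_simps assms(2-6))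

section \<open>Orbits on row vectors\<close>

abbreviation row_mod :: "('k, 'k vec) module" where "row_mod \<equiv> row_module v d"

lemma row_module_simps:
  "add row_mod = (+)" "zero row_mod = 0\<^sub>v d" "smult row_mod = (\<cdot>\<^sub>v)" "carrier row_mod = row_vecs (val_ring v) d"
  by (simp_all add: row_module_def module_vec_def)

lemma mem_row_vecs: "x \<in> row_vecs (val_ring v) d \<longleftrightarrow> x \<in> carrier_vec d \<and> (\<forall>i<d. vec_index x i \<in> ideal_pow 0)"
  by (simp add: row_vecs_def carrier_val_ring)

lemma module_row: "module (val_ring v) row_mod"
proof (rule module_val_ringI)
  show "abelian_group row_mod"
  proof (rule abelian_groupI)
    fix x assume x: "x \<in> carrier row_mod"
    show "\<exists>y\<in>carrier row_mod. y \<oplus>\<^bsub>row_mod\<^esub> x = \<zero>\<^bsub>row_mod\<^esub>"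
      by (rule bexI[of _ "- x"]) (use x in \<open>auto simp: row_module_simps mem_row_vecs\<close>)
  qed (auto simp: row_module_simps mem_row_vecs ideal_pow_add)
qed (auto simp: row_module_simps mem_row_vecs ideal_pow_mult_0 add_smult_distrib_vec smult_add_distrib_vec smult_smult_assoc)

definition ideal_rows :: "nat \<Rightarrow> 'k vec set" where
  "ideal_rows n = {x \<in> carrier row_mod. \<forall>i<d. vec_index x i \<in> ideal_pow n}"

lemma ideal_rows_eq: "ideal_times_module (val_ring v) (ideal_pow n) row_mod = ideal_rows n"
  and ideal_rows_subgroup: "abelian_subgroup (ideal_rows n) row_mod"
proof -
  obtain \<pi> where "\<pi> \<noteq> 0" and \<pi>: "\<pi> \<in> ideal_pow n" "\<And>x. x \<in> ideal_pow (n + 0) \<Longrightarrow> \<exists>y\<in>ideal_pow 0. x = \<pi> * y"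
    using uniformizer_power[of n 0] by blast
  note * = ideal_times_module_eq[OF module_row \<pi>(1) \<pi>(2)[unfolded add_0_right]]
  have "(\<lambda>x. \<pi> \<odot>\<^bsub>row_mod\<^esub> x) ` carrier row_mod = ideal_rows n"
  proof (intro equalityI subsetI)
    fix x assume "x \<in> (\<lambda>x. \<pi> \<odot>\<^bsub>row_mod\<^esub> x) ` carrier row_mod"
    moreover have "\<pi> \<in> ideal_pow 0" by (rule subsetD[OF ideal_pow_subset \<pi>(1)])
    ultimately show "x \<in> ideal_rows n"
      using \<pi>(1) by (auto simp: ideal_rows_def row_module_simps mem_row_vecs ideal_pow_mult_0)
  next
    fix x assume x: "x \<in> ideal_rows n"
    have "\<forall>i\<in>{..<d}. \<exists>y. y \<in> ideal_pow 0 \<and> vec_index x i = \<pi> * y"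
      using x \<pi>(2) by (simp add: ideal_rows_def Bex_def)
    from bchoice[OF this] obtain y
      where "\<forall>i\<in>{..<d}. y i \<in> ideal_pow 0 \<and> vec_index x i = \<pi> * y i" by blast
    then have y: "y i \<in> ideal_pow 0 \<and> vec_index x i = \<pi> * y i" if "i < d" for i
      using that by simp
    show "x \<in> (\<lambda>x. \<pi> \<odot>\<^bsub>row_mod\<^esub> x) ` carrier row_mod"
    proof (rule image_eqI)
      show "x = \<pi> \<odot>\<^bsub>row_mod\<^esub> vec d y"
        using x y by (intro eq_vecI) (simp_all add: row_module_simps ideal_rows_def mem_row_vecs)
      show "vec d y \<in> carrier row_mod" using y by (simp add: row_module_simps mem_row_vecs)
    qed
  qed
  with * show "ideal_times_module (val_ring v) (ideal_pow n) row_mod = ideal_rows n" "abelian_subgroup (ideal_rows n) row_mod" by simp_all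
qed

lemma ideal_rows_translate_iff:
  assumes "x \<in> carrier row_mod" "y \<in> carrier row_mod"
  shows "(\<exists>w\<in>ideal_rows n. x = w \<oplus>\<^bsub>row_mod\<^esub> y) \<longleftrightarrow> (\<forall>i<d. vec_index x i - vec_index y i \<in> ideal_pow n)"
proof
  assume "\<exists>w\<in>ideal_rows n. x = w \<oplus>\<^bsub>row_mod\<^esub> y"
  then show "\<forall>i<d. vec_index x i - vec_index y i \<in> ideal_pow n"
    using assms by (auto simp: ideal_rows_def row_module_simps mem_row_vecs)
next
  assume *: "\<forall>i<d. vec_index x i - vec_index y i \<in> ideal_pow n"
  have "x - y \<in> ideal_rows n"
    using * assms by (auto simp: ideal_rows_def row_module_simps mem_row_vecs ideal_pow_diff)
  moreover have "x = (x - y) \<oplus>\<^bsub>row_mod\<^esub> y"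
    using assms by (intro eq_vecI) (auto simp: row_module_simps mem_row_vecs)
  ultimately show "\<exists>w\<in>ideal_rows n. x = w \<oplus>\<^bsub>row_mod\<^esub> y" by (rule rev_bexI)
qed

definition row_mult :: "'k vec \<Rightarrow> 'k umat \<Rightarrow> 'k vec" where
  "row_mult x y = vec d (\<lambda>j. \<Sum>i<d. vec_index x i * entry y i j)"

lemma row_mult_index: "j < d \<Longrightarrow> vec_index (row_mult x y) j = (\<Sum>i<d. vec_index x i * entry y i j)"
  and row_mult_dim: "row_mult x y \<in> carrier_vec d"
  by (simp_all add: row_mult_def)

lemma row_mult_closed: "x \<in> carrier row_mod \<Longrightarrow> y \<in> ideal_mats n \<Longrightarrow> j < d \<Longrightarrow> vec_index (row_mult x y) j \<in> ideal_pow n"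
  by (auto simp: row_mult_index row_module_simps mem_row_vecs ideal_mats_def intro!: ideal_pow_sum ideal_pow_mult_0(1))

lemma row_mult_row_mod: "x \<in> carrier row_mod \<Longrightarrow> y \<in> ideal_mats 0 \<Longrightarrow> row_mult x y \<in> carrier row_mod"
  using row_mult_closed[of x y 0] by (simp add: row_module_simps mem_row_vecs row_mult_dim)

lemma row_act_integral:
  assumes "x \<in> carrier row_mod" "y \<in> ideal_mats 0"
  shows "row_act (val_ring v) d x (to_mat d y) = row_mult x y"
proof (rule eq_vecI)
  fix j assume "j < dim_vec (row_mult x y)"
  then have j: "j < d" by (simp add: row_mult_def)
  have "(\<Oplus>\<^bsub>val_ring v\<^esub>i\<in>{..<d}. vec_index x i \<otimes>\<^bsub>val_ring v\<^esub> to_mat d y $$ (i, j))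
      = (\<Sum>i<d. vec_index x i * to_mat d y $$ (i, j))"
    unfolding val_ring_simps
    by (rule finsum_val_ring) (use assms j in \<open>simp add: row_module_simps mem_row_vecs ideal_mats_def ideal_pow_mult_0\<close>)
  also have "\<dots> = (\<Sum>i<d. vec_index x i * entry y i j)" using j by simp
  finally show "vec_index (row_act (val_ring v) d x (to_mat d y)) j = vec_index (row_mult x y) j"
    using j by (simp add: row_act_def row_mult_index)
qed (simp add: row_act_def row_mult_def)

lemma row_act_residue:
  assumes "x \<in> carrier row_mod" "y \<in> ideal_mats 0"
  shows "row_act (residue_ring n) d (map_vec (residue n) x) (reduce n y) = map_vec (residue n) (row_mult x y)"
proof (rule eq_vecI)
  interpret ring_hom_cring "val_ring v" "residue_ring n" "residue n" by (rule residue_hom)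
  fix j assume "j < dim_vec (map_vec (residue n) (row_mult x y))"
  then have j: "j < d" by (simp add: row_mult_def)
  have "(\<Oplus>\<^bsub>residue_ring n\<^esub>i\<in>{..<d}. vec_index (map_vec (residue n) x) i \<otimes>\<^bsub>residue_ring n\<^esub> reduce n y $$ (i, j))
      = (\<Oplus>\<^bsub>residue_ring n\<^esub>i\<in>{..<d}. residue n (vec_index x i) \<otimes>\<^bsub>residue_ring n\<^esub> residue n (entry y i j))"
    by (rule S.finsum_cong') (use j assms in \<open>auto simp: row_module_simps mem_row_vecs ideal_mats_def carrier_val_ring\<close>)
  also have "\<dots> = residue n (\<Sum>i<d. vec_index x i * entry y i j)"
    using assms by (intro residue_sum_mult) (simp_all add: row_module_simps mem_row_vecs ideal_mats_def)
  finally show "vec_index (row_act (residue_ring n) d (map_vec (residue n) x) (reduce n y)) j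
      = vec_index (map_vec (residue n) (row_mult x y)) j"
    using j row_mult_dim[of x y] by (simp add: row_act_def row_mult_index)
qed (simp add: row_act_def row_mult_def)

lemma map_residue_eq_iff:
  assumes "x \<in> carrier_vec d" "y \<in> carrier_vec d"
  shows "map_vec (residue n) x = map_vec (residue n) y
    \<longleftrightarrow> (\<forall>i<d. vec_index x i - vec_index y i \<in> ideal_pow n)"
  using assms by (auto simp: vec_eq_iff residue_eq_iff)

lemma row_vecs_residue_ring: "row_vecs (residue_ring n) d = map_vec (residue n) ` carrier row_mod"
proof (intro equalityI subsetI)
  fix X assume X: "X \<in> row_vecs (residue_ring n) d"
  then have "\<forall>i\<in>{..<d}. \<exists>y. y \<in> ideal_pow 0 \<and> vec_index X i = residue n y"
    by (auto simp: row_vecs_def carrier_residue_ring)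
  from bchoice[OF this] obtain y
    where "\<forall>i\<in>{..<d}. y i \<in> ideal_pow 0 \<and> vec_index X i = residue n (y i)" by blast
  then have y: "y i \<in> ideal_pow 0 \<and> vec_index X i = residue n (y i)" if "i < d" for i
    using that by simp
  show "X \<in> map_vec (residue n) ` carrier row_mod"
  proof (rule image_eqI)
    show "X = map_vec (residue n) (vec d y)"
      using X y by (intro eq_vecI) (auto simp: row_vecs_def)
    show "vec d y \<in> carrier row_mod" using y by (simp add: row_module_simps mem_row_vecs)
  qed
qed (auto simp: row_vecs_def carrier_residue_ring row_module_simps carrier_val_ring)

lemma row_mult_one: "x \<in> carrier_vec d \<Longrightarrow> row_mult x 1 = x"
  by (intro eq_vecI) (simp_all add: row_mult_def entry_one if_distrib cong: if_cong)

lemma row_mult_mult: "row_mult x (y * z) = row_mult (row_mult x y) z"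
proof (rule eq_vecI)
  fix j assume "j < dim_vec (row_mult (row_mult x y) z)"
  then have j: "j < d" by (simp add: row_mult_def)
  then have d: "{..d - 1} = {..<d}" by auto
  have "vec_index (row_mult x (y * z)) j = (\<Sum>i<d. \<Sum>k<d. vec_index x i * entry y i k * entry z k j)"
    using j by (simp add: row_mult_index entry_mult[of j "d - 1"] d sum_distrib_left mult.assoc)
  also have "\<dots> = (\<Sum>k<d. \<Sum>i<d. vec_index x i * entry y i k * entry z k j)" by (rule sum.swap)
  also have "\<dots> = vec_index (row_mult (row_mult x y) z) j"
    using j by (simp add: row_mult_index sum_distrib_right)
  finally show "vec_index (row_mult x (y * z)) j = vec_index (row_mult (row_mult x y) z) j" .
qed (simp add: row_mult_def)

lemma row_mult_diff: "j < d \<Longrightarrow>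
    vec_index (row_mult x (y - z)) j = vec_index (row_mult x y) j - vec_index (row_mult x z) j"
  by (simp add: row_mult_index right_diff_distrib sum_subtractf)

text \<open>A row vector is viewed as an upper triangular matrix supported on its first row, so that
  \<open>annihilates_Exp_iff\<close> applies to it.\<close>

lemma row_as_umat:
  assumes "y \<in> strict"
  shows "umat (\<lambda>i j. if i = 0 \<and> j < d then vec_index x j else 0) * y \<in> ideal_mats n
    \<longleftrightarrow> (\<forall>j<d. vec_index (row_mult x y) j \<in> ideal_pow n)"
proof -
  let ?X = "umat (\<lambda>i j. if i = 0 \<and> j < d then vec_index x j else 0)"
  have in_range: "entry (?X * y) 0 j = vec_index (row_mult x y) j" if "j < d" for j
  proof -
    have "{..d - 1} = {..<d}" using that by auto
    then show ?thesis
      using that by (simp add: entry_mult[of j "d - 1"] row_mult_index entry_umat)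
  qed
  have outside: "entry (?X * y) i j = 0" if "i \<noteq> 0 \<or> d \<le> j" for i j
    unfolding entry_mult[OF order_refl]
  proof (intro sum.neutral ballI)
    fix k
    show "entry ?X i k * entry y k j = 0"
      using that strict_entry_outside[OF assms, of k j] by (cases "i = 0") (simp_all add: entry_umat)
  qed
  show ?thesis
  proof
    assume "?X * y \<in> ideal_mats n"
    then show "\<forall>j<d. vec_index (row_mult x y) j \<in> ideal_pow n"
      by (simp add: ideal_mats_def flip: in_range)
  next
    assume *: "\<forall>j<d. vec_index (row_mult x y) j \<in> ideal_pow n"
    have "entry (?X * y) i j \<in> ideal_pow n" for i j
      using * in_range[of j] outside[of i j] by (cases "i = 0 \<and> j < d") auto
    then show "?X * y \<in> ideal_mats n" by (simp add: ideal_mats_def)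
  qed
qed

text \<open>Since \<open>x exp y - x = x (exp y - 1)\<close>, this is \<open>annihilates_Exp_iff\<close> for row vectors.\<close>

lemma row_fixed_iff:
  assumes x: "x \<in> carrier row_mod" and y: "y \<in> lattice"
  shows "row_act (residue_ring n) d (map_vec (residue n) x) (reduce n (Exp y)) = map_vec (residue n) x
    \<longleftrightarrow> row_mult x y \<in> ideal_rows n"
proof -
  have x': "x \<in> carrier_vec d" using x by (simp add: row_module_simps mem_row_vecs)
  have fixed: "row_act (residue_ring n) d (map_vec (residue n) x) (reduce n e) = map_vec (residue n) x
      \<longleftrightarrow> (\<forall>j<d. vec_index (row_mult x (e - 1)) j \<in> ideal_pow n)" if "e \<in> ideal_mats 0" for e
    unfolding row_act_residue[OF x that] map_residue_eq_iff[OF row_mult_dim x']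
    by (simp add: row_mult_diff row_mult_one x')
  have "row_act (residue_ring n) d (map_vec (residue n) x) (reduce n (Exp y)) = map_vec (residue n) x
      \<longleftrightarrow> (\<forall>j<d. vec_index (row_mult x y) j \<in> ideal_pow n)"
    unfolding fixed[OF ideal_mats_Exp[OF lattice_ideal_mats[OF y]]] row_as_umat[OF Exp_minus_1_strict[OF lattice_strict[OF y]], symmetric]
      row_as_umat[OF lattice_strict[OF y], symmetric]
    by (rule annihilates_Exp_iff[OF lattice_strict[OF y] lattice_ideal_mats[OF y]])
  also have "\<dots> \<longleftrightarrow> row_mult x y \<in> ideal_rows n"
    using row_mult_row_mod[OF x lattice_ideal_mats[OF y]] by (simp add: ideal_rows_def)
  finally show ?thesis .
qed

definition right_mult :: "'k umat \<Rightarrow> 'k vec \<Rightarrow> 'k vec" where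
  "right_mult y = (\<lambda>x\<in>carrier row_mod. row_act (val_ring v) d x (to_mat d y))"

lemma right_mult_eq: "x \<in> carrier row_mod \<Longrightarrow> y \<in> lattice \<Longrightarrow> right_mult y x = row_mult x y"
  by (simp add: right_mult_def row_act_integral lattice_ideal_mats)

lemma right_mult_maps_eq: "right_mult_maps v d \<gg> = right_mult ` lattice"
proof -
  have "right_mult_maps v d (to_mat d ` lattice) = right_mult ` lattice"
    by (simp add: right_mult_maps_def image_image right_mult_def[abs_def])
  then show ?thesis by (simp only: to_mat_lattice)
qed

lemma right_mult_endo:
  assumes y: "y \<in> lattice"
  shows "\<And>x. x \<in> carrier row_mod \<Longrightarrow> right_mult y x \<in> carrier row_mod"
    and "\<And>x x'. x \<in> carrier row_mod \<Longrightarrow> x' \<in> carrier row_mod \<Longrightarrow>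
      right_mult y (x \<oplus>\<^bsub>row_mod\<^esub> x') = right_mult y x \<oplus>\<^bsub>row_mod\<^esub> right_mult y x'"
    and "\<And>x. x \<in> ideal_rows n \<Longrightarrow> right_mult y x \<in> ideal_rows n"
proof -
  show "right_mult y x \<in> carrier row_mod" if "x \<in> carrier row_mod" for x
    using that y by (simp add: right_mult_eq row_mult_row_mod lattice_ideal_mats)
  show "right_mult y (x \<oplus>\<^bsub>row_mod\<^esub> x') = right_mult y x \<oplus>\<^bsub>row_mod\<^esub> right_mult y x'"
    if "x \<in> carrier row_mod" "x' \<in> carrier row_mod" for x x'
  proof -
    have "x \<oplus>\<^bsub>row_mod\<^esub> x' \<in> carrier row_mod"
      using that by (auto simp: row_module_simps mem_row_vecs ideal_pow_add)
    then have "right_mult y (x \<oplus>\<^bsub>row_mod\<^esub> x') = row_mult (x + x') y"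
      using y by (simp add: right_mult_eq row_module_simps)
    also have "\<dots> = row_mult x y + row_mult x' y"
      using that by (intro eq_vecI)
        (auto simp: row_mult_def row_module_simps mem_row_vecs distrib_right sum.distrib)
    finally show ?thesis using that y by (simp add: right_mult_eq row_module_simps(1))
  qed
  show "right_mult y x \<in> ideal_rows n" if "x \<in> ideal_rows n" for x
  proof -
    have x: "x \<in> carrier row_mod" "\<forall>i<d. vec_index x i \<in> ideal_pow n" using that by (simp_all add: ideal_rows_def)
    have "vec_index (row_mult x y) j \<in> ideal_pow n" if "j < d" for j
      using x(2) lattice_ideal_mats[OF y] that by (auto simp: row_mult_index ideal_mats_def intro!: ideal_pow_sum ideal_pow_mult_0(2))
    then show ?thesis using x(1) y by (simp add: right_mult_eq ideal_rows_def row_mult_row_mod lattice_ideal_mats)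
  qed
qed

text \<open>The unit vectors recover the matrix entries from the induced endomorphism.\<close>

lemma induced_right_mult_eq_iff:
  assumes y: "y \<in> lattice" and z: "z \<in> lattice"
  shows "induced_map row_mod (ideal_rows n) (right_mult y) = induced_map row_mod (ideal_rows n) (right_mult z) \<longleftrightarrow> y - z \<in> ideal_mats n"
proof -
  have "induced_map row_mod (ideal_rows n) (right_mult y) = induced_map row_mod (ideal_rows n) (right_mult z)
      \<longleftrightarrow> (\<forall>x\<in>carrier row_mod. \<exists>w\<in>ideal_rows n. right_mult y x = w \<oplus>\<^bsub>row_mod\<^esub> right_mult z x)"
    by (rule induced_map_eq_iff[OF ideal_rows_subgroup right_mult_endo[OF y] right_mult_endo[OF z]])
  also have "\<dots> \<longleftrightarrow> (\<forall>x\<in>carrier row_mod. \<forall>j<d. vec_index (row_mult x (y - z)) j \<in> ideal_pow n)"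
  proof (rule ball_cong[OF refl])
    fix x assume x: "x \<in> carrier row_mod"
    show "(\<exists>w\<in>ideal_rows n. right_mult y x = w \<oplus>\<^bsub>row_mod\<^esub> right_mult z x)
        \<longleftrightarrow> (\<forall>j<d. vec_index (row_mult x (y - z)) j \<in> ideal_pow n)"
      unfolding ideal_rows_translate_iff[OF right_mult_endo(1)[OF y x] right_mult_endo(1)[OF z x]]
      by (simp add: right_mult_eq x y z row_mult_diff)
  qed
  also have "\<dots> \<longleftrightarrow> y - z \<in> ideal_mats n"
  proof
    assume *: "\<forall>x\<in>carrier row_mod. \<forall>j<d. vec_index (row_mult x (y - z)) j \<in> ideal_pow n"
    show "y - z \<in> ideal_mats n"
      unfolding strict_ideal_mats_iff[OF strict_diff[OF lattice_strict[OF y] lattice_strict[OF z]]]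
    proof (intro allI impI)
      fix i j assume ij: "i < d" "j < d"
      have "unit_vec d i \<in> carrier row_mod" using ij by (simp add: row_module_simps mem_row_vecs)
      moreover have "vec_index (row_mult (unit_vec d i) (y - z)) j = entry (y - z) i j"
        using ij by (simp only: row_mult_index)
          (simp add: index_unit_vec if_distrib[of "\<lambda>c. c * _"] cong: if_cong)
      ultimately show "entry (y - z) i j \<in> ideal_pow n" using * ij(2) by metis
    qed
  qed (simp add: row_mult_closed)
  finally show ?thesis .
qed

lemma card_fixed_row_vecs:
  assumes y: "y \<in> lattice"
  shows "card {X \<in> row_vecs (residue_ring n) d. row_act (residue_ring n) d X (reduce n (Exp y)) = X}
    = card (kernel (row_mod A_Mod ideal_rows n) (row_mod A_Mod ideal_rows n) (induced_map row_mod (ideal_rows n) (right_mult y)))"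
proof -
  interpret abelian_subgroup "ideal_rows n" row_mod by (rule ideal_rows_subgroup)
  have "{X \<in> row_vecs (residue_ring n) d. row_act (residue_ring n) d X (reduce n (Exp y)) = X}
      = map_vec (residue n) ` {x \<in> carrier row_mod. row_act (residue_ring n) d (map_vec (residue n) x) (reduce n (Exp y)) = map_vec (residue n) x}"
    unfolding row_vecs_residue_ring by blast
  also have "{x \<in> carrier row_mod. row_act (residue_ring n) d (map_vec (residue n) x) (reduce n (Exp y)) = map_vec (residue n) x}
      = {x \<in> carrier row_mod. right_mult y x \<in> ideal_rows n}"
    by (intro Collect_cong conj_cong refl) (simp only: row_fixed_iff y right_mult_eq)
  finally have "card {X \<in> row_vecs (residue_ring n) d. row_act (residue_ring n) d X (reduce n (Exp y)) = X}
      = card (map_vec (residue n) ` {x \<in> carrier row_mod. right_mult y x \<in> ideal_rows n})" by simp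
  also have "\<dots> = card ((\<lambda>x. ideal_rows n +>\<^bsub>row_mod\<^esub> x) ` {x \<in> carrier row_mod. right_mult y x \<in> ideal_rows n})"
  proof (rule card_image_eq_card_image)
    fix x x' assume "x \<in> {x \<in> carrier row_mod. right_mult y x \<in> ideal_rows n}" "x' \<in> {x \<in> carrier row_mod. right_mult y x \<in> ideal_rows n}"
    then have "x \<in> carrier row_mod" "x' \<in> carrier row_mod" by simp_all
    then show "map_vec (residue n) x = map_vec (residue n) x' \<longleftrightarrow> ideal_rows n +>\<^bsub>row_mod\<^esub> x = ideal_rows n +>\<^bsub>row_mod\<^esub> x'"
      by (simp add: coset_eq_iff ideal_rows_translate_iff map_residue_eq_iff row_module_simps(4) mem_row_vecs)
  qed
  also have "(\<lambda>x. ideal_rows n +>\<^bsub>row_mod\<^esub> x) ` {x \<in> carrier row_mod. right_mult y x \<in> ideal_rows n}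
      = kernel (row_mod A_Mod ideal_rows n) (row_mod A_Mod ideal_rows n) (induced_map row_mod (ideal_rows n) (right_mult y))"
    by (rule kernel_induced_map[OF ideal_rows_subgroup right_mult_endo[OF y], symmetric])
  finally show ?thesis .
qed

lemma orbits_row_vecs:
  "card (orbits (cong_group n) (row_vecs (residue_ring n) d) (\<lambda>g x. row_act (residue_ring n) d x g)) * card (carrier (cong_group n))
    = (\<Sum>g\<in>carrier (cong_group n). card {x \<in> row_vecs (residue_ring n) d. row_act (residue_ring n) d x g = x})"
proof (rule burnside_right[OF group_cong_group finite_cong_group finite_row_vecs])
  fix g X assume "g \<in> carrier (cong_group n)" "X \<in> row_vecs (residue_ring n) d"
  then obtain y x where yx: "y \<in> lattice" "g = reduce n (Exp y)" "x \<in> carrier row_mod" "X = map_vec (residue n) x"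
    unfolding cong_group_simps row_vecs_residue_ring by blast
  then show "row_act (residue_ring n) d X g \<in> row_vecs (residue_ring n) d"
    unfolding row_vecs_residue_ring by (simp add: row_act_residue ideal_mats_Exp lattice_ideal_mats row_mult_row_mod)
next
  fix X assume "X \<in> row_vecs (residue_ring n) d"
  then obtain x where x: "x \<in> carrier row_mod" "X = map_vec (residue n) x"
    unfolding row_vecs_residue_ring by blast
  then show "row_act (residue_ring n) d X \<one>\<^bsub>cong_group n\<^esub> = X"
    by (simp add: cong_group_simps row_act_residue ideal_mats_one row_mult_one row_module_simps mem_row_vecs)
next
  fix g h X assume "g \<in> carrier (cong_group n)" "h \<in> carrier (cong_group n)" "X \<in> row_vecs (residue_ring n) d"
  then obtain y z x where "y \<in> lattice" "g = reduce n (Exp y)" "z \<in> lattice" "h = reduce n (Exp z)" "x \<in> carrier row_mod" "X = map_vec (residue n) x"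
    unfolding cong_group_simps row_vecs_residue_ring by blast
  then show "row_act (residue_ring n) d X (g \<otimes>\<^bsub>cong_group n\<^esub> h) = row_act (residue_ring n) d (row_act (residue_ring n) d X g) h"
    by (simp add: reduce_mult ideal_mats_Exp lattice_ideal_mats row_act_residue ideal_mats_mult_left row_mult_row_mod row_mult_mult)
qed

text \<open>Here the fibres in the comparison of averages are single classes, by
  \<open>induced_right_mult_eq_iff\<close>.\<close>

lemma row_orbits_eq_ask:
  "of_nat (card (orbits (cong_group n) (row_vecs (residue_ring n) d) (\<lambda>g x. row_act (residue_ring n) d x g)))
    = average_kernel_size row_mod (ideal_times_module (val_ring v) (ideal_pow n) row_mod) (right_mult_maps v d \<gg>)"
proof -
  let ?E = "\<lambda>y. reduce n (Exp y)" and ?F = "\<lambda>y. induced_map row_mod (ideal_rows n) (right_mult y)"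
  let ?fix = "\<lambda>g. {x \<in> row_vecs (residue_ring n) d. row_act (residue_ring n) d x g = x}"
  let ?ker = "\<lambda>u. kernel (row_mod A_Mod ideal_rows n) (row_mod A_Mod ideal_rows n) u"
  have "average_kernel_size row_mod (ideal_times_module (val_ring v) (ideal_pow n) row_mod) (right_mult_maps v d \<gg>)
      = inverse (of_nat (card (?F ` lattice))) * (\<Sum>u\<in>?F ` lattice. of_nat (card (?ker u)))"
    unfolding average_kernel_size_def ideal_rows_eq right_mult_maps_eq Let_def image_image by (rule refl)
  also have "\<dots> = inverse (of_nat (card (?E ` lattice))) * (\<Sum>u\<in>?E ` lattice. of_nat (card (?fix u)))"
  proof (rule average_over_images[where N = 1])
    show "finite (?E ` lattice)" using finite_cong_group[of n] by (simp only: cong_group_simps)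
    show "lattice \<noteq> {}" using lattice_zero by blast
    show "?F a = ?F b" if "a \<in> lattice" "b \<in> lattice" "?E a = ?E b" for a b
      using that by (simp only: reduce_Exp_eq_iff induced_right_mult_eq_iff)
    show "card (?E ` {b \<in> lattice. ?F b = ?F a}) = 1" if a: "a \<in> lattice" for a
    proof -
      have "?E ` {b \<in> lattice. ?F b = ?F a} = {?E a}"
      proof (intro equalityI subsetI)
        fix u assume "u \<in> ?E ` {b \<in> lattice. ?F b = ?F a}"
        then obtain b where b: "u = ?E b" "b \<in> lattice" "?F b = ?F a" by blast
        then have "b - a \<in> ideal_mats n" using induced_right_mult_eq_iff[OF b(2) a] by simp
        then show "u \<in> {?E a}" using reduce_Exp_eq_iff[OF b(2) a] b(1) by simp
      qed (use a in blast)
      then show ?thesis by simp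
    qed
    show "of_nat (card (?fix (?E a))) = of_nat (card (?ker (?F a)))" if "a \<in> lattice" for a
      by (simp only: card_fixed_row_vecs that)
  qed
  also have "\<dots> = of_nat (card (orbits (cong_group n) (row_vecs (residue_ring n) d) (\<lambda>g x. row_act (residue_ring n) d x g)))"
  proof -
    have "card (carrier (cong_group n)) \<noteq> 0"
      using finite_cong_group[of n] group.is_monoid[OF group_cong_group[of n], THEN monoid.one_closed] by auto
    moreover have "of_nat (card (orbits (cong_group n) (row_vecs (residue_ring n) d) (\<lambda>g x. row_act (residue_ring n) d x g)))
        * of_nat (card (carrier (cong_group n))) = (\<Sum>u\<in>carrier (cong_group n). of_nat (card (?fix u)) :: rat)"
      using arg_cong[OF orbits_row_vecs[of n], of "of_nat :: nat \<Rightarrow> rat"] by simp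
    ultimately show ?thesis by (simp add: cong_group_simps(1)[symmetric] field_simps)
  qed
  finally show ?thesis by simp
qed

end

context lie_lattice
begin

section \<open>Conjugacy classes\<close>

abbreviation lie_mod :: "('k, 'k mat) module" where "lie_mod \<equiv> lie_module d \<gg>"

lemma lie_module_simps:
  "add lie_mod = (+)" "zero lie_mod = 0\<^sub>m d d" "smult lie_mod = (\<cdot>\<^sub>m)" "carrier lie_mod = \<gg>"
  by (simp_all add: lie_module_def module_mat_def)

lemma to_mat_in_\<gg>: "x \<in> lattice \<Longrightarrow> to_mat d x \<in> \<gg>"
  by (simp add: lattice_def)

lemma in_\<gg>_obtain:
  assumes "A \<in> \<gg>"
  obtains x where "x \<in> lattice" "A = to_mat d x"
proof -
  have "A \<in> to_mat d ` lattice" using assms by (simp only: to_mat_lattice)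
  then show ?thesis using that by blast
qed

lemma module_lie: "module (val_ring v) lie_mod"
proof (rule module_val_ringI)
  show "abelian_group lie_mod"
  proof (rule abelian_groupI)
    fix A assume A: "A \<in> carrier lie_mod"
    then have "(- 1) \<cdot>\<^sub>m A \<in> \<gg>" unfolding lie_module_simps by (intro \<gg>_smult) simp_all
    then show "\<exists>B\<in>carrier lie_mod. B \<oplus>\<^bsub>lie_mod\<^esub> A = \<zero>\<^bsub>lie_mod\<^esub>"
      unfolding lie_module_simps
      by (rule rev_bexI) (use \<gg>_carrier[of A] A in \<open>auto simp: lie_module_simps\<close>)
  next
    fix A B C assume "A \<in> carrier lie_mod" "B \<in> carrier lie_mod" "C \<in> carrier lie_mod"
    then have "A \<in> carrier_mat d d" "B \<in> carrier_mat d d" "C \<in> carrier_mat d d"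
      by (simp_all add: lie_module_simps \<gg>_carrier)
    then show "A \<oplus>\<^bsub>lie_mod\<^esub> B \<oplus>\<^bsub>lie_mod\<^esub> C = A \<oplus>\<^bsub>lie_mod\<^esub> (B \<oplus>\<^bsub>lie_mod\<^esub> C)"
      unfolding lie_module_simps by (rule assoc_add_mat)
  next
    fix A B assume "A \<in> carrier lie_mod" "B \<in> carrier lie_mod"
    then have "A \<in> carrier_mat d d" "B \<in> carrier_mat d d"
      by (simp_all add: lie_module_simps \<gg>_carrier)
    then show "A \<oplus>\<^bsub>lie_mod\<^esub> B = B \<oplus>\<^bsub>lie_mod\<^esub> A"
      unfolding lie_module_simps by (rule comm_add_mat)
  next
    fix A assume "A \<in> carrier lie_mod"
    then show "\<zero>\<^bsub>lie_mod\<^esub> \<oplus>\<^bsub>lie_mod\<^esub> A = A"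
      using \<gg>_carrier[of A] by (simp add: lie_module_simps)
  qed (simp_all add: lie_module_simps \<gg>_add \<gg>_zero)
next
  fix a b and A assume "A \<in> carrier lie_mod"
  then have A: "A \<in> carrier_mat d d" by (simp add: lie_module_simps \<gg>_carrier)
  show "(a + b) \<odot>\<^bsub>lie_mod\<^esub> A = a \<odot>\<^bsub>lie_mod\<^esub> A \<oplus>\<^bsub>lie_mod\<^esub> b \<odot>\<^bsub>lie_mod\<^esub> A"
    using A unfolding lie_module_simps by (intro eq_matI) (simp_all add: distrib_right)
  show "(a * b) \<odot>\<^bsub>lie_mod\<^esub> A = a \<odot>\<^bsub>lie_mod\<^esub> (b \<odot>\<^bsub>lie_mod\<^esub> A)"
    using A unfolding lie_module_simps by (intro eq_matI) simp_all
  show "1 \<odot>\<^bsub>lie_mod\<^esub> A = A"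
    using A unfolding lie_module_simps by (intro eq_matI) simp_all
next
  fix a and A B assume "A \<in> carrier lie_mod" "B \<in> carrier lie_mod"
  then have "A \<in> carrier_mat d d" "B \<in> carrier_mat d d"
    by (simp_all add: lie_module_simps \<gg>_carrier)
  then show "a \<odot>\<^bsub>lie_mod\<^esub> (A \<oplus>\<^bsub>lie_mod\<^esub> B) = a \<odot>\<^bsub>lie_mod\<^esub> A \<oplus>\<^bsub>lie_mod\<^esub> a \<odot>\<^bsub>lie_mod\<^esub> B"
    unfolding lie_module_simps by (intro eq_matI) (auto simp: distrib_left)
qed (simp add: lie_module_simps \<gg>_smult)

definition ideal_lattice :: "nat \<Rightarrow> 'k mat set" where
  "ideal_lattice n = to_mat d ` (lattice \<inter> ideal_mats n)"

text \<open>Isolation identifies the multiples of the \<open>n\<close>-th power of the uniformizer in the lattice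
  with the elements that are congruent to zero.\<close>

lemma ideal_lattice_eq: "ideal_times_module (val_ring v) (ideal_pow n) lie_mod = ideal_lattice n"
  and ideal_lattice_subgroup: "abelian_subgroup (ideal_lattice n) lie_mod"
proof -
  obtain \<pi> where \<pi>0: "\<pi> \<noteq> 0" and \<pi>: "\<pi> \<in> ideal_pow n" "\<And>x. x \<in> ideal_pow (n + 0) \<Longrightarrow> \<exists>y\<in>ideal_pow 0. x = \<pi> * y"
    using uniformizer_power[of n 0] by blast
  have \<pi>O: "\<pi> \<in> ideal_pow 0" by (rule subsetD[OF ideal_pow_subset \<pi>(1)])
  note * = ideal_times_module_eq[OF module_lie \<pi>(1) \<pi>(2)[unfolded add_0_right]]
  have "(\<lambda>A. \<pi> \<odot>\<^bsub>lie_mod\<^esub> A) ` carrier lie_mod = ideal_lattice n"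
  proof (intro equalityI subsetI)
    fix A assume "A \<in> (\<lambda>A. \<pi> \<odot>\<^bsub>lie_mod\<^esub> A) ` carrier lie_mod"
    then obtain B where B: "B \<in> \<gg>" "A = \<pi> \<cdot>\<^sub>m B" unfolding lie_module_simps by (rule imageE)
    from B(1) obtain x where x: "x \<in> lattice" "B = to_mat d x" by (rule in_\<gg>_obtain)
    have "scalar_umat \<pi> * x \<in> ideal_mats n"
      using lattice_ideal_mats[OF x(1)] \<pi>(1) by (simp add: ideal_mats_def ideal_pow_mult_0)
    then show "A \<in> ideal_lattice n"
      unfolding ideal_lattice_def using x(1) B(2) x(2) lattice_scale[OF \<pi>O x(1)]
      by (intro image_eqI[of _ _ "scalar_umat \<pi> * x"]) (simp_all add: to_mat_scale)
  next
    fix A assume "A \<in> ideal_lattice n"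
    then obtain x where x: "A = to_mat d x" "x \<in> lattice" "x \<in> ideal_mats n" unfolding ideal_lattice_def by blast
    define y where "y = scalar_umat (inverse \<pi>) * x"
    have xy: "x = scalar_umat \<pi> * y" unfolding y_def using \<pi>0 by (intro umat_eqI) simp
    have "y \<in> ideal_mats 0"
      unfolding ideal_mats_def
    proof (intro CollectI allI)
      fix i j
      have "entry x i j \<in> ideal_pow (n + 0)" using x(3) by (simp add: ideal_mats_def)
      from \<pi>(2)[OF this] obtain c where "c \<in> ideal_pow 0" "entry x i j = \<pi> * c" by (rule bexE)
      then show "entry y i j \<in> ideal_pow 0" using \<pi>0 by (simp add: y_def mult.assoc[symmetric])
    qed
    moreover have "y \<in> strict" unfolding y_def by (rule umat.N_scale[OF lattice_strict[OF x(2)]])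
    ultimately have "y \<in> lattice" using lattice_isolated[of y \<pi>] \<pi>O \<pi>0 x(2) xy by simp
    then show "A \<in> (\<lambda>A. \<pi> \<odot>\<^bsub>lie_mod\<^esub> A) ` carrier lie_mod"
      unfolding lie_module_simps x(1) xy to_mat_scale by (intro imageI to_mat_in_\<gg>)
  qed
  with * show "ideal_times_module (val_ring v) (ideal_pow n) lie_mod = ideal_lattice n" "abelian_subgroup (ideal_lattice n) lie_mod" by simp_all
qed

lemma to_mat_inj: "x \<in> strict \<Longrightarrow> y \<in> strict \<Longrightarrow> to_mat d x = to_mat d y \<Longrightarrow> x = y"
  by (metis of_mat_to_mat)

lemma to_mat_ideal_lattice_iff: assumes "x \<in> lattice" shows "to_mat d x \<in> ideal_lattice n \<longleftrightarrow> x \<in> ideal_mats n"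
proof
  assume "to_mat d x \<in> ideal_lattice n"
  then obtain y where "to_mat d x = to_mat d y" "y \<in> lattice" "y \<in> ideal_mats n" unfolding ideal_lattice_def by blast
  then show "x \<in> ideal_mats n" using to_mat_inj[OF lattice_strict lattice_strict, of x y] assms by simp
qed (use assms in \<open>simp add: ideal_lattice_def\<close>)

lemma ideal_lattice_translate_iff:
  assumes "x \<in> lattice" "y \<in> lattice"
  shows "(\<exists>w\<in>ideal_lattice n. to_mat d x = w \<oplus>\<^bsub>lie_mod\<^esub> to_mat d y) \<longleftrightarrow> x - y \<in> ideal_mats n"
proof
  assume "\<exists>w\<in>ideal_lattice n. to_mat d x = w \<oplus>\<^bsub>lie_mod\<^esub> to_mat d y"
  then obtain u where u: "to_mat d x = to_mat d (u + y)" "u \<in> lattice" "u \<in> ideal_mats n"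
    unfolding ideal_lattice_def lie_module_simps to_mat_add by blast
  have "x = u + y" using assms u by (intro to_mat_inj lattice_strict lattice_add) simp_all
  then show "x - y \<in> ideal_mats n" using u by simp
next
  assume "x - y \<in> ideal_mats n"
  then have "to_mat d (x - y) \<in> ideal_lattice n" using assms by (simp add: to_mat_ideal_lattice_iff lattice_diff)
  moreover have "to_mat d x = to_mat d (x - y) \<oplus>\<^bsub>lie_mod\<^esub> to_mat d y"
    unfolding lie_module_simps to_mat_add[symmetric] by simp
  ultimately show "\<exists>w\<in>ideal_lattice n. to_mat d x = w \<oplus>\<^bsub>lie_mod\<^esub> to_mat d y" by (rule rev_bexI)
qed

definition ad :: "'k umat \<Rightarrow> 'k mat \<Rightarrow> 'k mat" where
  "ad a = (\<lambda>B\<in>\<gg>. B * to_mat d a - to_mat d a * B)"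

lemma ad_maps_eq: "ad_maps \<gg> = ad ` lattice"
proof -
  have "ad_maps \<gg> = (\<lambda>A. \<lambda>B\<in>\<gg>. B * A - A * B) ` to_mat d ` lattice"
    by (simp only: ad_maps_def to_mat_lattice)
  then show ?thesis by (simp add: image_image ad_def[abs_def])
qed

lemma ad_to_mat: "x \<in> lattice \<Longrightarrow> ad a (to_mat d x) = to_mat d (bracket x a)"
  by (simp add: ad_def to_mat_in_\<gg> bracket_def to_mat_diff to_mat_mult)

lemma lattice_bracket': "x \<in> lattice \<Longrightarrow> y \<in> lattice \<Longrightarrow> bracket x y \<in> lattice"
  unfolding bracket_def by (rule lattice_bracket)

lemma bracket_add: "bracket (x + y) a = bracket x a + bracket y a"
  and bracket_diff_right: "bracket x (a - b) = bracket x a - bracket x b"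
  for x y a b :: "'k umat"
  by (simp_all add: bracket_def algebra_simps)

lemma ad_endo:
  assumes a: "a \<in> lattice"
  shows "\<And>A. A \<in> carrier lie_mod \<Longrightarrow> ad a A \<in> carrier lie_mod"
    and "\<And>A B. A \<in> carrier lie_mod \<Longrightarrow> B \<in> carrier lie_mod \<Longrightarrow> ad a (A \<oplus>\<^bsub>lie_mod\<^esub> B) = ad a A \<oplus>\<^bsub>lie_mod\<^esub> ad a B"
    and "\<And>A. A \<in> ideal_lattice n \<Longrightarrow> ad a A \<in> ideal_lattice n"
proof -
  show "ad a A \<in> carrier lie_mod" if "A \<in> carrier lie_mod" for A
  proof -
    from that have "A \<in> \<gg>" by (simp only: lie_module_simps)
    then obtain x where "x \<in> lattice" "A = to_mat d x" by (rule in_\<gg>_obtain)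
    then show ?thesis using a by (simp add: ad_to_mat lie_module_simps to_mat_in_\<gg> lattice_bracket')
  qed
  show "ad a (A \<oplus>\<^bsub>lie_mod\<^esub> B) = ad a A \<oplus>\<^bsub>lie_mod\<^esub> ad a B" if "A \<in> carrier lie_mod" "B \<in> carrier lie_mod" for A B
  proof -
    from that have "A \<in> \<gg>" "B \<in> \<gg>" by (simp_all only: lie_module_simps)
    from \<open>A \<in> \<gg>\<close> obtain x where x: "x \<in> lattice" "A = to_mat d x" by (rule in_\<gg>_obtain)
    from \<open>B \<in> \<gg>\<close> obtain y where y: "y \<in> lattice" "B = to_mat d y" by (rule in_\<gg>_obtain)
    show ?thesis
      using x(1) y(1) by (simp add: lie_module_simps x(2) y(2) ad_to_mat lattice_add bracket_add flip: to_mat_add)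
  qed
  show "ad a A \<in> ideal_lattice n" if "A \<in> ideal_lattice n" for A
  proof -
    from that obtain x where x: "A = to_mat d x" "x \<in> lattice" "x \<in> ideal_mats n" unfolding ideal_lattice_def by blast
    have "bracket x a \<in> ideal_mats n"
      unfolding bracket_def using x(3) lattice_ideal_mats[OF a] by (intro ideal_mats_diff ideal_mats_mult_left ideal_mats_mult_right)
    then show ?thesis using x a by (simp add: ad_to_mat to_mat_ideal_lattice_iff lattice_bracket')
  qed
qed

lemma induced_ad_eq_iff:
  assumes a: "a \<in> lattice" and b: "b \<in> lattice"
  shows "induced_map lie_mod (ideal_lattice n) (ad a) = induced_map lie_mod (ideal_lattice n) (ad b)
    \<longleftrightarrow> (\<forall>x\<in>lattice. bracket x (a - b) \<in> ideal_mats n)"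
proof -
  have "induced_map lie_mod (ideal_lattice n) (ad a) = induced_map lie_mod (ideal_lattice n) (ad b)
      \<longleftrightarrow> (\<forall>A\<in>carrier lie_mod. \<exists>w\<in>ideal_lattice n. ad a A = w \<oplus>\<^bsub>lie_mod\<^esub> ad b A)"
    by (rule induced_map_eq_iff[OF ideal_lattice_subgroup ad_endo[OF a] ad_endo[OF b]])
  also have "\<dots> \<longleftrightarrow> (\<forall>A\<in>to_mat d ` lattice. \<exists>w\<in>ideal_lattice n. ad a A = w \<oplus>\<^bsub>lie_mod\<^esub> ad b A)"
    by (simp only: to_mat_lattice lie_module_simps(4))
  also have "\<dots> \<longleftrightarrow> (\<forall>x\<in>lattice. \<exists>w\<in>ideal_lattice n. to_mat d (bracket x a) = w \<oplus>\<^bsub>lie_mod\<^esub> to_mat d (bracket x b))"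
    by (simp add: ad_to_mat)
  also have "\<dots> \<longleftrightarrow> (\<forall>x\<in>lattice. bracket x (a - b) \<in> ideal_mats n)"
  proof (rule ball_cong[OF refl])
    fix x assume "x \<in> lattice"
    then show "(\<exists>w\<in>ideal_lattice n. to_mat d (bracket x a) = w \<oplus>\<^bsub>lie_mod\<^esub> to_mat d (bracket x b))
        \<longleftrightarrow> bracket x (a - b) \<in> ideal_mats n"
      using a b by (simp add: ideal_lattice_translate_iff lattice_bracket' bracket_diff_right)
  qed
  finally show ?thesis .
qed

text \<open>Elements commuting with \<open>exp a\<close> modulo the \<open>n\<close>-th power are the \<open>exp b\<close> with \<open>[b, a]\<close>
  congruent to zero, and \<open>exp b\<close> has the same residue class as \<open>exp c\<close> exactly when \<open>b\<close> and \<open>c\<close>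
  have the same coset.\<close>

lemma card_centralizer:
  assumes a: "a \<in> lattice"
  shows "card {h \<in> carrier (cong_group n). reduce n (Exp a) \<otimes>\<^bsub>cong_group n\<^esub> h = h \<otimes>\<^bsub>cong_group n\<^esub> reduce n (Exp a)}
    = card (kernel (lie_mod A_Mod ideal_lattice n) (lie_mod A_Mod ideal_lattice n) (induced_map lie_mod (ideal_lattice n) (ad a)))"
proof -
  interpret abelian_subgroup "ideal_lattice n" lie_mod by (rule ideal_lattice_subgroup)
  have comm: "reduce n (Exp a) \<otimes>\<^bsub>cong_group n\<^esub> reduce n (Exp b) = reduce n (Exp b) \<otimes>\<^bsub>cong_group n\<^esub> reduce n (Exp a) \<longleftrightarrow> bracket b a \<in> ideal_mats n"
    if b: "b \<in> lattice" for b
  proof -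
    have strict: "Exp b * Exp a - Exp a * Exp b \<in> strict"
    proof -
      have "Exp b * Exp a - Exp a * Exp b
          = (Exp b - 1) * (Exp a - 1) - (Exp a - 1) * (Exp b - 1)" by (simp add: algebra_simps)
      also have "\<dots> \<in> strict" using a b by (intro strict_diff strict_mult Exp_minus_1_strict lattice_strict)
      finally show ?thesis .
    qed
    have "reduce n (Exp a) \<otimes>\<^bsub>cong_group n\<^esub> reduce n (Exp b) = reduce n (Exp b) \<otimes>\<^bsub>cong_group n\<^esub> reduce n (Exp a)
        \<longleftrightarrow> reduce n (Exp b * Exp a) = reduce n (Exp a * Exp b)"
      using reduce_mult[OF ideal_mats_Exp ideal_mats_Exp, OF lattice_ideal_mats lattice_ideal_mats, of a b n] reduce_mult[OF ideal_mats_Exp ideal_mats_Exp, OF lattice_ideal_mats lattice_ideal_mats, of b a n] a b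
      by (simp only: eq_commute)
    also have "\<dots> \<longleftrightarrow> Exp b * Exp a - Exp a * Exp b \<in> ideal_mats n" by (rule reduce_eq_iff_ideal_mats[OF strict])
    also have "\<dots> \<longleftrightarrow> bracket b a \<in> ideal_mats n"
      unfolding bracket_def using a b by (intro Exps_commute_iff lattice_strict lattice_ideal_mats)
    finally show ?thesis .
  qed
  have "{h \<in> carrier (cong_group n). reduce n (Exp a) \<otimes>\<^bsub>cong_group n\<^esub> h = h \<otimes>\<^bsub>cong_group n\<^esub> reduce n (Exp a)}
      = (\<lambda>b. reduce n (Exp b)) ` {b \<in> lattice. reduce n (Exp a) \<otimes>\<^bsub>cong_group n\<^esub> reduce n (Exp b) = reduce n (Exp b) \<otimes>\<^bsub>cong_group n\<^esub> reduce n (Exp a)}"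
    unfolding cong_group_simps(1) by blast
  also have "{b \<in> lattice. reduce n (Exp a) \<otimes>\<^bsub>cong_group n\<^esub> reduce n (Exp b) = reduce n (Exp b) \<otimes>\<^bsub>cong_group n\<^esub> reduce n (Exp a)}
      = {b \<in> lattice. bracket b a \<in> ideal_mats n}"
    by (intro Collect_cong conj_cong refl comm)
  finally have "card {h \<in> carrier (cong_group n). reduce n (Exp a) \<otimes>\<^bsub>cong_group n\<^esub> h = h \<otimes>\<^bsub>cong_group n\<^esub> reduce n (Exp a)}
      = card ((\<lambda>b. reduce n (Exp b)) ` {b \<in> lattice. bracket b a \<in> ideal_mats n})" by simp
  also have "\<dots> = card ((\<lambda>b. ideal_lattice n +>\<^bsub>lie_mod\<^esub> to_mat d b) ` {b \<in> lattice. bracket b a \<in> ideal_mats n})"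
  proof (rule card_image_eq_card_image)
    fix b c assume "b \<in> {b \<in> lattice. bracket b a \<in> ideal_mats n}" "c \<in> {b \<in> lattice. bracket b a \<in> ideal_mats n}"
    then have bc: "b \<in> lattice" "c \<in> lattice" by simp_all
    then have "to_mat d b \<in> carrier lie_mod" "to_mat d c \<in> carrier lie_mod" by (simp_all add: lie_module_simps to_mat_in_\<gg>)
    then show "reduce n (Exp b) = reduce n (Exp c) \<longleftrightarrow> ideal_lattice n +>\<^bsub>lie_mod\<^esub> to_mat d b = ideal_lattice n +>\<^bsub>lie_mod\<^esub> to_mat d c"
      using bc by (simp only: reduce_Exp_eq_iff coset_eq_iff ideal_lattice_translate_iff)
  qed
  also have "(\<lambda>b. ideal_lattice n +>\<^bsub>lie_mod\<^esub> to_mat d b) ` {b \<in> lattice. bracket b a \<in> ideal_mats n}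
      = (\<lambda>A. ideal_lattice n +>\<^bsub>lie_mod\<^esub> A) ` {A \<in> carrier lie_mod. ad a A \<in> ideal_lattice n}"
  proof -
    have "{A \<in> to_mat d ` lattice. ad a A \<in> ideal_lattice n} = to_mat d ` {b \<in> lattice. ad a (to_mat d b) \<in> ideal_lattice n}" by blast
    also have "{b \<in> lattice. ad a (to_mat d b) \<in> ideal_lattice n} = {b \<in> lattice. bracket b a \<in> ideal_mats n}"
      using a by (intro Collect_cong conj_cong refl) (simp add: ad_to_mat to_mat_ideal_lattice_iff lattice_bracket')
    finally have "{A \<in> carrier lie_mod. ad a A \<in> ideal_lattice n} = to_mat d ` {b \<in> lattice. bracket b a \<in> ideal_mats n}"
      by (simp only: to_mat_lattice lie_module_simps(4))
    then show ?thesis by (simp only: image_image)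
  qed
  also have "\<dots> = kernel (lie_mod A_Mod ideal_lattice n) (lie_mod A_Mod ideal_lattice n) (induced_map lie_mod (ideal_lattice n) (ad a))"
    by (rule kernel_induced_map[OF ideal_lattice_subgroup ad_endo[OF a], symmetric])
  finally show ?thesis .
qed

text \<open>Elements of the lattice that differ by an element acting trivially under the adjoint action
  induce the same endomorphism. As \<open>ad\<close> is additive, the fibres are translates of one another.\<close>

lemma class_number_eq_ask:
  "of_nat (class_number (cong_group n))
    = average_kernel_size lie_mod (ideal_times_module (val_ring v) (ideal_pow n) lie_mod) (ad_maps \<gg>)"
proof -
  let ?E = "\<lambda>y. reduce n (Exp y)" and ?F = "\<lambda>y. induced_map lie_mod (ideal_lattice n) (ad y)"
  let ?cent = "\<lambda>g. {h \<in> carrier (cong_group n). g \<otimes>\<^bsub>cong_group n\<^esub> h = h \<otimes>\<^bsub>cong_group n\<^esub> g}"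
  let ?ker = "\<lambda>u. kernel (lie_mod A_Mod ideal_lattice n) (lie_mod A_Mod ideal_lattice n) u"
  have "average_kernel_size lie_mod (ideal_times_module (val_ring v) (ideal_pow n) lie_mod) (ad_maps \<gg>)
      = inverse (of_nat (card (?F ` lattice))) * (\<Sum>u\<in>?F ` lattice. of_nat (card (?ker u)))"
    unfolding average_kernel_size_def ideal_lattice_eq ad_maps_eq Let_def image_image by (rule refl)
  also have "\<dots> = inverse (of_nat (card (?E ` lattice))) * (\<Sum>u\<in>?E ` lattice. of_nat (card (?cent u)))"
  proof (rule average_over_images[where N = "card (?E ` {b \<in> lattice. ?F b = ?F 0})"])
    show "finite (?E ` lattice)" using finite_cong_group[of n] by (simp only: cong_group_simps)
    show "lattice \<noteq> {}" using lattice_zero by blast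
    show "?F a = ?F b" if ab: "a \<in> lattice" "b \<in> lattice" "?E a = ?E b" for a b
    proof -
      have "a - b \<in> ideal_mats n" using ab by (simp only: reduce_Exp_eq_iff)
      then have "bracket x (a - b) \<in> ideal_mats n" if "x \<in> lattice" for x
        unfolding bracket_def by (intro ideal_mats_diff[OF ideal_mats_mult_left ideal_mats_mult_right] lattice_ideal_mats[OF that])
      then show ?thesis using ab by (simp only: induced_ad_eq_iff) simp
    qed
    \<comment> \<open>the fibre over \<open>a\<close> is the translate by \<open>a\<close> of the fibre over zero\<close>
    show "card (?E ` {b \<in> lattice. ?F b = ?F a}) = card (?E ` {b \<in> lattice. ?F b = ?F 0})" if a: "a \<in> lattice" for a
    proof -
      have "card (?E ` {b \<in> lattice. ?F b = ?F a}) = card ((\<lambda>b. ?E (b - a)) ` {b \<in> lattice. ?F b = ?F a})"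
      proof (rule card_image_eq_card_image)
        fix b c assume "b \<in> {b \<in> lattice. ?F b = ?F a}" "c \<in> {b \<in> lattice. ?F b = ?F a}"
        then have "b \<in> lattice" "c \<in> lattice" by simp_all
        then show "?E b = ?E c \<longleftrightarrow> ?E (b - a) = ?E (c - a)"
          using a by (simp add: reduce_Exp_eq_iff lattice_diff)
      qed
      also have "(\<lambda>b. ?E (b - a)) ` {b \<in> lattice. ?F b = ?F a} = ?E ` (\<lambda>b. b - a) ` {b \<in> lattice. ?F b = ?F a}"
        by (simp only: image_image)
      also have "(\<lambda>b. b - a) ` {b \<in> lattice. ?F b = ?F a} = {b \<in> lattice. ?F b = ?F 0}"
      proof (intro equalityI subsetI)
        fix c assume "c \<in> (\<lambda>b. b - a) ` {b \<in> lattice. ?F b = ?F a}"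
        then obtain b where "c = b - a" "b \<in> lattice" "?F b = ?F a" by blast
        then show "c \<in> {b \<in> lattice. ?F b = ?F 0}"
          using a by (simp add: induced_ad_eq_iff lattice_diff lattice_zero)
      next
        fix c assume "c \<in> {b \<in> lattice. ?F b = ?F 0}"
        then have "c \<in> lattice" "?F c = ?F 0" by simp_all
        then show "c \<in> (\<lambda>b. b - a) ` {b \<in> lattice. ?F b = ?F a}"
          using a by (intro image_eqI[of _ _ "c + a"]) (simp_all add: induced_ad_eq_iff lattice_add lattice_zero)
      qed
      finally show ?thesis .
    qed
    show "of_nat (card (?cent (?E a))) = of_nat (card (?ker (?F a)))" if "a \<in> lattice" for a
      by (simp only: card_centralizer that)
  qed
  also have "\<dots> = of_nat (class_number (cong_group n))"
  proof -
    have "card (carrier (cong_group n)) \<noteq> 0"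
      using finite_cong_group[of n] group.is_monoid[OF group_cong_group[of n], THEN monoid.one_closed] by auto
    moreover have "of_nat (class_number (cong_group n)) * of_nat (card (carrier (cong_group n)))
        = (\<Sum>u\<in>carrier (cong_group n). of_nat (card (?cent u)) :: rat)"
      using arg_cong[OF class_number_eq[OF group_cong_group finite_cong_group, of n], of "of_nat :: nat \<Rightarrow> rat"] by simp
    ultimately show ?thesis by (simp add: cong_group_simps(1)[symmetric] field_simps)
  qed
  finally show ?thesis by simp
qed

end



section \<open>Equality of the zeta functions\<close>

theorem theorem1p7:
  fixes v :: "'k::field_char_0 \<Rightarrow> int" and p d :: nat and \<gg> G :: "'k mat set"
  assumes "nonarch_local_field v"
    and "has_characteristic (val_ring v Quot max_ideal v) p"
    and "lie_subalgebra v d \<gg>"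
    and "G = nilpotent_exp d ` \<gg>"
    and "d \<le> p"
    and "isolated_submodule (val_ring v) (strict_upper_module v d) \<gg>"
  shows "subgroup G (unitriangular v d) \<and>
    oc_zeta (val_ring v) (max_ideal v) d G =
      ask_zeta (val_ring v) (max_ideal v) (row_module v d) (right_mult_maps v d \<gg>) \<and>
    cc_zeta (val_ring v) (max_ideal v) d G =
      ask_zeta (val_ring v) (max_ideal v) (lie_module d \<gg>) (ad_maps \<gg>)"
proof -
  interpret nonarch_local_field v by fact
  interpret lie_lattice v p d \<gg>
    by unfold_locales (fact assms)+
  have G: "lie_lattice.exp_group d \<gg> = G"
    by (simp add: exp_group_def assms(4))
  show ?thesis
    using subgroup_exp_group
    by (simp add: oc_zeta_def cc_zeta_def ask_zeta_def ideal_power_eq Let_def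
        row_orbits_eq_ask[unfolded G] class_number_eq_ask[unfolded G] G)
qed

end
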